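(* Let $G$ be a connected reduced graph on $n\geq 6$ vertices with $m$ edges, and let $c=m-n+1$ be the first Betti number (cyclomatic number) of $G$. Then $$m_{L(G)}(1)\leq c+\frac{n-2}{4},$$ and equality holds if and only if either $G$ is the cycle $C_6$ (with $c=1$), or $G$ is a tree (with $c=0$) satisfying the following two conditions: (i) each vertex of degree greater than $2$ is a quasi-pendant vertex in $G$; (ii) each of the final reduction components of $G$ is a path $P_6$.
   Context: All graphs are finite, simple and undirected. $P_k$ and $C_k$ denote the path and the cycle on $k$ vertices. The Laplacian matrix of a graph $G$ is $L(G)=D(G)-A(G)$, where $D(G)$ is the diagonal matrix of vertex degrees and $A(G)$ is the adjacency matrix; $m_{L(G)}(1)$ denotes the multiplicity of $1$ as an eigenvalue of $L(G)$ (with value $0$ if $1$ is not an eigenvalue). A pendant vertex is a vertex of degree $1$; a quasi-pendant vertex is a vertex adjacent to a pendant vertex. Let $p(G)$ and $q(G)$ be the numbers of pendant and quasi-pendant vertices of $G$. The graph $G$ is called reduced if $p(G)=q(G)$, i.e. every quasi-pendant vertex is adjacent to exactly one pendant vertex. Reduction operation: let $u$ be a pendant vertex of a graph $G$ with neighbor $v$, and let $N_G(v)\setminus\{u\}=\{v_1,\dots,v_s\}$ be the other neighbors of $v$. Form $G-\{u,v\}$ and, for each $i=1,\dots,s$, add a new disjoint copy of the path $P_2$ and join $v_i$ by an edge to one vertex of that copy. The resulting graph is the reduction graph of $G$ with respect to $u$ and $v$. (If $v$ has degree $2$, the operation yields a graph isomorphic to $G$.) Performing the reduction operation repeatedly,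 at quasi-pendant vertices of degree greater than $2$, until each quasi-pendant vertex has degree $2$, one obtains the final reduction graph of $G$; its connected components are called the final reduction components of $G$. (If every quasi-pendant vertex of $G$ already has degree $2$, the final reduction graph is $G$ itself.) *)

theory Defs
  imports
    "Graph_Theory.Digraph_Component"
    "Graph_Theory.Digraph_Isomorphism"
    "Jordan_Normal_Form.Char_Poly"
begin

text \<open>
  A finite simple undirected graph is a \<^locale>\<open>pair_graph\<close>: a finite symmetric loop-free digraph
  without parallel arcs, so that each undirected edge is represented by two opposite arcs.
\<close>

definition edges :: "'a pair_pre_digraph \<Rightarrow> 'a set set" where
  "edges G = (\<lambda>(u, v). {u, v}) ` parcs G"

definition nbrs :: "'a pair_pre_digraph \<Rightarrow> 'a \<Rightarrow> 'a set" where
  "nbrs G v = {w. (v, w) \<in> parcs G}"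

text \<open>In a symmetric digraph the out-degree is the degree of the underlying undirected graph.\<close>

abbreviation deg :: "'a pair_pre_digraph \<Rightarrow> 'a \<Rightarrow> nat" where
  "deg G v \<equiv> out_degree (with_proj G) v"

abbreviation connected_graph :: "'a pair_pre_digraph \<Rightarrow> bool" where
  "connected_graph G \<equiv> Digraph_Component.connected (with_proj G)"

abbreviation graph_iso :: "'a pair_pre_digraph \<Rightarrow> 'b pair_pre_digraph \<Rightarrow> bool" where
  "graph_iso G H \<equiv> digraph_iso (with_proj G) (with_proj H)"

text \<open>The path and the cycle on \<open>k\<close> vertices; the latter is only meaningful for \<open>k \<ge> 3\<close>.\<close>

definition path_graph :: "nat \<Rightarrow> nat pair_pre_digraph" where
  "path_graph k = \<lparr> pverts = {..<k},
     parcs = {(i, j). i < k \<and> j < k \<and> (j = i + 1 \<or> i = j + 1)} \<rparr>"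

definition cycle_graph :: "nat \<Rightarrow> nat pair_pre_digraph" where
  "cycle_graph k = \<lparr> pverts = {..<k},
     parcs = {(i, j). i < k \<and> j < k \<and> (j = (i + 1) mod k \<or> i = (j + 1) mod k)} \<rparr>"

text \<open>
  \<^const>\<open>tree\<close> of the digraph library cannot be used here: it counts a pair of opposite arcs as a
  cycle, so a symmetric digraph with an arc is never a tree in that sense.
\<close>

definition tree_graph :: "'a pair_pre_digraph \<Rightarrow> bool" where
  "tree_graph G \<longleftrightarrow> connected_graph G \<and>
     \<not> (\<exists>k\<ge>3. \<exists>H. subgraph (with_proj H) (with_proj G) \<and> graph_iso H (cycle_graph k))"

text \<open>
  Matrices are indexed by numbers, so the vertices are enumerated in an arbitrary order. Another
  order conjugates the Laplacian by a permutation matrix, which leaves the characteristic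
  polynomial unchanged.
\<close>

definition vert_list :: "'a pair_pre_digraph \<Rightarrow> 'a list" where
  "vert_list G = (SOME vs. distinct vs \<and> set vs = pverts G)"

definition adjacency_mat :: "'a pair_pre_digraph \<Rightarrow> real mat" where
  "adjacency_mat G = (let vs = vert_list G in
     mat (length vs) (length vs) (\<lambda>(i, j). if (vs ! i, vs ! j) \<in> parcs G then 1 else 0))"

definition degree_mat :: "'a pair_pre_digraph \<Rightarrow> real mat" where
  "degree_mat G = (let vs = vert_list G in
     mat (length vs) (length vs) (\<lambda>(i, j). if i = j then real (deg G (vs ! i)) else 0))"

definition laplacian_mat :: "'a pair_pre_digraph \<Rightarrow> real mat" where
  "laplacian_mat G = degree_mat G - adjacency_mat G"

definition laplacian_mult :: "'a pair_pre_digraph \<Rightarrow> real \<Rightarrow> nat" where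
  "laplacian_mult G x = Polynomial.order x (char_poly (laplacian_mat G))"

definition pendant_verts :: "'a pair_pre_digraph \<Rightarrow> 'a set" where
  "pendant_verts G = {u \<in> pverts G. deg G u = 1}"

definition quasi_pendant_verts :: "'a pair_pre_digraph \<Rightarrow> 'a set" where
  "quasi_pendant_verts G = {v \<in> pverts G. \<exists>u \<in> pendant_verts G. (v, u) \<in> parcs G}"

definition reduced :: "'a pair_pre_digraph \<Rightarrow> bool" where
  "reduced G \<longleftrightarrow> card (pendant_verts G) = card (quasi_pendant_verts G)"

text \<open>
  \<open>H\<close> is a reduction graph of \<open>G\<close> with respect to the pendant vertex \<open>u\<close> and its neighbour \<open>v\<close>.
  The copy of the path on two vertices that belongs to the neighbour \<open>w\<close> of \<open>v\<close> has the new
  vertices \<open>a w\<close> and \<open>b w\<close>, and \<open>w\<close> is joined to \<open>a w\<close>.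
\<close>

definition reduction_graph ::
    "'a pair_pre_digraph \<Rightarrow> 'a \<Rightarrow> 'a \<Rightarrow> 'a pair_pre_digraph \<Rightarrow> bool" where
  "reduction_graph G u v H \<longleftrightarrow>
     u \<in> pendant_verts G \<and> (u, v) \<in> parcs G \<and>
     (let N = nbrs G v - {u} in
      \<exists>a b. inj_on a N \<and> inj_on b N \<and> a ` N \<inter> b ` N = {} \<and> (a ` N \<union> b ` N) \<inter> pverts G = {} \<and>
        pverts H = (pverts G - {u, v}) \<union> a ` N \<union> b ` N \<and>
        parcs H = {(x, y) \<in> parcs G. x \<notin> {u, v} \<and> y \<notin> {u, v}}
          \<union> (\<Union>w\<in>N. {(w, a w), (a w, w), (a w, b w), (b w, a w)}))"

definition reduction_step :: "'a pair_pre_digraph \<Rightarrow> 'a pair_pre_digraph \<Rightarrow> bool" where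
  "reduction_step G H \<longleftrightarrow> (\<exists>u v. 2 < deg G v \<and> reduction_graph G u v H)"

text \<open>
  The vertex type \<^typ>\<open>'a\<close> may be finite, so the copy \<open>embed G\<close> of \<open>G\<close> over \<^typ>\<open>'a + nat\<close> is reduced
  instead, where new vertices are always available.
\<close>

definition embed :: "'a pair_pre_digraph \<Rightarrow> ('a + nat) pair_pre_digraph" where
  "embed G = \<lparr> pverts = Inl ` pverts G, parcs = map_prod Inl Inl ` parcs G \<rparr>"

definition final_reduction_graph ::
    "'a pair_pre_digraph \<Rightarrow> ('a + nat) pair_pre_digraph \<Rightarrow> bool" where
  "final_reduction_graph G H \<longleftrightarrow>
     reduction_step\<^sup>*\<^sup>* (embed G) H \<and> (\<forall>v \<in> quasi_pendant_verts H. deg H v = 2)"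

text \<open>
  Final reduction graphs are unique up to isomorphism (the names of the new vertices and the order of
  the reductions are free), so the components of all of them are collected. The strongly connected
  components of a symmetric digraph are the connected components of the underlying graph.
\<close>

definition final_reduction_components ::
    "'a pair_pre_digraph \<Rightarrow> ('a + nat, ('a + nat) \<times> ('a + nat)) pre_digraph set" where
  "final_reduction_components G =
     {C. \<exists>H. final_reduction_graph G H \<and> C \<in> pre_digraph.sccs (with_proj H)}"

text \<open>
  Every connected graph with at least three vertices has a final reduction graph, so a statement about
  all its final reduction components is not vacuous. Reductions keep every quasi-pendant degree
  at least 2, and each step lowers the number of quasi-pendant vertices of degree greater than 2.
\<close>

lemma deg_nbrs: "deg G v = card (nbrs G v)"
proof -
  have "out_arcs (with_proj G) v = Pair v ` nbrs G v"
    by (auto simp: out_arcs_def nbrs_def)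
  then show ?thesis unfolding out_degree_def by (simp add: card_image inj_on_def)
qed

lemma fresh_pair:
  fixes V :: "'v set"
  assumes "infinite (UNIV :: 'v set)" "finite V" "finite N"
  shows "\<exists>a b :: 'v \<Rightarrow> 'v. inj_on a N \<and> inj_on b N \<and> a ` N \<inter> b ` N = {} \<and> (a ` N \<union> b ` N) \<inter> V = {}"
proof -
  have ext: "\<exists>f :: 'v \<Rightarrow> 'v. inj_on f N \<and> f ` N \<inter> W = {}" if "finite W" for W :: "'v set"
  proof -
    have "infinite (UNIV - W)" using assms(1) that by simp
    then obtain T where T: "T \<subseteq> UNIV - W" "card T = card N" "finite T"
      using infinite_arbitrarily_large by blast
    then obtain f where "bij_betw f N T" using assms(3) finite_same_card_bij by metis
    then show ?thesis using T(1) by (auto simp: bij_betw_def intro!: exI[of _ f])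
  qed
  from ext[OF assms(2)] obtain a where a: "inj_on a N" "a ` N \<inter> V = {}" by auto
  have "finite (V \<union> a ` N)" using assms by auto
  from ext[OF this] obtain b where b: "inj_on b N" "b ` N \<inter> (V \<union> a ` N) = {}" by auto
  have "a ` N \<inter> b ` N = {}" "(a ` N \<union> b ` N) \<inter> V = {}" using a(2) b(2) by blast+
  with a(1) b(1) show ?thesis by metis
qed

definition reduction_inv :: "'a pair_pre_digraph \<Rightarrow> bool" where
  "reduction_inv G \<longleftrightarrow> finite (pverts G) \<and> parcs G \<subseteq> pverts G \<times> pverts G \<and> sym (parcs G) \<and> irrefl (parcs G)
     \<and> (\<forall>v \<in> quasi_pendant_verts G. 2 \<le> deg G v)"

lemma reduction_inv_step:
  fixes G :: "'v pair_pre_digraph"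
  assumes inf: "infinite (UNIV :: 'v set)" and g: "reduction_inv G"
    and v: "v \<in> quasi_pendant_verts G" "deg G v > 2"
  shows "\<exists>H. reduction_step G H \<and> reduction_inv H \<and>
    {x \<in> quasi_pendant_verts H. deg H x > 2} \<subseteq> {x \<in> quasi_pendant_verts G. deg G x > 2} - {v}"
proof -
  have fin: "finite (pverts G)" and sub: "parcs G \<subseteq> pverts G \<times> pverts G"
    and sy: "\<And>x y. (x,y) \<in> parcs G \<Longrightarrow> (y,x) \<in> parcs G" and irr: "\<And>x. (x,x) \<notin> parcs G"
    using g by (auto simp: reduction_inv_def sym_def irrefl_def)
  have finn: "finite (nbrs G x)" for x
  proof (rule finite_subset[OF _ fin])
    show "nbrs G x \<subseteq> pverts G" using sub by (auto simp: nbrs_def)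
  qed
  obtain u where u: "u \<in> pendant_verts G" "(v,u) \<in> parcs G" and vV: "v \<in> pverts G"
    using v by (auto simp: quasi_pendant_verts_def)
  have "card (nbrs G u) = 1" using u(1) by (simp add: pendant_verts_def deg_nbrs)
  then have Nu: "nbrs G u = {v}"
  proof -
    have "v \<in> nbrs G u" using sy[OF u(2)] by (simp add: nbrs_def)
    then show ?thesis using \<open>card (nbrs G u) = 1\<close> by (metis card_1_singletonE singletonD)
  qed
  define N where "N = nbrs G v - {u}"
  obtain a b where ab: "inj_on a N" "inj_on b N" "a ` N \<inter> b ` N = {}"
      "(a ` N \<union> b ` N) \<inter> pverts G = {}"
    using fresh_pair[OF inf fin, of N] finn N_def by auto
  define H where "H = \<lparr>pverts = (pverts G - {u, v}) \<union> a ` N \<union> b ` N,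
     parcs = {(x, y) \<in> parcs G. x \<notin> {u, v} \<and> y \<notin> {u, v}}
          \<union> (\<Union>w\<in>N. {(w, a w), (a w, w), (a w, b w), (b w, a w)})\<rparr>"
  have R: "reduction_graph G u v H"
    unfolding reduction_graph_def Let_def N_def[symmetric]
  proof (intro conjI exI)
    show "inj_on a N" "inj_on b N" "a ` N \<inter> b ` N = {}" "(a ` N \<union> b ` N) \<inter> pverts G = {}"
      by fact+
    show "u \<in> pendant_verts G" "(u, v) \<in> parcs G" using u sy by blast+
  qed (simp_all add: H_def)
  have NV: "w \<in> pverts G" "w \<noteq> u" "w \<noteq> v" "(w,v) \<in> parcs G" "(v,w) \<in> parcs G" if "w \<in> N" for w
    using that sub irr sy by (auto simp: N_def nbrs_def)
  have aN: "a w \<notin> pverts G" "b w \<notin> pverts G" if "w \<in> N" for w using ab(4) that by auto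
  have neq: "a w \<noteq> b x" if "w \<in> N" "x \<in> N" for w x using ab(3) that by blast
  have ai: "a w = a x \<longleftrightarrow> w = x" if "w \<in> N" "x \<in> N" for w x using ab(1) that by (auto simp: inj_on_def)
  have bi: "b w = b x \<longleftrightarrow> w = x" if "w \<in> N" "x \<in> N" for w x using ab(2) that by (auto simp: inj_on_def)
  have uN: "(x,u) \<in> parcs G \<Longrightarrow> x = v" for x using Nu sy by (auto simp: nbrs_def)
  have na: "nbrs H (a w) = {w, b w}" if "w \<in> N" for w
  proof -
    have "(a w, x) \<notin> parcs G" for x using aN(1)[OF that] sub by auto
    moreover have "a w \<noteq> x" "x \<noteq> a w" if "x \<in> N" for x using aN(1)[OF \<open>w \<in> N\<close>] NV(1)[OF that] by auto
    ultimately show ?thesis using that neq[OF that] neq ai[OF that] ai by (auto simp: H_def nbrs_def)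
  qed
  have nb: "nbrs H (b w) = {a w}" if "w \<in> N" for w
  proof -
    have "(b w, x) \<notin> parcs G" for x using aN(2)[OF that] sub by auto
    moreover have "b w \<noteq> x" "x \<noteq> b w" if "x \<in> N" for x using aN(2)[OF \<open>w \<in> N\<close>] NV(1)[OF that] by auto
    moreover have "b w \<noteq> a x" "a x \<noteq> b w" if "x \<in> N" for x using neq[OF that \<open>w \<in> N\<close>] by auto
    ultimately show ?thesis using that bi[OF that] by (auto simp: H_def nbrs_def)
  qed
  have nold: "nbrs H x = (if x \<in> N then insert (a x) (nbrs G x - {v}) else nbrs G x)"
    if "x \<in> pverts G" "x \<noteq> u" "x \<noteq> v" for x
  proof -
    have "(x,v) \<in> parcs G \<Longrightarrow> x \<in> N" using sy that by (auto simp: N_def nbrs_def)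
    moreover have "a w \<noteq> x" "b w \<noteq> x" "x \<noteq> a w" "x \<noteq> b w" if "w \<in> N" for w
      using aN[OF that] \<open>x \<in> pverts G\<close> by auto
    moreover have "(x, u) \<notin> parcs G" using uN that by auto
    moreover have "(x, v) \<in> parcs G" if "x \<in> N" using NV that by auto
    ultimately show ?thesis using that by (auto simp: H_def nbrs_def)
  qed
  have dold: "deg H x = deg G x" if "x \<in> pverts G" "x \<noteq> u" "x \<noteq> v" for x
  proof (cases "x \<in> N")
    case True
    have "a x \<notin> nbrs G x" using aN[OF True] sub by (auto simp: nbrs_def)
    moreover have "v \<in> nbrs G x" using NV(4)[OF True] by (auto simp: nbrs_def)
    ultimately show ?thesis using nold[OF that] True finn[of x]
      using card_Suc_Diff1[of "nbrs G x" v] by (simp add: deg_nbrs del: card_Diff_singleton)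
  qed (use nold[OF that] in \<open>simp add: deg_nbrs\<close>)
  have da: "deg H (a w) = 2" if "w \<in> N" for w
    using na[OF that] aN[OF that] NV(1)[OF that] by (auto simp: deg_nbrs card_insert_if)
  have db: "deg H (b w) = 1" if "w \<in> N" for w
    using nb[OF that] by (simp add: deg_nbrs)
  have H1: "finite (pverts H)" "parcs H \<subseteq> pverts H \<times> pverts H"
  proof -
    have "finite N" using finn[of v] by (simp add: N_def)
    then show "finite (pverts H)" using fin by (simp add: H_def)
    show "parcs H \<subseteq> pverts H \<times> pverts H"
      using sub NV(1-3) unfolding H_def by auto
  qed
  have H2: "sym (parcs H)" using sy by (auto simp: H_def intro!: symI)
  have H3: "irrefl (parcs H)"
  proof -
    have "a w \<noteq> w" "w \<noteq> a w" "a w \<noteq> b w" "b w \<noteq> a w" if "w \<in> N" for w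
      using aN[OF that] NV(1)[OF that] neq[OF that that] by auto
    then show ?thesis using irr by (auto simp: H_def irrefl_def)
  qed
  have Q: "(\<exists>w\<in>N. x = a w) \<or> (x \<in> quasi_pendant_verts G \<and> x \<in> pverts G \<and> x \<noteq> u \<and> x \<noteq> v)"
    if xq: "x \<in> quasi_pendant_verts H" for x
  proof -
    obtain y where y: "deg H y = 1" "(x,y) \<in> parcs H" "y \<in> pverts H"
      using xq by (auto simp: quasi_pendant_verts_def pendant_verts_def)
    then have xy: "x \<in> nbrs H y" using H2 by (auto simp: nbrs_def sym_def)
    consider w where "w \<in> N" "y = a w" | w where "w \<in> N" "y = b w"
      | "y \<in> pverts G" "y \<noteq> u" "y \<noteq> v" using y(3) by (auto simp: H_def)
    then show ?thesis
    proof cases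
      case 1 then show ?thesis using da y by simp
    next
      case 2 then show ?thesis using nb xy by auto
    next
      case 3
      have dy: "deg G y = 1" using dold[OF 3] y by simp
      show ?thesis
      proof (cases "y \<in> N")
        case True
        then have "x \<in> insert (a y) (nbrs G y - {v})" using nold[OF 3] xy by simp
        moreover have "nbrs G y = {v}"
        proof -
          have "v \<in> nbrs G y" using NV(4)[OF True] by (simp add: nbrs_def)
          then show ?thesis using dy by (metis deg_nbrs card_1_singletonE singletonD)
        qed
        ultimately show ?thesis using True by auto
      next
        case False
        then have "x \<in> nbrs G y" using nold[OF 3] xy by simp
        then have xyG: "(x,y) \<in> parcs G" "(y,x) \<in> parcs G" using sy by (auto simp: nbrs_def)
        have "x \<noteq> u" using Nu xyG 3 by (auto simp: nbrs_def)
        moreover have "x \<noteq> v" using False xyG 3 by (auto simp: N_def nbrs_def)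
        ultimately show ?thesis using xyG dy sub 3
          by (auto simp: quasi_pendant_verts_def pendant_verts_def)
      qed
    qed
  qed
  have "reduction_inv H"
  proof -
    have "2 \<le> deg H x" if x: "x \<in> quasi_pendant_verts H" for x
      using Q[OF x]
    proof
      assume "\<exists>w\<in>N. x = a w" then show ?thesis using da by auto
    next
      assume "x \<in> quasi_pendant_verts G \<and> x \<in> pverts G \<and> x \<noteq> u \<and> x \<noteq> v"
      then show ?thesis using dold[of x] g by (simp add: reduction_inv_def)
    qed
    then show ?thesis using H1 H2 H3 by (simp add: reduction_inv_def)
  qed
  moreover have "{x \<in> quasi_pendant_verts H. deg H x > 2}
      \<subseteq> {x \<in> quasi_pendant_verts G. deg G x > 2} - {v}"

  proof
    fix x assume x: "x \<in> {x \<in> quasi_pendant_verts H. deg H x > 2}"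
    then have "\<not> (\<exists>w\<in>N. x = a w)" using da by auto
    then show "x \<in> {x \<in> quasi_pendant_verts G. deg G x > 2} - {v}"
      using Q[of x] x dold[of x] by auto
  qed
  moreover have "reduction_step G H" using R v by (auto simp: reduction_step_def)
  ultimately show ?thesis by blast
qed

lemma reduction_inv_final:
  fixes G :: "'v pair_pre_digraph"
  assumes inf: "infinite (UNIV :: 'v set)" and "reduction_inv G"
  shows "\<exists>H. reduction_step\<^sup>*\<^sup>* G H \<and> (\<forall>v \<in> quasi_pendant_verts H. deg H v = 2)"
  using assms(2)
proof (induction "card {x \<in> quasi_pendant_verts G. deg G x > 2}" arbitrary: G rule: less_induct)
  case less
  show ?case
  proof (cases "\<exists>v \<in> quasi_pendant_verts G. deg G v > 2")
    case False
    then have "\<forall>v \<in> quasi_pendant_verts G. deg G v = 2"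
      using less.prems by (force simp: reduction_inv_def)
    then show ?thesis by blast
  next
    case True
    then obtain v where v: "v \<in> quasi_pendant_verts G" "deg G v > 2" by blast
    from reduction_inv_step[OF inf less.prems v] obtain H where H: "reduction_step G H" "reduction_inv H"
      "{x \<in> quasi_pendant_verts H. deg H x > 2} \<subseteq> {x \<in> quasi_pendant_verts G. deg G x > 2} - {v}"
      by blast
    have "finite {x \<in> quasi_pendant_verts G. deg G x > 2}"
      using less.prems by (auto simp: reduction_inv_def quasi_pendant_verts_def)
    then have "card {x \<in> quasi_pendant_verts H. deg H x > 2} < card {x \<in> quasi_pendant_verts G. deg G x > 2}"
      using H(3) v by (intro psubset_card_mono) auto
    from less.hyps[OF this H(2)] H(1) show ?thesis by (meson converse_rtranclp_into_rtranclp)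
  qed
qed

lemma conn_ge2:
  assumes G: "pair_graph G" "connected_graph G" "card (pverts G) \<ge> 3"
    and v: "v \<in> quasi_pendant_verts G"
  shows "2 \<le> deg G v"
proof (rule ccontr)
  interpret pair_graph G by fact
  assume c: "\<not> 2 \<le> deg G v"
  obtain u where u: "u \<in> pverts G" "deg G u = 1" "(v,u) \<in> parcs G" and vV: "v \<in> pverts G"
    using v by (auto simp: quasi_pendant_verts_def pendant_verts_def)
  have sy: "(x,y) \<in> parcs G \<Longrightarrow> (y,x) \<in> parcs G" for x y
    using pair_sym_arcs by (auto simp: symmetric_def sym_def)
  have "finite (nbrs G v)" using finite_subset[OF _ pair_finite_verts, of "nbrs G v"] in_arcsD2
    by (auto simp: nbrs_def)
  then have "card (nbrs G v) \<noteq> 0" using u(3) by (auto simp: nbrs_def)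
  then have "card (nbrs G v) = 1" using c by (simp add: deg_nbrs)
  then have Nv: "nbrs G v = {u}"
  proof -
    have "u \<in> nbrs G v" using u(3) by (simp add: nbrs_def)
    with \<open>card (nbrs G v) = 1\<close> show ?thesis by (metis card_1_singletonE singletonD)
  qed
  have Nu: "nbrs G u = {v}"
  proof -
    have "v \<in> nbrs G u" using sy[OF u(3)] by (simp add: nbrs_def)
    then show ?thesis using u(2) by (metis deg_nbrs card_1_singletonE singletonD)
  qed
  have "pverts G \<subseteq> {u,v}"
  proof
    fix w assume "w \<in> pverts G"
    have "(mk_symmetric (with_proj G)) = G"
      using sy by (auto simp: mk_symmetric_def intro!: pair_pre_digraph.equality)
    then have "v \<rightarrow>\<^sup>*\<^bsub>with_proj G\<^esub> w"
      using G(2) vV \<open>w \<in> pverts G\<close> by (auto simp: connected_def strongly_connected_def)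
    then have "(v,w) \<in> (parcs G)\<^sup>*" using reachable_rtranclI by fastforce
    then show "w \<in> {u,v}"
      by (induction rule: rtrancl_induct) (use Nu Nv in \<open>auto simp: nbrs_def\<close>)
  qed
  then have "card (pverts G) \<le> 2"
    using card_mono[of "{u,v}" "pverts G"] card_insert_le_m1[of 2 "{v}" u] by (simp add: card_insert_if split: if_splits)
  with G(3) show False by simp
qed

lemma deg_embed: "deg (embed G) (Inl v) = deg G v"
proof -
  have "nbrs (embed G) (Inl v) = Inl ` nbrs G v" by (auto simp: nbrs_def embed_def)
  then show ?thesis by (simp add: deg_nbrs card_image)
qed

lemma final_reduction_graph_exists:
  assumes G: "pair_graph G" "connected_graph G" "card (pverts G) \<ge> 3"
  shows "\<exists>H. final_reduction_graph G H"
proof -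
  interpret pair_graph G by fact
  have "quasi_pendant_verts (embed G) = Inl ` quasi_pendant_verts G"
  proof -
    have p: "pendant_verts (embed G) = Inl ` pendant_verts G"
      using deg_embed[of G] by (auto simp: pendant_verts_def) (auto simp: embed_def)
    show ?thesis unfolding quasi_pendant_verts_def p by (auto simp: embed_def)
  qed
  then have Q: "\<forall>v \<in> quasi_pendant_verts (embed G). 2 \<le> deg (embed G) v"
    using conn_ge2[OF G] by (simp add: deg_embed)
  have "parcs G \<subseteq> pverts G \<times> pverts G" using wellformed' by auto
  then have "parcs (embed G) \<subseteq> pverts (embed G) \<times> pverts (embed G)"
    by (auto simp: embed_def)
  moreover have "sym (parcs G)" using pair_sym_arcs by (simp add: symmetric_def)
  then have "sym (parcs (embed G))" by (auto simp: embed_def sym_def)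
  moreover have "(x, x) \<notin> parcs G" for x using pair_no_loops[of "(x, x)"] by auto
  then have "irrefl (parcs (embed G))" by (auto simp: embed_def irrefl_def)
  moreover have "finite (pverts (embed G))" using pair_finite_verts by (simp add: embed_def)
  ultimately have "reduction_inv (embed G)" using Q by (simp add: reduction_inv_def)
  moreover have "infinite (UNIV :: ('a + nat) set)" by simp
  ultimately show ?thesis unfolding final_reduction_graph_def by (rule reduction_inv_final[rotated])
qed

end

theory Submission
  imports Defs "Jordan_Normal_Form.Jordan_Normal_Form_Existence" "Jordan_Normal_Form.Jordan_Normal_Form_Uniqueness"
begin

text \<open>The multiplicity of \<open>1\<close> is the dimension of the space of functions \<open>x\<close> on the vertices with
\<open>(deg v - 1) * x v = (\<Sum>w\<in>N(v). x w)\<close> for every \<open>v\<close>. Everything takes place in a slightly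
larger world: a finite graph \<open>(V, E)\<close> with a weight \<open>d v \<ge> deg v\<close> at each vertex, and the same
equation with \<open>d\<close> in place of the degree (\<open>eigenfunctions\<close>). Weights allow vertices to be deleted
while the equations at the surviving vertices keep their coefficients.

The proof compares four times this dimension with the potential \<open>\<Psi> = (\<Sum>v\<in>V. 2 * d v - 3) + 2 * (number of
components)\<close> (\<open>nullity_bound\<close>). For a connected graph weighted by its degrees, \<open>\<Psi> = 4 m - 3 n
+ 2 = 4 c + n - 2\<close>, so the inequality of the theorem is \<open>4 * dim \<le> \<Psi>\<close>. The potential is additive
over components, and deleting a vertex \<open>w\<close> creates at most \<open>deg w - 1\<close> new components
(\<open>num_components_remove\<close>), which is paid for by the summand of \<open>w\<close>.

At a pendant vertex of weight \<open>1\<close> the equation says that \<open>x\<close> vanishes at the neighbour, and the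
equation at the neighbour then determines \<open>x\<close> at the pendant vertex. Hence the two can be deleted without
changing the dimension, and \<open>\<Psi>\<close> does not grow (\<open>reducible_bounded\<close>); a reduced graph is
exactly one in which the pairs do not interfere. What remains has all weights at least \<open>2\<close>, and
\<open>admissible_bounded\<close> proves \<open>4 * dim \<le> \<Psi>\<close> for it by induction. An edge on a cycle with an
endpoint of weight at least \<open>3\<close> can be removed, or the path through its other endpoint deleted, at the price of
one linear functional, which costs \<open>4\<close> on both sides (\<open>bounded_delete_edge\<close>,
\<open>nonbridge_contract\<close>). Otherwise there is a component that is a cycle of weight-\<open>2\<close> vertices
(\<open>bounded_cycle\<close>), or the graph is a forest, where a vertex near the leaves admits one of a few explicit
deletions (\<open>bounded_forest\<close>). Equality survives only if all weights are \<open>2\<close> and every component is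
a single edge or a hexagon.

Reading the deletions backwards, a connected graph attaining the bound is \<open>C\<^sub>6\<close>, or its vertices split
into pendant vertices \<open>P\<close>, pairwise nonadjacent quasi-pendant vertices \<open>Q\<close> with one pendant
neighbour each, and adjacent pairs \<open>W\<close> of vertices of degree \<open>2\<close>, each with one neighbour in
\<open>Q\<close> (\<open>p6_structure\<close>). This structure is preserved by the reduction operation in both directions,
and when all quasi-pendant vertices have degree \<open>2\<close> it says that every component is a \<open>P\<^sub>6\<close>
(\<open>final_components_iff_p6_structure\<close>). With \<open>q\<close> quasi-pendant vertices and \<open>r\<close> pairs
the multiplicity is \<open>r\<close>, \<open>n = 2 q + 2 r\<close> and \<open>m = q + 3 r\<close>
(\<open>p6_structure_counts\<close>), so equality holds if and only if \<open>r = q - 1\<close>, that is, \<open>c =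
0\<close>.\<close>

section \<open>Dimension bounds by linear functionals\<close>

definition linear_functional :: "(('a \<Rightarrow> real) \<Rightarrow> real) \<Rightarrow> bool" where
  "linear_functional \<phi> \<longleftrightarrow>
     (\<forall>x y. \<phi> (\<lambda>v. x v + y v) = \<phi> x + \<phi> y) \<and> (\<forall>c x. \<phi> (\<lambda>v. c * x v) = c * \<phi> x)"

text \<open>Upper bounds on dimensions are witnessed by functionals without a common nonzero zero on \<open>S\<close>; this avoids bases
altogether, and a bound for a subspace cut out by one functional extends to \<open>S\<close> at the cost of \<open>1\<close>.\<close>

definition dim_at_most :: "('a \<Rightarrow> real) set \<Rightarrow> nat \<Rightarrow> bool" where
  "dim_at_most S k \<longleftrightarrow> (\<exists>\<Phi>. finite \<Phi> \<and> card \<Phi> \<le> k \<and> (\<forall>\<phi>\<in>\<Phi>. linear_functional \<phi>) \<and>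
     (\<forall>x\<in>S. (\<forall>\<phi>\<in>\<Phi>. \<phi> x = 0) \<longrightarrow> (\<forall>v. x v = 0)))"

definition nbrs_in :: "('a \<times> 'a) set \<Rightarrow> 'a set \<Rightarrow> 'a \<Rightarrow> 'a set" where
  "nbrs_in E V v = {w \<in> V. (v, w) \<in> E}"

text \<open>The functions are extended by \<open>0\<close> outside \<open>V\<close>. For \<open>d = deg\<close> these are the
eigenvectors of the Laplacian for the eigenvalue \<open>1\<close>, together with \<open>0\<close>.\<close>

definition eigenfunctions :: "('a \<times> 'a) set \<Rightarrow> 'a set \<Rightarrow> ('a \<Rightarrow> nat) \<Rightarrow> ('a \<Rightarrow> real) set" where
  "eigenfunctions E V d = {x. (\<forall>v. v \<notin> V \<longrightarrow> x v = 0) \<and>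
     (\<forall>v\<in>V. (real (d v) - 1) * x v = (\<Sum>w\<in>nbrs_in E V v. x w))}"

lemma linear_functionalD:
  assumes "linear_functional \<phi>"
  shows "\<phi> (\<lambda>v. x v + y v) = \<phi> x + \<phi> y" and "\<phi> (\<lambda>v. c * x v) = c * \<phi> x"
  using assms unfolding linear_functional_def by simp_all

lemma linear_functional_0:
  assumes "linear_functional \<phi>"
  shows "\<phi> (\<lambda>v. 0) = 0"
proof -
  have "\<phi> (\<lambda>v. 0 * (0::real)) = 0 * \<phi> (\<lambda>v. 0)"
    by (rule linear_functionalD(2)[OF assms])
  then show ?thesis by simp
qed

text \<open>A functional is a priori an arbitrary map on a function space that may be infinite-dimensional; on functions supported in a
finite set it is given by coefficients, which turns it into a vector.\<close>

lemma linear_functional_expand: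
  assumes \<phi>: "linear_functional \<phi>" and "finite V" "\<And>v. v \<notin> V \<Longrightarrow> x v = 0"
  shows "\<phi> x = (\<Sum>v\<in>V. x v * \<phi> (\<lambda>w. if w = v then 1 else 0))"
  using assms(2,3)
proof (induction V arbitrary: x rule: finite_induct)
  case empty
  then have "x = (\<lambda>v. 0)" by auto
  then show ?case using linear_functional_0[OF \<phi>] by simp
next
  case (insert u V)
  let ?e = "\<lambda>w. if w = u then 1 else (0::real)"
  have x: "x = (\<lambda>v. (x(u := 0)) v + (\<lambda>v. x u * ?e v) v)" by auto
  have "\<phi> x = \<phi> (\<lambda>v. (x(u := 0)) v + (\<lambda>v. x u * ?e v) v)" using x by (rule arg_cong)
  also have "\<dots> = \<phi> (x(u := 0)) + \<phi> (\<lambda>v. x u * ?e v)"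
    by (rule linear_functionalD(1)[OF \<phi>])
  also have "\<phi> (\<lambda>v. x u * ?e v) = x u * \<phi> ?e"
    by (rule linear_functionalD(2)[OF \<phi>])
  also have "\<phi> (x(u := 0)) = (\<Sum>v\<in>V. (x(u := 0)) v * \<phi> (\<lambda>w. if w = v then 1 else 0))"
    by (rule insert.IH) (use insert.prems in auto)
  also have "\<dots> = (\<Sum>v\<in>V. x v * \<phi> (\<lambda>w. if w = v then 1 else 0))"
    using insert.hyps by (intro sum.cong) auto
  finally show ?case using insert.hyps by (simp add: add.commute)
qed

lemma linear_functional_eval: "linear_functional (\<lambda>x. x v)"
  by (simp add: linear_functional_def)

lemma linear_functional_diff: "linear_functional (\<lambda>x. x v - x w)"
  by (simp add: linear_functional_def algebra_simps)

lemma dim_at_mostE: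
  assumes "dim_at_most S k"
  obtains \<Phi> where "finite \<Phi>" "card \<Phi> \<le> k" "\<forall>\<phi>\<in>\<Phi>. linear_functional \<phi>"
    "\<forall>x\<in>S. (\<forall>\<phi>\<in>\<Phi>. \<phi> x = 0) \<longrightarrow> (\<forall>v. x v = 0)"
  using assms unfolding dim_at_most_def by (elim exE conjE) (rule that)

lemma dim_at_mostI:
  assumes "finite \<Phi>" "card \<Phi> \<le> k" "\<And>\<phi>. \<phi> \<in> \<Phi> \<Longrightarrow> linear_functional \<phi>"
    "\<And>x v. x \<in> S \<Longrightarrow> (\<And>\<phi>. \<phi> \<in> \<Phi> \<Longrightarrow> \<phi> x = 0) \<Longrightarrow> x v = 0"
  shows "dim_at_most S k"
  unfolding dim_at_most_def by (intro exI[of _ \<Phi>] conjI ballI impI allI) (use assms in blast)+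

lemma dim_at_most_mono:
  assumes "dim_at_most S k" "T \<subseteq> S" "k \<le> l"
  shows "dim_at_most T l"
proof -
  from assms(1) obtain \<Phi> where P: "finite \<Phi>" "card \<Phi> \<le> k" "\<forall>\<phi>\<in>\<Phi>. linear_functional \<phi>"
    "\<forall>x\<in>S. (\<forall>\<phi>\<in>\<Phi>. \<phi> x = 0) \<longrightarrow> (\<forall>v. x v = 0)"
    by (elim dim_at_mostE)
  show ?thesis
  proof (rule dim_at_mostI[OF P(1)])
    show "linear_functional \<phi>" if "\<phi> \<in> \<Phi>" for \<phi> using that P(3) by blast
    show "card \<Phi> \<le> l" using P(2) assms(3) by linarith
    show "x v = 0" if "x \<in> T" "\<And>\<phi>. \<phi> \<in> \<Phi> \<Longrightarrow> \<phi> x = 0" for x v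
      using P(4) that assms(2) by blast
  qed
qed

lemma dim_at_most_functional:
  assumes \<phi>: "linear_functional \<phi>" and "dim_at_most {x \<in> S. \<phi> x = 0} k"
  shows "dim_at_most S (Suc k)"
proof -
  from assms(2) obtain \<Phi> where P: "finite \<Phi>" "card \<Phi> \<le> k" "\<forall>\<psi>\<in>\<Phi>. linear_functional \<psi>"
    "\<forall>x\<in>{x \<in> S. \<phi> x = 0}. (\<forall>\<psi>\<in>\<Phi>. \<psi> x = 0) \<longrightarrow> (\<forall>v. x v = 0)"
    by (elim dim_at_mostE)
  show ?thesis
  proof (rule dim_at_mostI[of "insert \<phi> \<Phi>"])
    show "finite (insert \<phi> \<Phi>)" using P(1) by simp
    show "card (insert \<phi> \<Phi>) \<le> Suc k" using P(1,2) by (simp add: card_insert_if)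
    show "linear_functional \<psi>" if "\<psi> \<in> insert \<phi> \<Phi>" for \<psi> using that P(3) \<phi> by blast
    show "x v = 0" if "x \<in> S" "\<And>\<psi>. \<psi> \<in> insert \<phi> \<Phi> \<Longrightarrow> \<psi> x = 0" for x v
      using P(4) that by blast
  qed
qed

lemma dim_at_most_evals:
  assumes "finite R" "dim_at_most {x \<in> S. \<forall>r\<in>R. x r = 0} k"
  shows "dim_at_most S (k + card R)"
  using assms
proof (induction R arbitrary: S rule: finite_induct)
  case (insert r R)
  have "dim_at_most {x \<in> {x \<in> S. x r = 0}. \<forall>s\<in>R. x s = 0} k"
    using insert.prems by (rule dim_at_most_mono) auto
  then have "dim_at_most {x \<in> S. x r = 0} (k + card R)" by (rule insert.IH)
  then show ?case using insert.hyps dim_at_most_functional[OF linear_functional_eval[of r], of S] by simp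
qed simp

text \<open>A dimension bound is transported along the restriction to \<open>V\<close>, whenever it is injective on \<open>S\<close>:
compose the functionals with the restriction.\<close>

lemma dim_at_most_restrict:
  assumes T: "dim_at_most T k"
    and into: "\<And>x. x \<in> S \<Longrightarrow> (\<lambda>v. if v \<in> V then x v else 0) \<in> T"
    and inj: "\<And>x v. x \<in> S \<Longrightarrow> (\<And>u. u \<in> V \<Longrightarrow> x u = 0) \<Longrightarrow> x v = 0"
  shows "dim_at_most S k"
proof -
  define r where "r = (\<lambda>x v. if v \<in> V then x v else (0::real))"
  from T obtain \<Phi> where P: "finite \<Phi>" "card \<Phi> \<le> k" "\<forall>\<phi>\<in>\<Phi>. linear_functional \<phi>"
    "\<forall>x\<in>T. (\<forall>\<phi>\<in>\<Phi>. \<phi> x = 0) \<longrightarrow> (\<forall>v. x v = 0)"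
    by (elim dim_at_mostE)
  have lin: "linear_functional (\<lambda>x. \<phi> (r x))" if "\<phi> \<in> \<Phi>" for \<phi>
  proof -
    have a: "r (\<lambda>v. x v + y v) = (\<lambda>v. r x v + r y v)" for x y by (auto simp: r_def)
    have b: "r (\<lambda>v. c * x v) = (\<lambda>v. c * r x v)" for c x by (auto simp: r_def)
    show ?thesis unfolding linear_functional_def a b
      using linear_functionalD[of \<phi>] P(3) that by blast
  qed
  show ?thesis
  proof (rule dim_at_mostI[of "(\<lambda>\<phi> x. \<phi> (r x)) ` \<Phi>"])
    show "finite ((\<lambda>\<phi> x. \<phi> (r x)) ` \<Phi>)" using P(1) by simp
    show "card ((\<lambda>\<phi> x. \<phi> (r x)) ` \<Phi>) \<le> k" using card_image_le[OF P(1)] P(2) le_trans by blast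
    show "linear_functional \<psi>" if "\<psi> \<in> (\<lambda>\<phi> x. \<phi> (r x)) ` \<Phi>" for \<psi> using that lin by blast
    show "x v = 0" if x: "x \<in> S" and z: "\<And>\<psi>. \<psi> \<in> (\<lambda>\<phi> x. \<phi> (r x)) ` \<Phi> \<Longrightarrow> \<psi> x = 0" for x v
    proof (rule inj[OF x])
      have "r x u = 0" for u
        using P(4) into[OF x] z unfolding r_def by blast
      then show "x u = 0" if "u \<in> V" for u using that unfolding r_def by meson
    qed
  qed
qed

lemma dim_at_most_0: "(\<And>x v. x \<in> S \<Longrightarrow> x v = 0) \<Longrightarrow> dim_at_most S 0"
  by (rule dim_at_mostI[of "{}"]) auto

section \<open>The eigenvalue multiplicity as a dimension\<close>

text \<open>With \<open>w = A v\<close> the Hermitian square of \<open>w\<close> equals the product of \<open>A w = 0\<close> with the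
conjugate of \<open>v\<close>. The conditions say that \<open>A\<close> is a real symmetric matrix, regarded as a complex
one.\<close>

lemma real_symmetric_kernel_square:
  fixes A :: "complex mat"
  assumes A: "A \<in> carrier_mat n n" and sym: "transpose_mat A = A" and re: "map_mat cnj A = A"
    and v: "v \<in> carrier_vec n" and "A *\<^sub>v (A *\<^sub>v v) = 0\<^sub>v n"
  shows "A *\<^sub>v v = 0\<^sub>v n"
proof -
  define w where "w = A *\<^sub>v v"
  have w: "w \<in> carrier_vec n" "A *\<^sub>v w = 0\<^sub>v n" using assms by (auto simp: w_def)
  have cw: "conjugate w = A *\<^sub>v conjugate v"
  proof (rule eq_vecI)
    show "dim_vec (conjugate w) = dim_vec (A *\<^sub>v conjugate v)" using w A by auto
    fix i assume "i < dim_vec (A *\<^sub>v conjugate v)"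
    then have i: "i < n" using A by auto
    have "conjugate (row A i) = row A i"
    proof (rule eq_vecI)
      fix j assume "j < dim_vec (row A i)"
      then have "A $$ (i,j) = map_mat cnj A $$ (i,j)" "j < n" using re A by auto
      then show "conjugate (row A i) $ j = row A i $ j" using A i by auto
    qed simp
    moreover have "conjugate (row A i \<bullet> v) = conjugate (row A i) \<bullet> conjugate v"
      by (rule conjugate_sprod_vec[of _ n]) (use A i v in auto)
    ultimately show "conjugate w $ i = (A *\<^sub>v conjugate v) $ i" using A i w by (simp add: w_def)
  qed
  have "w \<bullet>c w = w \<bullet> (A *\<^sub>v conjugate v)" by (simp add: cw)
  also have "\<dots> = (transpose_mat A *\<^sub>v w) \<bullet> conjugate v"
    by (rule transpose_vec_mult_scalar[symmetric]) (use A w v in auto)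
  also have "\<dots> = 0" using w v by (simp add: sym)
  finally show ?thesis using w by (simp add: w_def)
qed

text \<open>Algebraic and geometric multiplicity agree because a Jordan block of size at least \<open>2\<close> would make the kernel of
the square of \<open>A - a\<close> larger than the kernel of \<open>A - a\<close>. Complex matrices are used since the Jordan
normal form needs a split characteristic polynomial.\<close>

lemma real_symmetric_order_eq_kernel_dim:
  fixes A :: "real mat"
  assumes A: "A \<in> carrier_mat n n" and sym: "transpose_mat A = A"
  shows "Polynomial.order a (char_poly A) =
    kernel_dim (char_matrix (map_mat complex_of_real A) (complex_of_real a))"
proof -
  define B where "B = map_mat complex_of_real A"
  define e where "e = complex_of_real a"
  define C where "C = char_matrix B e"
  have B: "B \<in> carrier_mat n n" using A by (simp add: B_def)
  have C: "C \<in> carrier_mat n n" using B by (simp add: C_def)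
  have "Polynomial.order a (char_poly A) = Polynomial.order e (map_poly complex_of_real (char_poly A))"
    unfolding e_def
  proof -
    interpret h: map_poly_inj_idom_divide_hom complex_of_real ..
    show "Polynomial.order a (char_poly A) =
        Polynomial.order (complex_of_real a) (map_poly complex_of_real (char_poly A))"
      by (rule h.order_hom[symmetric])
  qed
  also have "map_poly complex_of_real (char_poly A) = char_poly B"
    unfolding B_def by (metis A of_real_hom.char_poly_hom)
  finally have ord: "Polynomial.order a (char_poly A) = Polynomial.order e (char_poly B)" .
  obtain as where "char_poly B = (\<Prod>a\<leftarrow>as. [:- a, 1:])" using char_poly_factorized[OF B] by auto
  then obtain bl where J: "jordan_nf B bl" using jordan_nf_exists[OF B] by blast
  have symC: "transpose_mat C = C"
  proof (rule eq_matI)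
    fix i j assume "i < dim_row C" "j < dim_col C"
    then have ij: "i < n" "j < n" using C by auto
    have "A $$ (j,i) = A $$ (i,j)" using sym A ij by (metis carrier_matD index_transpose_mat(1))
    then show "transpose_mat C $$ (i,j) = C $$ (i,j)" using A ij by (auto simp: C_def char_matrix_def B_def)
  qed (use C in auto)
  have reC: "map_mat cnj C = C"
    using A by (intro eq_matI) (auto simp: C_def char_matrix_def B_def e_def)
  have ker: "mat_kernel (C ^\<^sub>m 2) = mat_kernel C"
  proof -
    have C2: "C ^\<^sub>m 2 = C * C" using C by (simp add: numeral_2_eq_2)
    have "v \<in> mat_kernel (C * C) \<longleftrightarrow> v \<in> mat_kernel C" for v
      using real_symmetric_kernel_square[OF C symC reC, of v] C assoc_mult_mat_vec[OF C C, of v]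
      unfolding mat_kernel_def by auto
    then show ?thesis unfolding C2 by blast
  qed
  have eq: "dim_gen_eigenspace B e 2 = dim_gen_eigenspace B e 1"
    using ker C by (simp add: dim_gen_eigenspace_def kernel_dim_def C_def[symmetric])
  have nz: "\<And>m b. (m, b) \<in> set bl \<Longrightarrow> m > 0"
    using J unfolding jordan_nf_def by force
  \<comment> \<open>a block of size at least \<open>2\<close> contributes more to the second sum than to the first\<close>
  have small: "(\<forall>(m,b)\<in>set l. m > 0) \<Longrightarrow>
      (\<Sum>m\<leftarrow>map fst [(m, b)\<leftarrow>l . b = e]. min 1 m) \<le> (\<Sum>m\<leftarrow>map fst [(m, b)\<leftarrow>l . b = e]. min 2 m) \<and>
      ((\<Sum>m\<leftarrow>map fst [(m, b)\<leftarrow>l . b = e]. min 2 m) = (\<Sum>m\<leftarrow>map fst [(m, b)\<leftarrow>l . b = e]. min 1 m) \<longrightarrow>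
       (\<Sum>m\<leftarrow>map fst [(m, b)\<leftarrow>l . b = e]. min 1 m) = sum_list (map fst (filter (\<lambda> na. snd na = e) l)))"
    for l :: "(nat \<times> complex) list"
    by (induction l) (auto simp: min_def)
  have "dim_gen_eigenspace B e 1 = Polynomial.order e (char_poly B)"
    using small[of bl] nz eq unfolding dim_gen_eigenspace[OF J] jordan_nf_order[OF J] by auto
  then show ?thesis using ord C by (simp add: dim_gen_eigenspace_def C_def[symmetric] B_def[symmetric] e_def[symmetric])
qed

text \<open>If a basis had more than \<open>k\<close> elements, the matrix of the \<open>k\<close> functionals on it, padded by zero rows
to a square, would be singular, and a kernel vector of it would give a nonzero combination of the basis on which all
functionals vanish.\<close>

lemma kernel_dim_le:
  fixes C :: "'f::field mat"
  assumes C: "C \<in> carrier_mat n n" and W: "\<And>i. i < k \<Longrightarrow> W i \<in> carrier_vec n"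
    and inj: "\<And>v. v \<in> mat_kernel C \<Longrightarrow> (\<And>i. i < k \<Longrightarrow> W i \<bullet> v = 0) \<Longrightarrow> v = 0\<^sub>v n"
  shows "kernel_dim C \<le> k"
proof (rule ccontr)
  interpret K: kernel n n C by unfold_locales (rule C)
  obtain S where S: "finite S" "K.basis S" using kernel_basis_exists[OF C] by blast
  define d where "d = card S"
  assume "\<not> kernel_dim C \<le> k"
  then have dk: "k < d" using K.Ker.dim_basis[OF S] by (simp add: d_def)
  obtain b where b: "bij_betw b {0..<d} S" using ex_bij_betw_nat_finite[OF S(1)] by (auto simp: d_def)
  have Sker: "S \<subseteq> mat_kernel C" using S(2) by (simp add: K.Ker.basis_def)
  have bS: "b j \<in> carrier_vec n" if "j < d" for j
    using subsetD[OF Sker] bij_betwE[OF b] that subsetD[OF mat_kernel_carrier[OF C]] by auto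
  define M where "M = mat d d (\<lambda>(i,j). if i < k then W i \<bullet> b j else 0)"
  have M: "M \<in> carrier_mat d d" by (simp add: M_def)
  have "row M k = 0\<^sub>v d" using dk by (intro eq_vecI) (auto simp: M_def)
  moreover have "M $$ (k, j) = 0" if "j < d" for j using that dk by (simp add: M_def)
  ultimately have "det M = 0" using laplace_expansion_row[OF M, of k] dk by (simp add: sum.neutral)
  then obtain y where y: "y \<in> carrier_vec d" "y \<noteq> 0\<^sub>v d" "M *\<^sub>v y = 0\<^sub>v d"
    using det_0_iff_vec_prod_zero_field[OF M] by auto
  define a where "a = (\<lambda>s. y $ (the_inv_into {0..<d} b s))"
  have ab: "a (b j) = y $ j" if "j < d" for j
    using that b by (simp add: a_def bij_betw_def the_inv_into_f_f)
  define v where "v = K.NC.lincomb a S"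
  have vker: "v \<in> mat_kernel C"
    using K.Ker.lincomb_closed[of S a] Sker K.lincomb_same[OF Sker, of a]
    by (simp add: v_def class_ring_simps)
  have vi: "v $ l = (\<Sum>j<d. y $ j * b j $ l)" if "l < n" for l
  proof -
    have "v $ l = (\<Sum>s\<in>S. a s * s $ l)"
      unfolding v_def by (rule K.lincomb_index[OF that Sker, unfolded K.lincomb_same[OF Sker]])
    also have "\<dots> = (\<Sum>j\<in>{0..<d}. a (b j) * b j $ l)"
      using sum.reindex_bij_betw[OF b, of "\<lambda>s. a s * s $ l"] by simp
    finally show ?thesis using ab by (simp add: atLeast0LessThan)
  qed
  have vc: "v \<in> carrier_vec n" using vker mat_kernel_carrier[OF C] by auto
  have "W i \<bullet> v = 0" if i: "i < k" for i
  proof -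
    have "W i \<bullet> v = (\<Sum>l\<in>{0..<n}. W i $ l * (\<Sum>j<d. y $ j * b j $ l))"
      using vc vi by (simp add: scalar_prod_def)
    also have "\<dots> = (\<Sum>j<d. (\<Sum>l\<in>{0..<n}. W i $ l * b j $ l) * y $ j)"
      unfolding sum_distrib_left sum_distrib_right by (subst sum.swap) (simp add: mult_ac)
    also have "\<dots> = (\<Sum>j<d. M $$ (i,j) * y $ j)"
      using carrier_vecD[OF bS] i dk by (intro sum.cong) (auto simp: M_def scalar_prod_def)
    also have "\<dots> = (M *\<^sub>v y) $ i"
      using M y(1) i dk by (simp add: scalar_prod_def atLeast0LessThan)
    also have "\<dots> = 0" using y(3) i dk by simp
    finally show ?thesis .
  qed
  from inj[OF vker this] have "v = 0\<^sub>v n" .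
  then have lc: "K.lincomb a S = 0\<^sub>v n" unfolding v_def K.lincomb_same[OF Sker] .
  have "K.lin_indpt S" using S(2) unfolding K.Ker.basis_def by blast
  from K.Ker.not_lindepD[OF this S(1) subset_refl _ lc] have "a \<in> S \<rightarrow> {0}" by blast
  then have "a s = 0" if "s \<in> S" for s using that by blast
  then have "y $ j = 0" if "j < d" for j using ab[OF that] that b by (auto simp: bij_betw_def)
  then have "y = 0\<^sub>v d" using y(1) by (intro eq_vecI) auto
  then show False using y(2) by simp
qed

text \<open>Vectors dual to a set of coordinates are linearly independent.\<close>

lemma kernel_dim_ge:
  fixes C :: "'f::field mat"
  assumes C: "C \<in> carrier_mat n n" and R: "finite R"
    and f: "\<And>r. r \<in> R \<Longrightarrow> f r \<in> mat_kernel C"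
    and p: "\<And>r. r \<in> R \<Longrightarrow> p r < n"
    and eval: "\<And>r s. r \<in> R \<Longrightarrow> s \<in> R \<Longrightarrow> f r $ p s = (if r = s then 1 else 0)"
  shows "card R \<le> kernel_dim C"
proof -
  interpret K: kernel n n C by unfold_locales (rule C)
  have inj: "inj_on f R"
  proof (rule inj_onI)
    fix r s assume "r \<in> R" "s \<in> R" "f r = f s"
    then show "r = s" using eval[of r r] eval[of s r] by (metis zero_neq_one)
  qed
  have sub: "f ` R \<subseteq> mat_kernel C" using f by auto
  have "K.lin_indpt (f ` R)"
  proof (rule K.Ker.finite_lin_indpt2)
    show "finite (f ` R)" "f ` R \<subseteq> mat_kernel C" by (rule finite_imageI[OF R], rule sub)
    fix a :: "'f vec \<Rightarrow> 'f"
    assume lc: "K.lincomb a (f ` R) = 0\<^sub>v n"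
    show "\<forall>v\<in>f ` R. a v = 0"
    proof
      fix v assume "v \<in> f ` R"
      then obtain s where s: "s \<in> R" and v: "v = f s" by blast
      have "0 = K.lincomb a (f ` R) $ p s" using lc p[OF s] by simp
      also have "\<dots> = (\<Sum>v\<in>f ` R. a v * v $ p s)" by (rule K.lincomb_index[OF p[OF s] sub])
      also have "\<dots> = (\<Sum>r\<in>R. a (f r) * f r $ p s)" by (simp add: sum.reindex[OF inj] o_def)
      also have "\<dots> = (\<Sum>r\<in>R. if r = s then a (f r) else 0)"
        by (rule sum.cong[OF refl]) (use eval s in force)
      also have "\<dots> = a (f s)" using R s by simp
      finally show "a v = 0" by (simp add: v)
    qed
  qed
  moreover have "K.Ker.fin_dim" using kernel_basis_exists[OF C]
    unfolding K.Ker.fin_dim_def K.Ker.basis_def by blast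
  ultimately have "card (f ` R) \<le> K.dim" using K.Ker.li_le_dim(2) sub by blast
  then show ?thesis by (simp add: card_image[OF inj])
qed

lemma the_nth_index:
  assumes "distinct xs" "i < length xs"
  shows "(THE k. k < length xs \<and> xs ! k = xs ! i) = i"
proof (rule the_equality)
  show "k = i" if "k < length xs \<and> xs ! k = xs ! i" for k
    using that assms nth_eq_iff_index_eq[OF assms(1), of k i] by blast
qed (use assms in simp)

text \<open>The translation between vectors indexed by positions in the vertex list and functions on vertices. A complex kernel vector
yields two real eigenfunctions, its real and its imaginary part.\<close>

lemma eigenfunctions_of_kernel:
  assumes G: "pair_graph G"
  defines "vs \<equiv> vert_list G"
  defines "C \<equiv> char_matrix (map_mat complex_of_real (laplacian_mat G)) (complex_of_real 1)"
  defines "S \<equiv> eigenfunctions (parcs G) (pverts G) (\<lambda>v. deg G v)"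
  shows vert_list: "distinct vs" "set vs = pverts G"
    and laplacian_carrier: "laplacian_mat G \<in> carrier_mat (length vs) (length vs)"
    and laplacian_sym: "transpose_mat (laplacian_mat G) = laplacian_mat G"
    and char_carrier: "C \<in> carrier_mat (length vs) (length vs)"
    and Re_kernel: "v \<in> mat_kernel C \<Longrightarrow>
       (\<lambda>a. if a \<in> pverts G then Re (v $ (THE i. i < length vs \<and> vs ! i = a)) else 0) \<in> S"
    and Im_kernel: "v \<in> mat_kernel C \<Longrightarrow>
       (\<lambda>a. if a \<in> pverts G then Im (v $ (THE i. i < length vs \<and> vs ! i = a)) else 0) \<in> S"
    and kernel_of_eigenfunction: "x \<in> S \<Longrightarrow> vec (length vs) (\<lambda>i. complex_of_real (x (vs ! i))) \<in> mat_kernel C"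
proof -
  interpret pair_graph G by fact
  have "\<exists>l. distinct l \<and> set l = pverts G" using pair_finite_verts finite_distinct_list by blast
  then have "distinct (vert_list G) \<and> set (vert_list G) = pverts G"
    unfolding vert_list_def by (metis (mono_tags, lifting) someI_ex)
  then show vs: "distinct vs" "set vs = pverts G" by (auto simp: vs_def)
  define n where "n = length vs"
  have sy: "(a,b) \<in> parcs G \<longleftrightarrow> (b,a) \<in> parcs G" for a b
    using pair_sym_arcs by (auto simp: symmetric_def sym_def)
  have irr: "(a,a) \<notin> parcs G" for a using pair_no_loops[of "(a,a)"] by auto
  show L: "laplacian_mat G \<in> carrier_mat (length vs) (length vs)"
    by (auto simp: laplacian_mat_def degree_mat_def adjacency_mat_def Let_def vs_def)
  have Lij: "laplacian_mat G $$ (i,j) = (if i = j then real (deg G (vs ! i)) else 0)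
     - (if (vs ! i, vs ! j) \<in> parcs G then 1 else 0)" if "i < n" "j < n" for i j
    using that by (simp add: laplacian_mat_def degree_mat_def adjacency_mat_def Let_def vs_def n_def)
  show "transpose_mat (laplacian_mat G) = laplacian_mat G"
    by (rule eq_matI) (use L Lij sy in \<open>auto simp: n_def\<close>)
  show C: "C \<in> carrier_mat (length vs) (length vs)" using L by (simp add: C_def)
  have Cij: "C $$ (i,j) = (if i = j then of_nat (deg G (vs ! i)) - 1 else 0)
     - (if (vs ! i, vs ! j) \<in> parcs G then 1 else 0)" if "i < n" "j < n" for i j
    using that L Lij[OF that] by (auto simp: C_def char_matrix_def n_def)
  have vsV: "vs ! i \<in> pverts G" if "i < n" for i using that vs(2) nth_mem[of i vs] by (simp add: n_def)
  have bij: "bij_betw (\<lambda>i. vs ! i) {0..<n} (pverts G)"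
    by (rule bij_betw_nth[OF vs(1)]) (simp_all add: n_def vs(2) lessThan_atLeast0)
  have idx: "(THE k. k < length vs \<and> vs ! k = vs ! i) = i" if "i < n" for i
    using the_nth_index[OF vs(1)] that unfolding n_def by blast
  have row: "(\<Sum>j\<in>{0..<n}. C $$ (i,j) * X (vs ! j)) =
      (of_nat (deg G (vs ! i)) - 1) * X (vs ! i) - (\<Sum>w\<in>nbrs_in (parcs G) (pverts G) (vs ! i). X w)"
    if i: "i < n" for i and X :: "'a \<Rightarrow> complex"
  proof -
    have "(\<Sum>j\<in>{0..<n}. C $$ (i,j) * X (vs ! j)) =
      (\<Sum>j\<in>{0..<n}. (if j = i then (of_nat (deg G (vs ! i)) - 1) * X (vs ! i) else 0)
        - (if (vs ! i, vs ! j) \<in> parcs G then X (vs ! j) else 0))"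
      by (rule sum.cong) (use i in \<open>auto simp: Cij algebra_simps\<close>)
    also have "\<dots> = (of_nat (deg G (vs ! i)) - 1) * X (vs ! i)
        - (\<Sum>j\<in>{0..<n}. if (vs ! i, vs ! j) \<in> parcs G then X (vs ! j) else 0)"
      using i by (simp add: sum_subtractf)
    also have "(\<Sum>j\<in>{0..<n}. if (vs ! i, vs ! j) \<in> parcs G then X (vs ! j) else 0) =
      (\<Sum>w\<in>pverts G. if (vs ! i, w) \<in> parcs G then X w else 0)"
      by (rule sum.reindex_bij_betw[OF bij])
    also have "\<dots> = (\<Sum>w\<in>nbrs_in (parcs G) (pverts G) (vs ! i). X w)"
      using pair_finite_verts by (simp add: nbrs_in_def sum.inter_filter)
    finally show ?thesis .
  qed
  have kerI: "vec n (\<lambda>j. X (vs ! j)) \<in> mat_kernel C"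
    if "\<And>a. a \<in> pverts G \<Longrightarrow>
      (of_nat (deg G a) - 1) * X a = (\<Sum>w\<in>nbrs_in (parcs G) (pverts G) a. X w)" for X :: "'a \<Rightarrow> complex"
  proof (rule mat_kernelI[OF C])
    show "C *\<^sub>v vec n (\<lambda>j. X (vs ! j)) = 0\<^sub>v (length vs)"
    proof (rule eq_vecI)
      fix i assume "i < dim_vec (0\<^sub>v (length vs))"
      then have i: "i < n" by (simp add: n_def)
      have "(C *\<^sub>v vec n (\<lambda>j. X (vs ! j))) $ i = (\<Sum>j\<in>{0..<n}. C $$ (i,j) * X (vs ! j))"
        using C i by (simp add: scalar_prod_def n_def)
      then show "(C *\<^sub>v vec n (\<lambda>j. X (vs ! j))) $ i = 0\<^sub>v (length vs) $ i"
        using row[OF i, of X] that[OF vsV[OF i]] i by (simp add: n_def)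
    qed (use C in simp)
  qed (simp add: n_def)
  show "vec (length vs) (\<lambda>i. complex_of_real (x (vs ! i))) \<in> mat_kernel C" if "x \<in> S"
  proof -
    have "(of_nat (deg G a) - 1) * complex_of_real (x a) =
        (\<Sum>w\<in>nbrs_in (parcs G) (pverts G) a. complex_of_real (x w))" if "a \<in> pverts G" for a
    proof -
      have "(real (deg G a) - 1) * x a = (\<Sum>w\<in>nbrs_in (parcs G) (pverts G) a. x w)"
        using \<open>x \<in> S\<close> that by (simp add: S_def eigenfunctions_def)
      then have "complex_of_real ((real (deg G a) - 1) * x a) =
          complex_of_real (\<Sum>w\<in>nbrs_in (parcs G) (pverts G) a. x w)" by (rule arg_cong)
      then show ?thesis by simp
    qed
    from kerI[OF this] show ?thesis by (simp add: n_def)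
  qed
  have kerD: "(of_nat (deg G a) - 1) * X a = (\<Sum>w\<in>nbrs_in (parcs G) (pverts G) a. X w)"
    if v: "v \<in> mat_kernel C" and a: "a \<in> pverts G"
      and X: "X = (\<lambda>a. if a \<in> pverts G then v $ (THE i. i < length vs \<and> vs ! i = a) else 0)" for v X a
  proof -
    obtain i where i: "i < n" "a = vs ! i" using a vs(2) by (metis in_set_conv_nth n_def)
    have vX: "v = vec n (\<lambda>j. X (vs ! j))"
      using mat_kernelD(1)[OF C v] vsV idx by (intro eq_vecI) (auto simp: X n_def)
    have "0 = (C *\<^sub>v v) $ i" using mat_kernelD(2)[OF C v] i by (simp add: n_def)
    also have "\<dots> = (\<Sum>j\<in>{0..<n}. C $$ (i,j) * X (vs ! j))"
      using C i by (subst vX) (simp add: scalar_prod_def n_def)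
    finally show ?thesis using row[OF i(1), of X] i(2) by simp
  qed
  {
    fix v and h :: "complex \<Rightarrow> real"
    assume v: "v \<in> mat_kernel C" and h: "h = Re \<or> h = Im"
    define X where "X = (\<lambda>a. if a \<in> pverts G then v $ (THE i. i < length vs \<and> vs ! i = a) else 0)"
    have "(\<lambda>a. h (X a)) \<in> S" unfolding S_def eigenfunctions_def
    proof (rule CollectI, intro conjI allI ballI impI)
      show "h (X a) = 0" if "a \<notin> pverts G" for a using that h by (auto simp: X_def)
      fix a assume a: "a \<in> pverts G"
      have "h ((of_nat (deg G a) - 1) * X a) = h (\<Sum>w\<in>nbrs_in (parcs G) (pverts G) a. X w)"
        using kerD[OF v a X_def] by simp
      moreover have "h ((of_nat (deg G a) - 1) * X a) = (real (deg G a) - 1) * h (X a)"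
        using h by auto
      moreover have "h (\<Sum>w\<in>nbrs_in (parcs G) (pverts G) a. X w) = (\<Sum>w\<in>nbrs_in (parcs G) (pverts G) a. h (X w))"
        using h by (auto simp: Re_sum Im_sum)
      ultimately show "(real (deg G a) - 1) * h (X a) = (\<Sum>w\<in>nbrs_in (parcs G) (pverts G) a. h (X w))"
        by simp
    qed
    also have "(\<lambda>a. h (X a)) = (\<lambda>a. if a \<in> pverts G then h (v $ (THE i. i < length vs \<and> vs ! i = a)) else 0)"
      using h by (auto simp: X_def)
    finally have "(\<lambda>a. if a \<in> pverts G then h (v $ (THE i. i < length vs \<and> vs ! i = a)) else 0) \<in> S" .
  } note * = this
  show "v \<in> mat_kernel C \<Longrightarrow>
       (\<lambda>a. if a \<in> pverts G then Re (v $ (THE i. i < length vs \<and> vs ! i = a)) else 0) \<in> S"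
   "v \<in> mat_kernel C \<Longrightarrow>
       (\<lambda>a. if a \<in> pverts G then Im (v $ (THE i. i < length vs \<and> vs ! i = a)) else 0) \<in> S"
    using *[of v Re] *[of v Im] by simp_all
qed

text \<open>Functionals on real functions act on a complex kernel vector through real coefficients, hence separately on its real and
imaginary part; so they also separate complex kernel vectors from \<open>0\<close>.\<close>

lemma laplacian_mult_le:
  assumes G: "pair_graph G"
    and S: "dim_at_most (eigenfunctions (parcs G) (pverts G) (\<lambda>v. deg G v)) k"
  shows "laplacian_mult G 1 \<le> k"
proof -
  define vs where "vs = vert_list G"
  define C where "C = char_matrix (map_mat complex_of_real (laplacian_mat G)) (complex_of_real 1)"
  note E = eigenfunctions_of_kernel[OF G, folded vs_def C_def]
  from S obtain \<Phi> where P: "finite \<Phi>" "card \<Phi> \<le> k" "\<forall>\<phi>\<in>\<Phi>. linear_functional \<phi>"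
    "\<forall>x\<in>eigenfunctions (parcs G) (pverts G) (\<lambda>v. deg G v).
      (\<forall>\<phi>\<in>\<Phi>. \<phi> x = 0) \<longrightarrow> (\<forall>v. x v = 0)"
    by (elim dim_at_mostE)
  obtain f where f: "bij_betw f {0..<card \<Phi>} \<Phi>" using ex_bij_betw_nat_finite[OF P(1)] by blast
  define n where "n = length vs"
  have bij: "bij_betw (\<lambda>i. vs ! i) {0..<n} (pverts G)"
    by (rule bij_betw_nth[OF E(1)]) (simp_all add: n_def E(2) lessThan_atLeast0)
  have fin: "finite (pverts G)" using List.finite_set[of vs] unfolding E(2) .
  let ?i = "\<lambda>a. THE i. i < length vs \<and> vs ! i = a"
  have idx: "?i (vs ! i) = i" if "i < n" for i
    using the_nth_index[OF E(1)] that unfolding n_def by blast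
  have vsV: "vs ! i \<in> pverts G" if "i < n" for i using that E(2) nth_mem[of i vs] by (simp add: n_def)
  define c where "c = (\<lambda>i a. f i (\<lambda>w. if w = a then 1 else (0::real)))"
  define W where "W = (\<lambda>i. vec n (\<lambda>j. complex_of_real (c i (vs ! j))))"
  have "kernel_dim C \<le> card \<Phi>"
  proof (rule kernel_dim_le[OF E(5)])
    show "W i \<in> carrier_vec (length vs)" for i by (simp add: W_def n_def)
    fix v assume v: "v \<in> mat_kernel C" and W0: "\<And>i. i < card \<Phi> \<Longrightarrow> W i \<bullet> v = 0"
    have vc: "v \<in> carrier_vec n" using mat_kernelD(1)[OF E(5) v] by (simp add: n_def)
    have zero: "h (v $ j) = 0" if j: "j < n" and h: "h = Re \<or> h = Im"
      and xS: "(\<lambda>a. if a \<in> pverts G then h (v $ ?i a) else 0)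
          \<in> eigenfunctions (parcs G) (pverts G) (\<lambda>v. deg G v)" for h j
    proof -
      let ?x = "\<lambda>a. if a \<in> pverts G then h (v $ ?i a) else 0"
      have "\<phi> ?x = 0" if phi: "\<phi> \<in> \<Phi>" for \<phi>
      proof -
        from f phi have "\<phi> \<in> f ` {0..<card \<Phi>}" by (simp add: bij_betw_def)
        then obtain i where i: "i < card \<Phi>" "\<phi> = f i" by (elim imageE) simp
        have "\<phi> ?x = (\<Sum>a\<in>pverts G. ?x a * c i a)"
          unfolding c_def using linear_functional_expand[OF bspec[OF P(3) phi] fin, of ?x] i by simp
        also have "\<dots> = (\<Sum>j\<in>{0..<n}. ?x (vs ! j) * c i (vs ! j))"
          by (rule sum.reindex_bij_betw[OF bij, symmetric])
        also have "\<dots> = (\<Sum>j\<in>{0..<n}. h (W i $ j * v $ j))"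
          by (rule sum.cong) (use vsV idx h in \<open>auto simp: W_def\<close>)
        also have "\<dots> = h (W i \<bullet> v)"
          using vc h by (auto simp: scalar_prod_def Re_sum Im_sum)
        also have "\<dots> = 0" using W0[OF i(1)] h by auto
        finally show ?thesis .
      qed
      then have "?x (vs ! j) = 0" using P(4) xS by blast
      then show ?thesis using vsV[OF j] idx[OF j] by simp
    qed
    have "v $ j = 0" if "j < n" for j
      using zero[OF that _ E(6)[OF v]] zero[OF that _ E(7)[OF v]] by (simp add: complex_eq_iff)
    then show "v = 0\<^sub>v (length vs)" using vc by (intro eq_vecI) (auto simp: n_def)
  qed
  then show ?thesis unfolding laplacian_mult_def
    using real_symmetric_order_eq_kernel_dim[OF E(3,4), of 1] P(2) by (simp add: C_def)
qed

text \<open>If the values on \<open>R\<close> can be prescribed and determine the eigenfunction, the evaluations at \<open>R\<close> give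
the upper bound and the functions dual to \<open>R\<close> the lower bound.\<close>

lemma laplacian_mult_eq_card:
  assumes G: "pair_graph G" and R: "R \<subseteq> pverts G"
    and det: "\<And>x v. x \<in> eigenfunctions (parcs G) (pverts G) (\<lambda>v. deg G v) \<Longrightarrow>
        (\<forall>r\<in>R. x r = 0) \<Longrightarrow> x v = 0"
    and dual: "\<And>r. r \<in> R \<Longrightarrow> \<exists>x \<in> eigenfunctions (parcs G) (pverts G) (\<lambda>v. deg G v).
        \<forall>s\<in>R. x s = (if r = s then 1 else 0)"
  shows "laplacian_mult G 1 = card R"
proof (rule antisym)
  define vs where "vs = vert_list G"
  define C where "C = char_matrix (map_mat complex_of_real (laplacian_mat G)) (complex_of_real 1)"
  note E = eigenfunctions_of_kernel[OF G, folded vs_def C_def]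
  have fin: "finite R" using finite_subset[OF R] List.finite_set[of vs] unfolding E(2) by blast
  have "dim_at_most (eigenfunctions (parcs G) (pverts G) (\<lambda>v. deg G v)) (0 + card R)"
    by (rule dim_at_most_evals[OF fin], rule dim_at_most_0) (use det in blast)
  then show "laplacian_mult G 1 \<le> card R" using laplacian_mult_le[OF G] by simp
  let ?i = "\<lambda>a. THE i. i < length vs \<and> vs ! i = a"
  have idx: "?i a < length vs" "vs ! (?i a) = a" if "a \<in> pverts G" for a
  proof -
    from that have "a \<in> set vs" by (simp only: E(2))
    then obtain i where i: "i < length vs" "a = vs ! i" by (auto simp: in_set_conv_nth)
    have "?i a = i" unfolding i(2) by (rule the_nth_index[OF E(1) i(1)])
    then show "?i a < length vs" "vs ! (?i a) = a" using i by (simp_all only:)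
  qed
  obtain x where x: "\<And>r. r \<in> R \<Longrightarrow> x r \<in> eigenfunctions (parcs G) (pverts G) (\<lambda>v. deg G v)"
    "\<And>r s. r \<in> R \<Longrightarrow> s \<in> R \<Longrightarrow> x r s = (if r = s then 1 else 0)"
    using dual by metis
  have "card R \<le> kernel_dim C"
  proof (rule kernel_dim_ge[OF E(5) fin])
    show "vec (length vs) (\<lambda>i. complex_of_real (x r (vs ! i))) \<in> mat_kernel C" if "r \<in> R" for r
      by (rule E(8)) (rule x(1)[OF that])
    show "?i r < length vs" if "r \<in> R" for r using idx R that by blast
    show "vec (length vs) (\<lambda>i. complex_of_real (x r (vs ! i))) $ (?i s) = (if r = s then 1 else 0)"
      if "r \<in> R" "s \<in> R" for r s
      using idx[of s] x(2)[OF that] R that by (auto simp: subset_iff)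
  qed
  then show "card R \<le> laplacian_mult G 1" unfolding laplacian_mult_def
    using real_symmetric_order_eq_kernel_dim[OF E(3,4), of 1] by (simp add: C_def)
qed

section \<open>Components and non-bridges\<close>

definition component :: "('a \<times> 'a) set \<Rightarrow> 'a set \<Rightarrow> 'a \<Rightarrow> 'a set" where
  "component E V v = {w. (v, w) \<in> (E \<inter> V \<times> V)\<^sup>*}"

definition num_components :: "('a \<times> 'a) set \<Rightarrow> 'a set \<Rightarrow> nat" where
  "num_components E V = card (component E V ` V)"

text \<open>The edge lies on a cycle: its ends stay connected after its removal.\<close>

definition nonbridge :: "('a \<times> 'a) set \<Rightarrow> 'a set \<Rightarrow> 'a \<Rightarrow> 'a \<Rightarrow> bool" where
  "nonbridge E V a b \<longleftrightarrow> (a, b) \<in> E \<and> a \<in> V \<and> b \<in> V \<and> b \<in> component (E - {(a, b), (b, a)}) V a"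

lemma nbrs_in_mono: "V' \<subseteq> V \<Longrightarrow> nbrs_in E V' v \<subseteq> nbrs_in E V v"
  by (auto simp: nbrs_in_def)

lemma finite_nbrs_in: "finite V \<Longrightarrow> finite (nbrs_in E V v)"
  by (simp add: nbrs_in_def)

lemma card_nbrs_in_mono: "finite V \<Longrightarrow> V' \<subseteq> V \<Longrightarrow> card (nbrs_in E V' v) \<le> card (nbrs_in E V v)"
  by (intro card_mono finite_nbrs_in nbrs_in_mono)

lemma nbrs_in_sym: "sym E \<Longrightarrow> v \<in> V \<Longrightarrow> w \<in> nbrs_in E V v \<Longrightarrow> v \<in> nbrs_in E V w"
  unfolding nbrs_in_def using symD by fastforce

lemma component_refl: "v \<in> component E V v"
  by (simp add: component_def)

lemma component_subset: "v \<in> V \<Longrightarrow> component E V v \<subseteq> V"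
proof
  fix w assume "v \<in> V" "w \<in> component E V v"
  from this(2)[unfolded component_def, simplified] this(1) show "w \<in> V"
    by (induction rule: rtrancl_induct) auto
qed

lemma component_step: "u \<in> component E V v \<Longrightarrow> u \<in> V \<Longrightarrow> w \<in> nbrs_in E V u \<Longrightarrow> w \<in> component E V v"
  unfolding component_def nbrs_in_def by (auto intro: rtrancl_into_rtrancl)

lemma component_least:
  assumes "v \<in> C" "\<And>u w. u \<in> C \<Longrightarrow> u \<in> V \<Longrightarrow> w \<in> nbrs_in E V u \<Longrightarrow> w \<in> C"
  shows "component E V v \<subseteq> C"
proof
  fix w assume "w \<in> component E V v"
  then have "(v, w) \<in> (E \<inter> V \<times> V)\<^sup>*" by (simp add: component_def)
  then show "w \<in> C"
    by (induction rule: rtrancl_induct) (use assms in \<open>auto simp: nbrs_in_def\<close>)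
qed

lemma component_eq:
  assumes "sym E" "u \<in> component E V v"
  shows "component E V u = component E V v"
proof -
  have s: "sym ((E \<inter> V \<times> V)\<^sup>*)" using assms(1) by (intro sym_rtrancl) (auto simp: sym_def)
  have "(v, u) \<in> (E \<inter> V \<times> V)\<^sup>*" using assms(2) by (simp add: component_def)
  moreover from this have "(u, v) \<in> (E \<inter> V \<times> V)\<^sup>*" by (rule symD[OF s])
  ultimately show ?thesis unfolding component_def by (auto intro: rtrancl_trans)
qed

text \<open>A component of \<open>V - {w}\<close> that contains no neighbour of \<open>w\<close> is already a component of
\<open>V\<close> other than that of \<open>w\<close>, and there are at most \<open>deg w\<close> components that contain one.\<close>

lemma num_components_remove:
  assumes fin: "finite V" and E: "sym E" and w: "w \<in> V"
  shows "num_components E (V - {w}) + 1 \<le> num_components E V + card (nbrs_in E V w)"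
proof -
  let ?c = "component E V" and ?c' = "component E (V - {w})"
  have "?c' ` (V - {w}) \<subseteq> ?c' ` nbrs_in E V w \<union> (?c ` V - {?c w})"
  proof
    fix K assume "K \<in> ?c' ` (V - {w})"
    then obtain u where u: "u \<in> V" "u \<noteq> w" "K = ?c' u" by auto
    show "K \<in> ?c' ` nbrs_in E V w \<union> (?c ` V - {?c w})"
    proof (cases "?c' u \<inter> nbrs_in E V w = {}")
      case False
      then show ?thesis using component_eq[OF E] u(3) by blast
    next
      case True
      have "?c u \<subseteq> ?c' u"
      proof (rule component_least[OF component_refl])
        fix y z assume y: "y \<in> ?c' u" "y \<in> V" and z: "z \<in> nbrs_in E V y"
        have yw: "y \<noteq> w" using component_subset[of u "V - {w}" E] u y by auto
        have "z \<noteq> w" using True y nbrs_in_sym[OF E y(2) z] by auto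
        then have "z \<in> nbrs_in E (V - {w}) y" using z by (auto simp: nbrs_in_def)
        then show "z \<in> ?c' u" using component_step[OF y(1)] y yw by auto
      qed
      moreover have "?c' u \<subseteq> ?c u"
      proof (rule component_least[OF component_refl])
        fix y z assume "y \<in> ?c u" "y \<in> V - {w}" "z \<in> nbrs_in E (V - {w}) y"
        then show "z \<in> ?c u" using component_step[of y E V u z] nbrs_in_mono[of "V - {w}" V] by auto
      qed
      ultimately have eq: "?c u = ?c' u" by blast
      have "w \<notin> ?c' u" using component_subset[of u "V - {w}" E] u by auto
      then have "?c u \<noteq> ?c w" using eq component_refl[of w] by blast
      then show ?thesis using u eq by auto
    qed
  qed
  then have "card (?c' ` (V - {w})) \<le> card (?c' ` nbrs_in E V w \<union> (?c ` V - {?c w}))"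
    by (intro card_mono) (use fin finite_nbrs_in[OF fin] in auto)
  also have "\<dots> \<le> card (nbrs_in E V w) + card (?c ` V - {?c w})"
    using card_Un_le card_image_le[OF finite_nbrs_in[OF fin], of ?c' E w] by (meson add_le_mono1 le_trans)
  finally have le: "card (?c' ` (V - {w})) \<le> card (nbrs_in E V w) + card (?c ` V - {?c w})" .
  have "card (?c ` V - {?c w}) + 1 = card (?c ` V)"
    using card_Suc_Diff1[of "?c ` V" "?c w"] fin w by (simp del: card_Diff_singleton)
  with le show ?thesis unfolding num_components_def by linarith
qed

text \<open>Degrees only drop while the vertices of \<open>B\<close> are deleted one after the other.\<close>

lemma num_components_remove_set:
  assumes fin: "finite V" and E: "sym E" and B: "B \<subseteq> V"
  shows "num_components E (V - B) + card B \<le> num_components E V + (\<Sum>b\<in>B. card (nbrs_in E V b))"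
  using finite_subset[OF B fin] B
proof (induction B rule: finite_induct)
  case (insert b B)
  have "num_components E (V - B - {b}) + 1 \<le> num_components E (V - B) + card (nbrs_in E (V - B) b)"
    by (rule num_components_remove) (use fin E insert in auto)
  also have "card (nbrs_in E (V - B) b) \<le> card (nbrs_in E V b)"
    by (rule card_nbrs_in_mono[OF fin]) auto
  finally have "num_components E (V - B - {b}) + 1 \<le> num_components E (V - B) + card (nbrs_in E V b)"
    by simp
  moreover have "V - insert b B = V - B - {b}" by auto
  ultimately show ?case using insert by simp
qed simp

lemma num_components_closed:
  assumes fin: "finite V" and E: "sym E" and C: "C \<subseteq> V" "C \<noteq> {}"
    and closed: "\<forall>u\<in>C. nbrs_in E V u \<subseteq> C"
  shows "num_components E (V - C) + 1 \<le> num_components E V"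
proof -
  obtain c where c: "c \<in> C" using C by auto
  have "component E (V - C) ` (V - C) \<subseteq> component E V ` V - {component E V c}"
  proof
    fix K assume "K \<in> component E (V - C) ` (V - C)"
    then obtain u where u: "u \<in> V" "u \<notin> C" "K = component E (V - C) u" by auto
    have "component E V u \<subseteq> component E (V - C) u \<inter> (V - C)"
    proof (rule component_least)
      fix y z assume y: "y \<in> component E (V - C) u \<inter> (V - C)" "y \<in> V" and z: "z \<in> nbrs_in E V y"
      have "z \<notin> C" using closed nbrs_in_sym[OF E y(2) z] y by auto
      then have "z \<in> nbrs_in E (V - C) y" using z by (auto simp: nbrs_in_def)
      then show "z \<in> component E (V - C) u \<inter> (V - C)"
        using component_step[of y E "V - C" u z] y by (auto simp: nbrs_in_def)
    qed (use u component_refl in auto)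
    moreover have "component E (V - C) u \<subseteq> component E V u"
    proof (rule component_least[OF component_refl])
      fix y z assume "y \<in> component E V u" "y \<in> V - C" "z \<in> nbrs_in E (V - C) y"
      then show "z \<in> component E V u"
        using component_step[of y E V u z] nbrs_in_mono[of "V - C" V] by auto
    qed
    ultimately have "K = component E V u" "c \<notin> K" using c u(3) by blast+
    then show "K \<in> component E V ` V - {component E V c}" using u component_refl[of c] by auto
  qed
  then have "card (component E (V - C) ` (V - C)) \<le> card (component E V ` V - {component E V c})"
    by (intro card_mono) (use fin in auto)
  moreover have "card (component E V ` V - {component E V c}) + 1 = card (component E V ` V)"
    using card_Suc_Diff1[of "component E V ` V" "component E V c"] fin c C(1)
    by (simp add: subset_iff del: card_Diff_singleton)
  ultimately show ?thesis unfolding num_components_def by linarith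
qed

lemma nonbridge_component:
  assumes E: "sym E" and nb: "nonbridge E V a b"
  shows "component (E - {(a, b), (b, a)}) V v = component E V v"
proof
  let ?F = "E - {(a, b), (b, a)}"
  have F: "sym ?F" using E by (auto simp: sym_def)
  have ab: "b \<in> component ?F V a" "a \<in> component ?F V b"
    using nb component_eq[OF F, of b V a] component_refl[of a] by (auto simp: nonbridge_def)
  show "component E V v \<subseteq> component ?F V v"
  proof (rule component_least[OF component_refl])
    fix y z assume y: "y \<in> component ?F V v" "y \<in> V" and z: "z \<in> nbrs_in E V y"
    have "z \<in> component ?F V y"
    proof (cases "(y, z) = (a, b) \<or> (y, z) = (b, a)")
      case False
      then have "z \<in> nbrs_in ?F V y" using z by (auto simp: nbrs_in_def)
      then show ?thesis using component_step[OF component_refl y(2)] by blast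
    qed (use ab in auto)
    then show "z \<in> component ?F V v" using component_eq[OF F y(1)] by simp
  qed
  show "component ?F V v \<subseteq> component E V v"
  proof (rule component_least[OF component_refl])
    fix y z assume "y \<in> component E V v" "y \<in> V" "z \<in> nbrs_in ?F V y"
    then show "z \<in> component E V v" using component_step[of y E V v z] by (auto simp: nbrs_in_def)
  qed
qed

lemma nonbridge_num_components:
  assumes "sym E" "nonbridge E V a b"
  shows "num_components (E - {(a, b), (b, a)}) V = num_components E V"
  using nonbridge_component[OF assms] by (simp add: num_components_def)

lemma nonbridge_sym:
  assumes E: "sym E" and nb: "nonbridge E V a b"
  shows "nonbridge E V b a"
proof -
  have F: "sym (E - {(a, b), (b, a)})" using E by (auto simp: sym_def)
  have eq: "{(a, b), (b, a)} = {(b, a), (a, b)}" by blast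
  have "a \<in> component (E - {(a, b), (b, a)}) V b"
    using nb component_eq[OF F, of b V a] component_refl[of a] by (auto simp: nonbridge_def)
  then show ?thesis using nb symD[OF E, of a b] unfolding nonbridge_def eq by blast
qed

lemma nonbridge_mono:
  assumes "nonbridge E V a b" "V \<subseteq> W"
  shows "nonbridge E W a b"
proof -
  have "(E - {(a, b), (b, a)}) \<inter> V \<times> V \<subseteq> (E - {(a, b), (b, a)}) \<inter> W \<times> W" using assms(2) by auto
  from rtrancl_mono[OF this] show ?thesis using assms by (auto simp: nonbridge_def component_def)
qed

text \<open>The exceptional vertex \<open>a\<close>, which may be a leaf, makes the induction work: if an edge from \<open>a\<close> to
\<open>b\<close> is a bridge, the component of \<open>b\<close> without that edge is smaller and \<open>b\<close> takes over
the role of the exceptional vertex.\<close>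

lemma nonbridge_exists_except_one:
  assumes "finite V" "sym E" "irrefl E" "a \<in> V" "nbrs_in E V a \<noteq> {}"
    and "\<And>v. v \<in> V \<Longrightarrow> v \<noteq> a \<Longrightarrow> 2 \<le> card (nbrs_in E V v)"
  shows "\<exists>x y. nonbridge E V x y"
  using assms
proof (induction "card V" arbitrary: V a rule: less_induct)
  case less
  note fin = less.prems(1) and E = less.prems(2,3)
  obtain b where b: "b \<in> V" "(a, b) \<in> E" "(b, a) \<in> E"
    using less.prems(5) symD[OF E(1)] unfolding nbrs_in_def by blast
  have ab: "a \<noteq> b" using b E by (auto simp: irrefl_def)
  let ?F = "E - {(b, a), (a, b)}"
  define B where "B = component ?F V b"
  show ?case
  proof (cases "a \<in> B")
    case True
    then have "nonbridge E V b a" using b less.prems(4) by (simp add: nonbridge_def B_def)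
    then show ?thesis by blast
  next
    case False
    have BV: "B \<subseteq> V" using component_subset b(1) by (simp add: B_def)
    have bB: "b \<in> B" by (simp add: B_def component_refl)
    have step: "z \<in> B" if "y \<in> B" "z \<in> nbrs_in E V y" "(y, z) \<noteq> (b, a)" for y z
    proof -
      have "y \<noteq> a" using that False by auto
      then have "z \<in> nbrs_in ?F V y" using that by (auto simp: nbrs_in_def)
      then show ?thesis using component_step[of y ?F V b z] that BV by (auto simp: B_def)
    qed
    have nb: "nbrs_in E B y = nbrs_in E V y" if "y \<in> B" "y \<noteq> b" for y
      using step that BV by (auto simp: nbrs_in_def)
    have "\<exists>x y. nonbridge E B x y"
    proof (rule less.hyps[where a = b])
      show "card B < card V" using False less.prems(4) fin BV by (intro psubset_card_mono) auto
      show "finite B" using finite_subset[OF BV fin] .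
      show "nbrs_in E B b \<noteq> {}"
      proof
        assume "nbrs_in E B b = {}"
        then have "nbrs_in E V b \<subseteq> {a}" using step[OF bB] by (auto simp: nbrs_in_def)
        then have "card (nbrs_in E V b) \<le> 1" using card_mono[of "{a}"] by force
        then show False using less.prems(6)[OF b(1)] ab by simp
      qed
      show "2 \<le> card (nbrs_in E B v)" if "v \<in> B" "v \<noteq> b" for v
        using less.prems(6)[of v] nb[OF that] that False BV by auto
    qed (use E bB in auto)
    then obtain x y where "nonbridge E B x y" by (elim exE)
    then have "nonbridge E V x y" using BV by (rule nonbridge_mono)
    then show ?thesis by (intro exI)
  qed
qed

lemma forest_small_degree:
  assumes "finite V" "sym E" "irrefl E" and forest: "\<And>x y. \<not> nonbridge E V x y"
    and W: "W \<subseteq> V" "W \<noteq> {}"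
  shows "\<exists>z\<in>W. card (nbrs_in E W z) \<le> 1"
proof (rule ccontr)
  assume "\<not> ?thesis"
  then have two: "2 \<le> card (nbrs_in E W z)" if "z \<in> W" for z using that by force
  obtain a where a: "a \<in> W" using W by auto
  have "nbrs_in E W a \<noteq> {}" using two[OF a] by auto
  then have "\<exists>x y. nonbridge E W x y"
    by (rule nonbridge_exists_except_one[OF finite_subset[OF W(1) assms(1)] assms(2,3) a]) (rule two)
  then obtain x y where "nonbridge E W x y" by (elim exE)
  then have "nonbridge E V x y" using W(1) by (rule nonbridge_mono)
  then show False using forest by simp
qed

text \<open>Twice the inequality \<open>n \<le> \<kappa> + m\<close>; every vertex deletion lowers the degree sum by twice the degree.\<close>

lemma card_le_num_components_edges:
  assumes "finite V" "sym E" "irrefl E"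
  shows "2 * card V \<le> 2 * num_components E V + (\<Sum>v\<in>V. card (nbrs_in E V v))"
  using assms
proof (induction V rule: finite_induct)
  case (insert w V)
  let ?W = "insert w V"
  have "num_components E (?W - {w}) + 1 \<le> num_components E ?W + card (nbrs_in E ?W w)"
    by (rule num_components_remove) (use insert in auto)
  then have nc: "num_components E V + 1 \<le> num_components E ?W + card (nbrs_in E ?W w)"
    using insert.hyps by simp
  have "(\<Sum>v\<in>V. card (nbrs_in E ?W v)) = (\<Sum>v\<in>V. card (nbrs_in E V v) + (if v \<in> nbrs_in E ?W w then 1 else 0))"
  proof (rule sum.cong[OF refl])
    fix v assume v: "v \<in> V"
    have "nbrs_in E ?W v = (if v \<in> nbrs_in E ?W w then insert w (nbrs_in E V v) else nbrs_in E V v)"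
      using v symD[OF insert.prems(1), of v w] symD[OF insert.prems(1), of w v]
      by (auto simp: nbrs_in_def)
    then show "card (nbrs_in E ?W v) = card (nbrs_in E V v) + (if v \<in> nbrs_in E ?W w then 1 else 0)"
      using insert.hyps finite_nbrs_in[OF insert.hyps(1), of E v] by (auto simp: nbrs_in_def)
  qed
  also have "\<dots> = (\<Sum>v\<in>V. card (nbrs_in E V v)) + card (nbrs_in E ?W w)"
  proof -
    have "nbrs_in E ?W w \<subseteq> V" using insert.prems by (auto simp: nbrs_in_def irrefl_def)
    then have "{v \<in> V. v \<in> nbrs_in E ?W w} = nbrs_in E ?W w" by auto
    then show ?thesis using insert.hyps by (simp add: sum.distrib sum.If_cases Int_def)
  qed
  finally have "(\<Sum>v\<in>?W. card (nbrs_in E ?W v)) = (\<Sum>v\<in>V. card (nbrs_in E V v)) + 2 * card (nbrs_in E ?W w)"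
    using insert.hyps by simp
  then show ?case using insert.IH insert.prems nc insert.hyps by simp
qed simp

section \<open>Nullity of weighted graphs: deleting closed sets, hubs and pendant paths\<close>

text \<open>This potential equals \<open>4 c + n - 2\<close> for a connected graph weighted by its degrees.\<close>

definition nullity_bound :: "('a \<times> 'a) set \<Rightarrow> 'a set \<Rightarrow> ('a \<Rightarrow> nat) \<Rightarrow> int" where
  "nullity_bound E V d = (\<Sum>v\<in>V. 2 * int (d v) - 3) + 2 * int (num_components E V)"

text \<open>The situation after all pendant vertices of weight \<open>1\<close> have been removed.\<close>

definition admissible :: "('a \<times> 'a) set \<Rightarrow> 'a set \<Rightarrow> ('a \<Rightarrow> nat) \<Rightarrow> bool" where
  "admissible E V d \<longleftrightarrow> finite V \<and> sym E \<and> irrefl E \<and> (\<forall>v\<in>V. 2 \<le> d v \<and> card (nbrs_in E V v) \<le> d v)"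

definition in_edge_component :: "('a \<times> 'a) set \<Rightarrow> 'a set \<Rightarrow> 'a \<Rightarrow> bool" where
  "in_edge_component E V v \<longleftrightarrow> (\<exists>w. nbrs_in E V v = {w} \<and> nbrs_in E V w = {v})"

definition in_hexagon_component :: "('a \<times> 'a) set \<Rightarrow> 'a set \<Rightarrow> 'a \<Rightarrow> bool" where
  "in_hexagon_component E V v \<longleftrightarrow> (\<exists>c1 c2 c3 c4 c5. distinct [v, c1, c2, c3, c4, c5] \<and>
     nbrs_in E V v = {c5, c1} \<and> nbrs_in E V c1 = {v, c2} \<and> nbrs_in E V c2 = {c1, c3} \<and>
     nbrs_in E V c3 = {c2, c4} \<and> nbrs_in E V c4 = {c3, c5} \<and> nbrs_in E V c5 = {c4, v})"

text \<open>The equality case. The weight \<open>2\<close> at a vertex of an edge component leaves room for one edge to a deleted vertex;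
in a hexagon there is none.\<close>

definition extremal :: "('a \<times> 'a) set \<Rightarrow> 'a set \<Rightarrow> ('a \<Rightarrow> nat) \<Rightarrow> bool" where
  "extremal E V d \<longleftrightarrow> (\<forall>v\<in>V. d v = 2 \<and> (in_edge_component E V v \<or> in_hexagon_component E V v))"

definition bounded :: "('a \<times> 'a) set \<Rightarrow> 'a set \<Rightarrow> ('a \<Rightarrow> nat) \<Rightarrow> bool" where
  "bounded E V d \<longleftrightarrow> (\<exists>k. dim_at_most (eigenfunctions E V d) k \<and>
     (4 * int k < nullity_bound E V d \<or> 4 * int k = nullity_bound E V d \<and> extremal E V d))"

lemma boundedE:
  assumes "bounded E V d"
  obtains k where "dim_at_most (eigenfunctions E V d) k" "4 * int k \<le> nullity_bound E V d"
    "4 * int k = nullity_bound E V d \<longrightarrow> extremal E V d"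
  using assms unfolding bounded_def by fastforce

lemma bounded_strictI:
  "dim_at_most (eigenfunctions E V d) k \<Longrightarrow> 4 * int k < nullity_bound E V d \<Longrightarrow> bounded E V d"
  unfolding bounded_def by blast

lemma admissible_subset:
  assumes "admissible E V d" "V' \<subseteq> V"
  shows "admissible E V' d"
  using assms finite_subset[of V' V] card_nbrs_in_mono[of V V' E]
  unfolding admissible_def by (meson le_trans subsetD)

lemma eigenfunction_eq:
  "x \<in> eigenfunctions E V d \<Longrightarrow> v \<in> V \<Longrightarrow> (real (d v) - 1) * x v = (\<Sum>w\<in>nbrs_in E V v. x w)"
  by (simp add: eigenfunctions_def)

lemma eigenfunction_eq1:
  "x \<in> eigenfunctions E V d \<Longrightarrow> v \<in> V \<Longrightarrow> nbrs_in E V v = {u} \<Longrightarrow> (real (d v) - 1) * x v = x u"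
  by (simp add: eigenfunction_eq)

lemma eigenfunction_eq2:
  "x \<in> eigenfunctions E V d \<Longrightarrow> v \<in> V \<Longrightarrow> nbrs_in E V v = {u, w} \<Longrightarrow> u \<noteq> w \<Longrightarrow>
    (real (d v) - 1) * x v = x u + x w"
  by (simp add: eigenfunction_eq)

lemma eigenfunction_outside: "x \<in> eigenfunctions E V d \<Longrightarrow> v \<notin> V \<Longrightarrow> x v = 0"
  by (simp add: eigenfunctions_def)

text \<open>Deleting vertices does not disturb the equation at a surviving vertex if the function vanishes at its deleted neighbours.\<close>

lemma eigenfunction_restrict:
  assumes fin: "finite V" and sub: "V' \<subseteq> V" and x: "x \<in> eigenfunctions E V d"
    and sep: "\<And>v w. v \<in> V' \<Longrightarrow> w \<in> nbrs_in E V v \<Longrightarrow> w \<notin> V' \<Longrightarrow> x w = 0"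
  shows "(\<lambda>v. if v \<in> V' then x v else 0) \<in> eigenfunctions E V' d"
proof -
  have "(real (d v) - 1) * x v = (\<Sum>w\<in>nbrs_in E V' v. x w)" if v: "v \<in> V'" for v
  proof -
    have "(real (d v) - 1) * x v = (\<Sum>w\<in>nbrs_in E V v. x w)"
      using eigenfunction_eq[OF x] v sub by auto
    also have "\<dots> = (\<Sum>w\<in>nbrs_in E V' v. x w)"
      by (rule sum.mono_neutral_right) (use fin sub sep[OF v] in \<open>auto simp: nbrs_in_def\<close>)
    finally show ?thesis .
  qed
  moreover have "(\<Sum>w\<in>nbrs_in E V' v. if w \<in> V' then x w else 0) = (\<Sum>w\<in>nbrs_in E V' v. x w)" for v
    by (rule sum.cong) (auto simp: nbrs_in_def)
  ultimately show ?thesis by (simp add: eigenfunctions_def)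
qed

text \<open>The common pattern of all deletions: once \<open>x\<close> is made to vanish on the probe set \<open>R\<close>, it restricts
to an eigenfunction on \<open>V'\<close>, and this restriction determines \<open>x\<close>.\<close>

lemma dim_at_most_probe:
  assumes fin: "finite V" and sub: "V' \<subseteq> V" and R: "finite R"
    and dim: "dim_at_most (eigenfunctions E V' d) k"
    and sep: "\<And>x v w. x \<in> eigenfunctions E V d \<Longrightarrow> (\<And>r. r \<in> R \<Longrightarrow> x r = 0) \<Longrightarrow>
       v \<in> V' \<Longrightarrow> w \<in> nbrs_in E V v \<Longrightarrow> w \<notin> V' \<Longrightarrow> x w = 0"
    and inj: "\<And>x v. x \<in> eigenfunctions E V d \<Longrightarrow> (\<And>r. r \<in> R \<Longrightarrow> x r = 0) \<Longrightarrow>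
       (\<And>u. u \<in> V' \<Longrightarrow> x u = 0) \<Longrightarrow> v \<in> V \<Longrightarrow> v \<notin> V' \<Longrightarrow> x v = 0"
  shows "dim_at_most (eigenfunctions E V d) (k + card R)"
proof (rule dim_at_most_evals[OF R], rule dim_at_most_restrict[OF dim])
  fix x assume "x \<in> {x \<in> eigenfunctions E V d. \<forall>r\<in>R. x r = 0}"
  then have x: "x \<in> eigenfunctions E V d" "\<And>r. r \<in> R \<Longrightarrow> x r = 0" by auto
  show "(\<lambda>v. if v \<in> V' then x v else 0) \<in> eigenfunctions E V' d"
    by (rule eigenfunction_restrict[OF fin sub x(1)]) (rule sep[OF x])
  show "x v = 0" if "\<And>u. u \<in> V' \<Longrightarrow> x u = 0" for v
    using inj[OF x that, of v] that eigenfunction_outside[OF x(1), of v] by blast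
qed

text \<open>In many deletions, vanishing on \<open>R\<close> forces \<open>x\<close> to vanish at all deleted vertices.\<close>

lemma dim_at_most_kill:
  assumes fin: "finite V" and sub: "V' \<subseteq> V" and R: "finite R"
    and dim: "dim_at_most (eigenfunctions E V' d) k"
    and kill: "\<And>x v. x \<in> eigenfunctions E V d \<Longrightarrow> (\<And>r. r \<in> R \<Longrightarrow> x r = 0) \<Longrightarrow>
       v \<in> V \<Longrightarrow> v \<notin> V' \<Longrightarrow> x v = 0"
  shows "dim_at_most (eigenfunctions E V d) (k + card R)"
proof (rule dim_at_most_probe[OF fin sub R dim])
  show "x w = 0" if "x \<in> eigenfunctions E V d" "\<And>r. r \<in> R \<Longrightarrow> x r = 0" "w \<in> nbrs_in E V v" "w \<notin> V'" for x v w
    by (rule kill[OF that(1,2)]) (use that in \<open>auto simp: nbrs_in_def\<close>)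
  show "x v = 0" if "x \<in> eigenfunctions E V d" "\<And>r. r \<in> R \<Longrightarrow> x r = 0" "v \<in> V" "v \<notin> V'" for x v
    by (rule kill[OF that(1,2)]) (use that in auto)
qed

lemma nullity_bound_split:
  assumes "finite V" "C \<subseteq> V"
  shows "nullity_bound E V d = nullity_bound E (V - C) d + (\<Sum>v\<in>C. 2 * int (d v) - 3)
    + 2 * int (num_components E V) - 2 * int (num_components E (V - C))"
  using sum.subset_diff[OF assms(2,1), of "\<lambda>v. 2 * int (d v) - 3"] by (simp add: nullity_bound_def)

lemma nbrs_in_closed_diff:
  assumes "sym E" "\<forall>u\<in>C. nbrs_in E V u \<subseteq> C" "v \<in> V - C"
  shows "nbrs_in E (V - C) v = nbrs_in E V v"
proof -
  have "w \<notin> C" if "w \<in> nbrs_in E V v" for w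
    using assms(2) nbrs_in_sym[OF assms(1) _ that] assms(3) by blast
  then show ?thesis by (auto simp: nbrs_in_def)
qed

lemma extremal_closed:
  assumes E: "sym E" and C: "\<forall>u\<in>C. nbrs_in E V u \<subseteq> C"
    and ex: "extremal E (V - C) d"
    and exC: "\<And>c. c \<in> C \<Longrightarrow> d c = 2 \<and> (in_edge_component E V c \<or> in_hexagon_component E V c)"
  shows "extremal E V d"
  unfolding extremal_def
proof
  fix v assume v: "v \<in> V"
  note N = nbrs_in_closed_diff[OF E C]
  show "d v = 2 \<and> (in_edge_component E V v \<or> in_hexagon_component E V v)"
  proof (cases "v \<in> C")
    case False
    then have vC: "v \<in> V - C" using v by blast
    have mem: "w \<in> V - C" if "w \<in> nbrs_in E (V - C) u" for w u using that by (simp add: nbrs_in_def)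
    have "d v = 2" using ex vC by (simp add: extremal_def)
    moreover have "in_edge_component E V v" if e: "in_edge_component E (V - C) v"
    proof -
      obtain w where w: "nbrs_in E (V - C) v = {w}" "nbrs_in E (V - C) w = {v}"
        using e unfolding in_edge_component_def by blast
      have "w \<in> V - C" using mem[of w v] w by simp
      then show ?thesis using w N vC unfolding in_edge_component_def by metis
    qed
    moreover have "in_hexagon_component E V v" if e: "in_hexagon_component E (V - C) v"
    proof -
      obtain c1 c2 c3 c4 c5 where c: "distinct [v, c1, c2, c3, c4, c5]"
        "nbrs_in E (V - C) v = {c5, c1}" "nbrs_in E (V - C) c1 = {v, c2}" "nbrs_in E (V - C) c2 = {c1, c3}"
        "nbrs_in E (V - C) c3 = {c2, c4}" "nbrs_in E (V - C) c4 = {c3, c5}" "nbrs_in E (V - C) c5 = {c4, v}"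
        using e unfolding in_hexagon_component_def by blast
      have "c1 \<in> V - C" "c5 \<in> V - C" "c2 \<in> V - C" "c3 \<in> V - C" "c4 \<in> V - C"
        using mem[of c1 v] mem[of c5 v] mem[of c2 c1] mem[of c3 c2] mem[of c4 c3] c by simp_all
      then show ?thesis using c N[OF vC] N[of c1] N[of c2] N[of c3] N[of c4] N[of c5]
        unfolding in_hexagon_component_def by metis
    qed
    ultimately show ?thesis using ex vC unfolding extremal_def by blast
  qed (use exC in blast)
qed

text \<open>Removing a union \<open>C\<close> of components; the \<open>2\<close> accounts for at least one component.\<close>

lemma bounded_remove_closed:
  assumes ad: "admissible E V d" and C: "C \<subseteq> V" "C \<noteq> {}"
    and closed: "\<forall>u\<in>C. nbrs_in E V u \<subseteq> C"
    and R: "finite R"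
    and kill: "\<And>x v. x \<in> eigenfunctions E V d \<Longrightarrow> (\<And>r. r \<in> R \<Longrightarrow> x r = 0) \<Longrightarrow> v \<in> C \<Longrightarrow> x v = 0"
    and rest: "bounded E (V - C) d"
    and count: "4 * int (card R) < (\<Sum>v\<in>C. 2 * int (d v) - 3) + 2 \<or>
      4 * int (card R) = (\<Sum>v\<in>C. 2 * int (d v) - 3) + 2 \<and>
      (\<forall>c\<in>C. d c = 2 \<and> (in_edge_component E V c \<or> in_hexagon_component E V c))"
  shows "bounded E V d"
proof -
  have fin: "finite V" and E: "sym E" using ad by (auto simp: admissible_def)
  from rest obtain k where k: "dim_at_most (eigenfunctions E (V - C) d) k"
    "4 * int k \<le> nullity_bound E (V - C) d" "4 * int k = nullity_bound E (V - C) d \<longrightarrow> extremal E (V - C) d"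
    by (elim boundedE)
  have dim: "dim_at_most (eigenfunctions E V d) (k + card R)"
    by (rule dim_at_most_kill[OF fin Diff_subset R k(1)]) (use kill in blast)
  have nb: "nullity_bound E V d \<ge> nullity_bound E (V - C) d + (\<Sum>v\<in>C. 2 * int (d v) - 3) + 2"
    using nullity_bound_split[OF fin C(1), of E d] num_components_closed[OF fin E C(1,2) closed] by linarith
  show ?thesis
  proof (cases "4 * int (k + card R) < nullity_bound E V d")
    case True
    then show ?thesis using dim bounded_strictI by blast
  next
    case False
    then have "4 * int k = nullity_bound E (V - C) d" "4 * int (k + card R) = nullity_bound E V d"
      "\<not> 4 * int (card R) < (\<Sum>v\<in>C. 2 * int (d v) - 3) + 2"
      using nb k(2) count by auto
    then have "extremal E V d" using extremal_closed[OF E closed] k(3) count by blast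
    then show ?thesis unfolding bounded_def using dim \<open>4 * int (k + card R) = nullity_bound E V d\<close> by blast
  qed
qed

lemma bounded_remove_isolated:
  assumes ad: "admissible E V d" and v: "v \<in> V" "nbrs_in E V v = {}" and rest: "bounded E (V - {v}) d"
  shows "bounded E V d"
proof (rule bounded_remove_closed[OF ad, where C = "{v}" and R = "{}"])
  have "2 \<le> d v" using ad v(1) by (simp add: admissible_def)
  then show "x u = 0" if "x \<in> eigenfunctions E V d" "u \<in> {v}" for x u
    using eigenfunction_eq[OF that(1) v(1)] v(2) that(2) by simp
  show "4 * int (card {}) < (\<Sum>v\<in>{v}. 2 * int (d v) - 3) + 2 \<or>
    4 * int (card {}) = (\<Sum>v\<in>{v}. 2 * int (d v) - 3) + 2 \<and>
    (\<forall>c\<in>{v}. d c = 2 \<and> (in_edge_component E V c \<or> in_hexagon_component E V c))"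
    using \<open>2 \<le> d v\<close> by simp
qed (use v rest in auto)

lemma bounded_remove_edge_component:
  assumes ad: "admissible E V d" and v: "nbrs_in E V v = {w}" "nbrs_in E V w = {v}"
    and rest: "bounded E (V - {v, w}) d"
  shows "bounded E V d"
proof (rule bounded_remove_closed[OF ad, where C = "{v, w}" and R = "{v}"])
  have vV: "v \<in> V" "w \<in> V" using v by (auto simp: nbrs_in_def)
  have ne: "v \<noteq> w" using v(1) ad by (auto simp: admissible_def irrefl_def nbrs_in_def)
  have d: "2 \<le> d v" "2 \<le> d w" using ad vV by (auto simp: admissible_def)
  show "x u = 0" if "x \<in> eigenfunctions E V d" "\<And>r. r \<in> {v} \<Longrightarrow> x r = 0" "u \<in> {v, w}" for x u
    using eigenfunction_eq1[OF that(1) vV(1) v(1)] that(2,3) by auto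
  show "4 * int (card {v}) < (\<Sum>v\<in>{v,w}. 2 * int (d v) - 3) + 2 \<or>
    4 * int (card {v}) = (\<Sum>v\<in>{v,w}. 2 * int (d v) - 3) + 2 \<and>
    (\<forall>c\<in>{v,w}. d c = 2 \<and> (in_edge_component E V c \<or> in_hexagon_component E V c))"
  proof (cases "d v = 2 \<and> d w = 2")
    case True
    then show ?thesis using ne v unfolding in_edge_component_def by auto
  next
    case False
    then show ?thesis using ne d by auto
  qed
qed (use v rest in \<open>auto simp: nbrs_in_def\<close>)

text \<open>The end of a branch of a forest: the neighbours of \<open>z\<close> include the leaves \<open>A\<close> and the inner
vertices \<open>B\<close> of pendant paths \<open>z, b, l b\<close> with two vertices.\<close>

definition hub :: "('a \<times> 'a) set \<Rightarrow> 'a set \<Rightarrow> 'a \<Rightarrow> 'a set \<Rightarrow> 'a set \<Rightarrow> ('a \<Rightarrow> 'a) \<Rightarrow> bool" where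
  "hub E V z A B l \<longleftrightarrow> z \<in> V \<and> A \<subseteq> nbrs_in E V z \<and> B \<subseteq> nbrs_in E V z \<and> (\<forall>a\<in>A. nbrs_in E V a = {z}) \<and>
     (\<forall>b\<in>B. l b \<in> V \<and> l b \<noteq> z \<and> nbrs_in E V b = {z, l b} \<and> nbrs_in E V (l b) = {b})"

lemma hub_disjoint:
  assumes E: "sym E" and ir: "irrefl E" and h: "hub E V z A B l"
  shows "z \<notin> A" "z \<notin> B" "z \<notin> l ` B" "A \<inter> B = {}" "A \<inter> l ` B = {}" "B \<inter> l ` B = {}" "inj_on l B"
    and "l ` B \<inter> nbrs_in E V z = {}" "A \<subseteq> V" "B \<subseteq> V" "l ` B \<subseteq> V"
proof -
  have nz: "z \<notin> nbrs_in E V z" using ir by (auto simp: nbrs_in_def irrefl_def)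
  have A: "nbrs_in E V a = {z}" "a \<in> nbrs_in E V z" if "a \<in> A" for a using h that by (auto simp: hub_def)
  have B: "l b \<in> V" "l b \<noteq> z" "nbrs_in E V b = {z, l b}" "nbrs_in E V (l b) = {b}" "b \<in> nbrs_in E V z"
    if "b \<in> B" for b using h that by (auto simp: hub_def)
  show "z \<notin> A" "z \<notin> B" using nz A(2) B(5) by blast+
  show "z \<notin> l ` B" using B(2) by blast
  show "A \<inter> B = {}" using A(1) B(2,3) by blast
  show "A \<inter> l ` B = {}"
  proof -
    have False if "b \<in> B" "l b \<in> A" for b
      using A(1)[OF that(2)] B(4)[OF that(1)] \<open>z \<notin> B\<close> that(1) by auto
    then show ?thesis by blast
  qed
  show "B \<inter> l ` B = {}"
  proof -
    have False if "b \<in> B" "l b \<in> B" for b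
      using B(3)[OF that(2)] B(4)[OF that(1)] \<open>z \<notin> B\<close> that(1) by auto
    then show ?thesis by blast
  qed
  show "inj_on l B"
  proof (rule inj_onI)
    fix b c assume bc: "b \<in> B" "c \<in> B" "l b = l c"
    have "{b} = nbrs_in E V (l c)" using B(4)[OF bc(1)] unfolding bc(3) by (rule sym)
    then have "{b} = {c}" unfolding B(4)[OF bc(2)] .
    then show "b = c" by simp
  qed
  have zV: "z \<in> V" using h by (simp add: hub_def)
  show "l ` B \<inter> nbrs_in E V z = {}"
  proof -
    have False if b: "b \<in> B" and "l b \<in> nbrs_in E V z" for b
      using nbrs_in_sym[OF E zV that(2)] B(4)[OF b] \<open>z \<notin> B\<close> b by auto
    then show ?thesis by blast
  qed
  show "A \<subseteq> V" "B \<subseteq> V" "l ` B \<subseteq> V" using A(2) B(1,5) by (auto simp: nbrs_in_def)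
qed

text \<open>Deleting \<open>z\<close> creates at most \<open>d z - 1\<close> components, and the deletion of each leaf and each pendant
path then removes one. Besides, the weights contribute \<open>1\<close> for each leaf and \<open>2\<close> for each path,
which gives \<open>3\<close> and \<open>4\<close> in total.\<close>

lemma hub_nullity_bound:
  assumes ad: "admissible E V d" and h: "hub E V z A B l"
  shows "nullity_bound E (V - ({z} \<union> A \<union> B \<union> l ` B)) d \<le>
    nullity_bound E V d + 1 - 3 * int (card A) - 4 * int (card B)"
proof -
  have fin: "finite V" and E: "sym E" "irrefl E" using ad by (auto simp: admissible_def)
  have d: "2 \<le> d v" "card (nbrs_in E V v) \<le> d v" if "v \<in> V" for v using ad that by (auto simp: admissible_def)
  have zV: "z \<in> V" using h by (simp add: hub_def)
  note D = hub_disjoint[OF E h]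
  have fA: "finite A" and fB: "finite B" and fL: "finite (l ` B)" using D(9-11) fin finite_subset by blast+
  \<comment> \<open>when \<open>z\<close> is gone, the leaves in \<open>A\<close> are isolated; deleting \<open>B\<close> then isolates the ends \<open>l b\<close>\<close>
  let ?V1 = "V - {z}" let ?V2 = "?V1 - A" let ?V3 = "?V2 - B" let ?V4 = "?V3 - l ` B"
  have V4: "V - ({z} \<union> A \<union> B \<union> l ` B) = ?V4" by auto
  have 1: "num_components E ?V1 + 1 \<le> num_components E V + d z"
    using num_components_remove[OF fin E(1) zV] d(2)[OF zV] by linarith
  have "nbrs_in E ?V1 a = {}" if "a \<in> A" for a using h that by (auto simp: hub_def nbrs_in_def)
  then have "(\<Sum>a\<in>A. card (nbrs_in E ?V1 a)) = 0" by simp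
  then have 2: "num_components E ?V2 + card A \<le> num_components E ?V1"
    using num_components_remove_set[of ?V1 E A] fin E(1) D(1,9) by (simp add: subset_Diff_insert)
  have "card (nbrs_in E ?V2 b) \<le> 1" if "b \<in> B" for b
  proof -
    have "nbrs_in E ?V2 b \<subseteq> {l b}" using h that by (auto simp: hub_def nbrs_in_def)
    then show ?thesis using card_mono[of "{l b}"] by force
  qed
  then have "(\<Sum>b\<in>B. card (nbrs_in E ?V2 b)) \<le> card B"
    using sum_bounded_above[of B "\<lambda>b. card (nbrs_in E ?V2 b)" 1] by simp
  moreover have "num_components E ?V3 + card B \<le> num_components E ?V2 + (\<Sum>b\<in>B. card (nbrs_in E ?V2 b))"
    by (rule num_components_remove_set) (use fin E(1) D in auto)
  ultimately have 3: "num_components E ?V3 \<le> num_components E ?V2" by linarith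
  have "nbrs_in E ?V3 c = {}" if c: "c \<in> l ` B" for c
  proof -
    obtain b where "b \<in> B" "c = l b" using c by blast
    then have "nbrs_in E V c = {b}" using h by (simp add: hub_def)
    moreover have "nbrs_in E ?V3 c = nbrs_in E V c - ({z} \<union> A \<union> B)" by (auto simp: nbrs_in_def)
    ultimately show ?thesis using \<open>b \<in> B\<close> by simp
  qed
  then have "(\<Sum>a\<in>l ` B. card (nbrs_in E ?V3 a)) = 0" by simp
  moreover have "num_components E ?V4 + card (l ` B) \<le> num_components E ?V3 + (\<Sum>a\<in>l ` B. card (nbrs_in E ?V3 a))"
    by (rule num_components_remove_set) (use fin E(1) D in auto)
  ultimately have 4: "num_components E ?V4 + card B \<le> num_components E ?V3"
    using card_image[OF D(7)] by linarith
  let ?S = "{z} \<union> A \<union> B \<union> l ` B"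
  let ?f = "\<lambda>v. 2 * int (d v) - 3"
  have SV: "?S \<subseteq> V" using zV D by auto
  have ge: "int (card X) \<le> sum ?f X" if "X \<subseteq> V" for X
  proof -
    have "(\<Sum>v\<in>X. 1) \<le> sum ?f X" by (rule sum_mono) (use d(1) that in force)
    then show ?thesis by simp
  qed
  have "sum ?f ?S = sum ?f ({z} \<union> A \<union> B) + sum ?f (l ` B)"
    by (rule sum.union_disjoint) (use fA fB fL D in auto)
  also have "sum ?f ({z} \<union> A \<union> B) = sum ?f ({z} \<union> A) + sum ?f B"
    by (rule sum.union_disjoint) (use fA fB D in auto)
  also have "sum ?f ({z} \<union> A) = ?f z + sum ?f A"
    using fA D(1) by simp
  finally have "sum ?f ?S = ?f z + sum ?f A + sum ?f B + sum ?f (l ` B)" .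
  then have "sum ?f ?S \<ge> ?f z + int (card A) + 2 * int (card B)"
    using ge[OF D(9)] ge[OF D(10)] ge[OF D(11)] card_image[OF D(7)] by linarith
  then show ?thesis
    using nullity_bound_split[OF fin SV, of E d] 1 2 3 4 unfolding V4 by linarith
qed

text \<open>A function that vanishes at the end of a pendant path at \<open>z\<close>, or at a leaf at \<open>z\<close>, vanishes at
\<open>z\<close>, and then at all leaves at \<open>z\<close>, since their weights exceed \<open>1\<close>. So one probe per
pendant path is enough, and a single one at a leaf if there is no such path.\<close>

lemma bounded_remove_hub_leaf:
  assumes ad: "admissible E V d" and h: "hub E V z A B l" and many: "A \<noteq> {}" "B \<noteq> {} \<or> 2 \<le> card A"
    and rest: "bounded E (V - ({z} \<union> A \<union> B \<union> l ` B)) d"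
  shows "bounded E V d"
proof -
  have fin: "finite V" and E: "sym E" "irrefl E" using ad by (auto simp: admissible_def)
  have d: "2 \<le> d v" if "v \<in> V" for v using ad that by (auto simp: admissible_def)
  have zV: "z \<in> V" using h by (simp add: hub_def)
  note D = hub_disjoint[OF E h]
  obtain a0 where a0: "a0 \<in> A" using many by blast
  define R where "R = (if B = {} then {a0} else l ` B)"
  have fB: "finite B" using D(10) fin finite_subset by blast
  have fA: "finite A" using D(9) fin finite_subset by blast
  have R: "finite R" by (simp add: R_def fB)
  from rest obtain k where k: "dim_at_most (eigenfunctions E (V - ({z} \<union> A \<union> B \<union> l ` B)) d) k"
    "4 * int k \<le> nullity_bound E (V - ({z} \<union> A \<union> B \<union> l ` B)) d" by (elim boundedE)
  have kill: "x v = 0" if x: "x \<in> eigenfunctions E V d" and x0: "\<And>r. r \<in> R \<Longrightarrow> x r = 0"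
    and v: "v \<in> {z} \<union> A \<union> B \<union> l ` B" for x v
  proof -
    have b: "x (l b) = 0" "x b = 0" "x z = 0" if "b \<in> B" for b
    proof -
      have hb: "b \<in> V" "l b \<in> V" "l b \<noteq> z" "nbrs_in E V b = {z, l b}" "nbrs_in E V (l b) = {b}"
        using h that D(10) by (auto simp: hub_def)
      show "x (l b) = 0" by (rule x0) (use that in \<open>auto simp: R_def\<close>)
      then show "x b = 0" using eigenfunction_eq1[OF x hb(2,5)] by simp
      then show "x z = 0" using eigenfunction_eq2[OF x hb(1,4)] hb(3) \<open>x (l b) = 0\<close> by simp
    qed
    have a: "a \<in> V" "nbrs_in E V a = {z}" if "a \<in> A" for a using h that D(9) by (auto simp: hub_def)
    have z: "x z = 0"
    proof (cases "B = {}")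
      case True
      then have "x a0 = 0" using x0 by (simp add: R_def)
      then show ?thesis using eigenfunction_eq1[OF x a[OF a0]] by simp
    qed (use b in blast)
    have "x a = 0" if "a \<in> A" for a
    proof -
      have "2 \<le> d a" using d a that by blast
      then show ?thesis using eigenfunction_eq1[OF x a[OF that]] z by simp
    qed
    then show ?thesis using v z b by blast
  qed
  have "dim_at_most (eigenfunctions E V d) (k + card R)"
    by (rule dim_at_most_kill[OF fin _ R k(1)]) (use kill in blast)+
  moreover have "4 * int (k + card R) < nullity_bound E V d"
  proof -
    have "1 \<le> card A" using a0 fA by (simp add: card_gt_0_iff Suc_le_eq) blast
    moreover have "4 * int (card R) < 3 * int (card A) + 4 * int (card B) - 1"
      using many(2) card_image[OF D(7)] \<open>1 \<le> card A\<close> by (auto simp: R_def)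
    moreover have "4 * int (k + card R) = 4 * int k + 4 * int (card R)" by simp
    ultimately show ?thesis using hub_nullity_bound[OF ad h] k(2) by linarith
  qed
  ultimately show ?thesis by (rule bounded_strictI)
qed

text \<open>Without leaves the count of the previous lemma falls short by a constant, but one probe can be saved: the equation at
\<open>z\<close> determines the value on the last pendant path.\<close>

lemma bounded_remove_hub_legs:
  assumes ad: "admissible E V d" and h: "hub E V z {} B l" and many: "2 \<le> card B"
    and rest: "bounded E (V - ({z} \<union> {} \<union> B \<union> l ` B)) d"
  shows "bounded E V d"
proof -
  have fin: "finite V" and E: "sym E" "irrefl E" using ad by (auto simp: admissible_def)
  have zV: "z \<in> V" using h by (simp add: hub_def)
  note D = hub_disjoint[OF E h]
  define V' where "V' = V - ({z} \<union> {} \<union> B \<union> l ` B)"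
  have fB: "finite B" using D(10) fin finite_subset by blast
  obtain b0 where b0: "b0 \<in> B" using many by (metis card.empty ex_in_conv not_numeral_le_zero)
  define R where "R = l ` (B - {b0})"
  have cR: "card R + 1 = card B"
  proof -
    have "card R = card (B - {b0})" unfolding R_def
      by (rule card_image) (use D(7) in \<open>auto simp: inj_on_def\<close>)
    then show ?thesis using b0 fB many by simp
  qed
  have R: "finite R" by (simp add: R_def fB)
  from rest obtain k where k: "dim_at_most (eigenfunctions E V' d) k" "4 * int k \<le> nullity_bound E V' d"
    unfolding V'_def by (elim boundedE)
  have hb: "b \<in> V" "l b \<in> V" "l b \<noteq> z" "nbrs_in E V b = {z, l b}" "nbrs_in E V (l b) = {b}" if "b \<in> B" for b
    using h that D(10) by (auto simp: hub_def)
  have leg: "x (l b) = 0" "x b = 0" "x z = 0"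
    if x: "x \<in> eigenfunctions E V d" and x0: "\<And>r. r \<in> R \<Longrightarrow> x r = 0" and b: "b \<in> B" "b \<noteq> b0" for x b
  proof -
    show "x (l b) = 0" using x0 b by (auto simp: R_def)
    then show "x b = 0" using eigenfunction_eq1[OF x hb(2,5)[OF b(1)]] by simp
    then show "x z = 0" using eigenfunction_eq2[OF x hb(1,4)[OF b(1)]] hb(3)[OF b(1)] \<open>x (l b) = 0\<close> by simp
  qed
  obtain b1 where b1: "b1 \<in> B" "b1 \<noteq> b0"
  proof -
    have "R \<noteq> {}" using many cR by auto
    then have "B - {b0} \<noteq> {}" unfolding R_def by blast
    then show ?thesis using that by blast
  qed
  have "dim_at_most (eigenfunctions E V d) (k + card R)"
  proof (rule dim_at_most_probe[OF fin _ R k(1)])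
    show "V' \<subseteq> V" by (auto simp: V'_def)
    fix x assume x: "x \<in> eigenfunctions E V d" and x0: "\<And>r. r \<in> R \<Longrightarrow> x r = 0"
    note leg = leg[OF x x0]
    have z: "x z = 0" using leg(3) b1 by blast
    show "x w = 0" if v: "v \<in> V'" and w: "w \<in> nbrs_in E V v" "w \<notin> V'" for v w
    proof -
      have vV: "v \<in> V" "v \<noteq> z" "v \<notin> B" "v \<notin> l ` B" using v by (auto simp: V'_def)
      have vw: "v \<in> nbrs_in E V w" using nbrs_in_sym[OF E(1) vV(1) w(1)] .
      have "w \<notin> B"
      proof
        assume "w \<in> B"
        then show False using vw hb(4)[of w] vV by auto
      qed
      moreover have "w \<notin> l ` B"
      proof
        assume "w \<in> l ` B"
        then obtain b where "b \<in> B" "w = l b" by blast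
        then show False using vw hb(5)[of b] vV by auto
      qed
      ultimately have "w = z" using w by (auto simp: V'_def nbrs_in_def)
      then show ?thesis using z by simp
    qed
    show "x v = 0" if x': "\<And>u. u \<in> V' \<Longrightarrow> x u = 0" and v: "v \<in> V" "v \<notin> V'" for v
    proof -
      have "x b0 = (\<Sum>w\<in>nbrs_in E V z. x w)"
      proof (subst sum.remove[of _ b0])
        show "finite (nbrs_in E V z)" using finite_nbrs_in[OF fin] .
        show "b0 \<in> nbrs_in E V z" using h b0 by (auto simp: hub_def)
        have "x w = 0" if "w \<in> nbrs_in E V z - {b0}" for w
        proof -
          have "w \<in> V" "w \<noteq> z" "w \<notin> l ` B" using that E(2) D(8) by (auto simp: nbrs_in_def irrefl_def)
          then show ?thesis using x'[of w] leg(2)[of w] that by (auto simp: V'_def)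
        qed
        then show "x b0 = x b0 + (\<Sum>w\<in>nbrs_in E V z - {b0}. x w)" by simp
      qed
      then have 0: "x b0 = 0" using eigenfunction_eq[OF x zV] z by simp
      then have "x (l b0) = 0" using eigenfunction_eq2[OF x hb(1,4)[OF b0]] hb(3)[OF b0] z by simp
      moreover have "v \<in> {z} \<union> B \<union> l ` B" using v by (auto simp: V'_def)
      ultimately show ?thesis using 0 z leg by blast
    qed
  qed
  moreover have "4 * int (k + card R) < nullity_bound E V d"
    using hub_nullity_bound[OF ad h] k(2) cR by (simp add: V'_def)
  ultimately show ?thesis by (rule bounded_strictI)
qed

text \<open>If the three weights are \<open>2\<close>, the values along \<open>l, w, z\<close> are \<open>- x y, - x y, 0\<close>, so the
equation at \<open>y\<close> does not notice that the path is deleted, and no probe is needed. Otherwise a probe at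
\<open>l\<close> is paid for by the larger weights.\<close>

lemma bounded_remove_pendant_path:
  fixes E :: "('a \<times> 'a) set"
  assumes ad: "admissible E V d" and l: "nbrs_in E V l = {w}" and w: "nbrs_in E V w = {l, z}"
    and z: "nbrs_in E V z = {w, y}" and ne: "l \<noteq> z" "w \<noteq> y"
    and rest: "bounded E (V - {l, w, z}) d"
  shows "bounded E V d"
proof -
  have fin: "finite V" and E: "sym E" "irrefl E" using ad by (auto simp: admissible_def)
  have V: "l \<in> V" "w \<in> V" "z \<in> V" "y \<in> V" using l w z by (auto simp: nbrs_in_def)
  have d: "2 \<le> d l" "2 \<le> d w" "2 \<le> d z" using ad V by (auto simp: admissible_def)
  have irr: "v \<notin> nbrs_in E V v" for v using E(2) by (auto simp: nbrs_in_def irrefl_def)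
  have ne': "l \<noteq> w" "w \<noteq> z" "z \<noteq> y" using irr[of l] irr[of w] irr[of z] l w z by auto
  have ly: "l \<noteq> y" using nbrs_in_sym[OF E(1) V(3), of y] z l ne' by auto
  define V' where "V' = V - {l, w, z}"
  have V'eq: "V' = V - {l} - {w} - {z}" by (auto simp: V'_def)
  have "num_components E (V - {l}) + 1 \<le> num_components E V + 1"
    using num_components_remove[OF fin E(1) V(1)] l by simp
  moreover have "num_components E (V - {l} - {w}) + 1 \<le> num_components E (V - {l}) + card (nbrs_in E (V - {l}) w)"
    by (rule num_components_remove) (use fin E V ne' in auto)
  moreover have "nbrs_in E (V - {l}) w = {z}" using w ne by (auto simp: nbrs_in_def)
  moreover have "num_components E V' + 1 \<le> num_components E (V - {l} - {w}) + card (nbrs_in E (V - {l} - {w}) z)"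
    unfolding V'eq by (rule num_components_remove) (use fin E V ne' ne in auto)
  moreover have "nbrs_in E (V - {l} - {w}) z = {y}" using z ne ly by (auto simp: nbrs_in_def)
  ultimately have nc: "num_components E V' \<le> num_components E V" by simp
  have nb: "nullity_bound E V' d + (2 * int (d l) - 3) + (2 * int (d w) - 3) + (2 * int (d z) - 3) \<le> nullity_bound E V d"
    using nullity_bound_split[OF fin, of "{l, w, z}" E d] V nc ne ne' by (simp add: V'_def)
  from rest obtain k where k: "dim_at_most (eigenfunctions E V' d) k" "4 * int k \<le> nullity_bound E V' d"
    unfolding V'_def by (elim boundedE)
  have outer: "u = z" if "v \<in> V'" "u \<in> nbrs_in E V v" "u \<notin> V'" for u v
  proof -
    have "v \<in> nbrs_in E V u" using nbrs_in_sym[OF E(1) _ that(2)] that by (auto simp: V'_def)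
    then show ?thesis using that l w by (auto simp: V'_def nbrs_in_def)
  qed
  show ?thesis
  proof (cases "d l = 2 \<and> d w = 2 \<and> d z = 2")
    case True
    have vals: "x l = - x y" "x w = - x y" "x z = 0" if x: "x \<in> eigenfunctions E V d" for x
      using eigenfunction_eq1[OF x V(1) l] eigenfunction_eq2[OF x V(2) w ne(1)]
        eigenfunction_eq2[OF x V(3) z ne(2)] True by simp_all
    have "dim_at_most (eigenfunctions E V d) (k + card ({} :: 'a set))"
    proof (rule dim_at_most_probe[OF fin _ _ k(1)])
      show "x u = 0" if "x \<in> eigenfunctions E V d" "v \<in> V'" "u \<in> nbrs_in E V v" "u \<notin> V'" for x u v
        using outer[OF that(2-)] vals(3)[OF that(1)] by simp
      show "x v = 0" if x: "x \<in> eigenfunctions E V d" and "\<And>u. u \<in> V' \<Longrightarrow> x u = 0" "v \<in> V" "v \<notin> V'" for x v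
      proof -
        have "x y = 0" using that(2)[of y] V(4) ly ne ne' by (auto simp: V'_def)
        then show ?thesis using vals[OF x] that(3,4) by (auto simp: V'_def)
      qed
    qed (auto simp: V'_def)
    moreover have "4 * int (k + card ({} :: 'a set)) < nullity_bound E V d" using nb k(2) True by simp
    ultimately show ?thesis by (rule bounded_strictI)
  next
    case False
    have "dim_at_most (eigenfunctions E V d) (k + card {l})"
    proof (rule dim_at_most_kill[OF fin _ _ k(1)])
      show "x v = 0" if x: "x \<in> eigenfunctions E V d" and "\<And>r. r \<in> {l} \<Longrightarrow> x r = 0" "v \<in> V" "v \<notin> V'" for x v
      proof -
        have "x l = 0" using that(2) by simp
        moreover from this have "x w = 0" using eigenfunction_eq1[OF x V(1) l] by simp
        moreover from calculation have "x z = 0" using eigenfunction_eq2[OF x V(2) w ne(1)] by simp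
        ultimately show ?thesis using that(3,4) by (auto simp: V'_def)
      qed
    qed (auto simp: V'_def)
    moreover have "4 * int (k + card {l}) < nullity_bound E V d" using nb k(2) False d by auto
    ultimately show ?thesis by (rule bounded_strictI)
  qed
qed

section \<open>Nullity of weighted graphs: forests, edges on cycles and the bound\<close>

text \<open>Delete the set \<open>L\<close> of leaves and the set \<open>M\<close> of vertices of degree \<open>2\<close> next to a leaf.
A vertex \<open>z\<close> with at most one neighbour in the rest is a hub, or the third vertex of a pendant path. If nothing
is left, then two adjacent vertices of \<open>M\<close> are found instead.\<close>

lemma bounded_forest:
  assumes ad: "admissible E V d" and ne: "V \<noteq> {}" and forest: "\<And>x y. \<not> nonbridge E V x y"
    and IH: "\<And>V'. V' \<subset> V \<Longrightarrow> bounded E V' d"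
  shows "bounded E V d"
proof -
  have fin: "finite V" and E: "sym E" "irrefl E" using ad by (auto simp: admissible_def)
  have irr: "v \<notin> nbrs_in E V v" for v using E(2) by (auto simp: nbrs_in_def irrefl_def)
  have NV: "w \<in> V" if "w \<in> nbrs_in E V v" for v w using that by (simp add: nbrs_in_def)
  have finN: "finite (nbrs_in E V v)" for v using finite_nbrs_in[OF fin] .
  note sy = nbrs_in_sym[OF E(1)]
  define leaves where "leaves = (\<lambda>z. {a \<in> V. nbrs_in E V a = {z}})"
  have leaves_sub: "leaves z \<subseteq> nbrs_in E V z" for z using sy by (auto simp: leaves_def)
  show ?thesis
  proof (cases "\<exists>v\<in>V. nbrs_in E V v = {}")
    case True
    then obtain v where "v \<in> V" "nbrs_in E V v = {}" by blast
    then show ?thesis by (intro bounded_remove_isolated[OF ad] IH) auto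
  next
    case no_isolated: False
    show ?thesis
    proof (cases "\<exists>v w. nbrs_in E V v = {w} \<and> nbrs_in E V w = {v}")
      case True
      then obtain v w where vw: "nbrs_in E V v = {w}" "nbrs_in E V w = {v}" by blast
      show ?thesis by (rule bounded_remove_edge_component[OF ad vw], rule IH) (use NV[of w v] vw in auto)
    next
      case no_edge: False
      show ?thesis
      proof (cases "\<exists>z\<in>V. 2 \<le> card (leaves z)")
        case True
        then obtain z where z: "z \<in> V" "2 \<le> card (leaves z)" by blast
        have "hub E V z (leaves z) {} id" using z leaves_sub by (auto simp: hub_def leaves_def)
        then show ?thesis
        proof (rule bounded_remove_hub_leaf[OF ad])
          show "leaves z \<noteq> {}" using z by auto
          show "bounded E (V - ({z} \<union> leaves z \<union> {} \<union> id ` {})) d" by (rule IH) (use z in auto)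
        qed (use z in simp)
      next
        case few: False
        \<comment> \<open>from here on no component is a vertex or an edge, and no vertex has two leaves\<close>
        define L where "L = {v \<in> V. card (nbrs_in E V v) = 1}"
        define M where "M = {w \<in> V. card (nbrs_in E V w) = 2 \<and> leaves w \<noteq> {}}"
        have Lleaf: "\<exists>z. nbrs_in E V v = {z}" if "v \<in> L" for v
          using that by (auto simp: L_def card_1_singleton_iff)
        have leavesL: "leaves z \<subseteq> L" for z by (auto simp: L_def leaves_def)
        have one_leaf: "card (leaves z) \<le> 1" if "z \<in> V" for z using few that by force
        have leg: "\<exists>l. l \<in> V \<and> l \<noteq> z \<and> nbrs_in E V w = {z, l} \<and> nbrs_in E V l = {w}"
          if w: "w \<in> M" "z \<in> nbrs_in E V w" "z \<notin> L" for w z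
        proof -
          obtain l where l: "l \<in> leaves w" using w by (auto simp: M_def)
          have lz: "l \<noteq> z" using l leavesL w by blast
          have "{z, l} \<subseteq> nbrs_in E V w" using l leaves_sub w by blast
          moreover have "card {z, l} = card (nbrs_in E V w)" using w lz by (simp add: M_def)
          ultimately have "nbrs_in E V w = {z, l}" using card_subset_eq[OF finN] by metis
          then show ?thesis using l lz by (auto simp: leaves_def)
        qed
        show ?thesis
        proof (cases "V - L - M = {}")
          case True
          \<comment> \<open>a component is then a path with four vertices, whose inner vertices \<open>w\<close> and \<open>z\<close> are in \<open>M\<close>\<close>
          have "\<exists>w. w \<in> M"
          proof -
            obtain v where v: "v \<in> V" using ne by blast
            show ?thesis
            proof (cases "v \<in> L")
              case True
              then obtain u where u: "nbrs_in E V v = {u}" using Lleaf by blast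
              have uV: "u \<in> V" using NV[of u v] u by simp
              have "u \<notin> L"
              proof
                assume "u \<in> L"
                then obtain t where "nbrs_in E V u = {t}" using Lleaf by blast
                moreover have "v \<in> nbrs_in E V u" using sy[OF v] u by simp
                ultimately show False using no_edge u by auto
              qed
              then show ?thesis using True uV \<open>V - L - M = {}\<close> by blast
            qed (use True v in blast)
          qed
          then obtain w where w: "w \<in> M" by blast
          then have wV: "w \<in> V" by (simp add: M_def)
          obtain l where l: "l \<in> leaves w" using w by (auto simp: M_def)
          have "\<exists>z. z \<in> nbrs_in E V w \<and> z \<noteq> l"
          proof (rule ccontr)
            assume "\<not> ?thesis"
            then have "card (nbrs_in E V w) \<le> 1" using card_mono[of "{l}" "nbrs_in E V w"] by force
            then show False using w by (simp add: M_def)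
          qed
          then obtain z where z: "z \<in> nbrs_in E V w" "z \<noteq> l" by blast
          have zL: "z \<notin> L"
          proof
            assume "z \<in> L"
            then obtain t where "nbrs_in E V z = {t}" using Lleaf by blast
            moreover have "w \<in> nbrs_in E V z" using sy[OF wV z(1)] .
            ultimately have "z \<in> leaves w" using NV[OF z(1)] by (simp add: leaves_def)
            then have "card {l, z} \<le> card (leaves w)" using l
              by (intro card_mono finite_subset[OF leaves_sub finN]) auto
            then show False using one_leaf[OF wV] z(2) by simp
          qed
          then have zM: "z \<in> M" using True NV[OF z(1)] by blast
          obtain m where m: "m \<in> V" "m \<noteq> z" "nbrs_in E V w = {z, m}" "nbrs_in E V m = {w}"
            using leg[OF w z(1) zL] by blast
          have zV: "z \<in> V" using NV z by blast
          have "hub E V z (leaves z) {w} (\<lambda>_. m)" using m zV leaves_sub sy[OF wV z(1)]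
            by (auto simp: hub_def leaves_def)
          then show ?thesis
          proof (rule bounded_remove_hub_leaf[OF ad])
            show "leaves z \<noteq> {}" using zM by (simp add: M_def)
            show "bounded E (V - ({z} \<union> leaves z \<union> {w} \<union> (\<lambda>_. m) ` {w})) d" by (rule IH) (use zV in auto)
          qed simp
        next
          case False
          \<comment> \<open>all neighbours of \<open>z\<close> but at most one are leaves or belong to pendant paths\<close>
          obtain z where z: "z \<in> V - L - M" "card (nbrs_in E (V - L - M) z) \<le> 1"
            using forest_small_degree[OF fin E forest _ False] by blast
          have zV: "z \<in> V" using z by blast
          have deg2: "2 \<le> card (nbrs_in E V z)"
          proof -
            have "card (nbrs_in E V z) \<noteq> 0" using no_isolated zV finN by auto
            moreover have "card (nbrs_in E V z) \<noteq> 1" using z by (auto simp: L_def)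
            ultimately show ?thesis by linarith
          qed
          define B where "B = nbrs_in E V z \<inter> M"
          have "\<forall>b\<in>B. \<exists>l. l \<in> V \<and> l \<noteq> z \<and> nbrs_in E V b = {z, l} \<and> nbrs_in E V l = {b}"
            using leg sy[OF zV] z by (auto simp: B_def)
          from bchoice[OF this] obtain l where
            l: "\<And>b. b \<in> B \<Longrightarrow> l b \<in> V \<and> l b \<noteq> z \<and> nbrs_in E V b = {z, l b} \<and> nbrs_in E V (l b) = {b}" by blast
          have hub: "hub E V z (leaves z) B l" using l zV leaves_sub by (auto simp: hub_def leaves_def B_def)
          have smaller: "bounded E (V - ({z} \<union> X \<union> Y \<union> Z)) d" for X Y Z by (rule IH) (use zV in auto)
          have "nbrs_in E V z \<subseteq> leaves z \<union> B \<union> nbrs_in E (V - L - M) z"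
          proof
            fix u assume u: "u \<in> nbrs_in E V z"
            have "u \<in> leaves z" if uL: "u \<in> L"
            proof -
              obtain t where "nbrs_in E V u = {t}" using Lleaf[OF uL] by blast
              then show ?thesis using sy[OF zV u] NV[OF u] by (simp add: leaves_def)
            qed
            then show "u \<in> leaves z \<union> B \<union> nbrs_in E (V - L - M) z"
              using u by (auto simp: B_def nbrs_in_def)
          qed
          moreover have fB: "finite B" using finN by (simp add: B_def)
          moreover have fl: "finite (leaves z)" using finite_subset[OF leaves_sub finN] .
          ultimately have "card (nbrs_in E V z) \<le> card (leaves z \<union> B \<union> nbrs_in E (V - L - M) z)"
            by (intro card_mono) (use fin in \<open>auto simp: nbrs_in_def\<close>)
          also have "\<dots> \<le> card (leaves z) + card B + card (nbrs_in E (V - L - M) z)"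
            by (meson add_le_mono1 card_Un_le le_trans)
          finally have cN: "card (nbrs_in E V z) \<le> card (leaves z) + card B + 1" using z(2) by linarith
          show ?thesis
          proof (cases "leaves z = {}")
            case False
            \<comment> \<open>otherwise \<open>z\<close>, with a single leaf and one further neighbour, would be in \<open>M\<close>\<close>
            have "B \<noteq> {}"
            proof
              assume "B = {}"
              then have "card (nbrs_in E V z) = 2" using cN deg2 one_leaf[OF zV] by simp
              then show False using z False by (auto simp: M_def)
            qed
            then show ?thesis using bounded_remove_hub_leaf[OF ad hub False _ smaller] by blast
          next
            case True
            show ?thesis
            proof (cases "2 \<le> card B")
              case two: True
              have h: "hub E V z {} B l" using hub True by simp
              show ?thesis by (rule bounded_remove_hub_legs[OF ad h two smaller])
            next
              case False
              then have "card B = 1" and c2: "card (nbrs_in E V z) = 2" using cN deg2 True by simp_all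
              then obtain b where b: "B = {b}" by (auto simp: card_1_singleton_iff)
              then have bN: "b \<in> nbrs_in E V z" by (auto simp: B_def)
              have "\<exists>y. y \<noteq> b \<and> nbrs_in E V z = {b, y}"
                using c2 bN by (auto simp: card_2_iff)
              then obtain y where y: "y \<noteq> b" "nbrs_in E V z = {b, y}" by blast
              have lb: "nbrs_in E V b = {l b, z}" "nbrs_in E V (l b) = {b}" "l b \<noteq> z" using l[of b] b by auto
              have "V - {l b, b, z} \<subset> V" using zV by auto
              from bounded_remove_pendant_path[OF ad lb(2,1) y(2) lb(3) y(1)[symmetric] IH[OF this]]
              show ?thesis .
            qed
          qed
        qed
      qed
    qed
  qed
qed

text \<open>On the functions with \<open>x a = x b\<close> the edge can be removed together with one unit of weight at each end, which
lowers the bound by exactly \<open>4\<close>. If the smaller graph is extremal, then \<open>a\<close> and \<open>b\<close>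
lie on a common hexagon. But a hexagon with a chord has nullity at most \<open>2\<close>, whereas its bound allows
\<open>3\<close>.\<close>

lemma bounded_delete_edge:
  assumes ad: "admissible E V d" and nb: "nonbridge E V a b" and d3: "3 \<le> d a" "3 \<le> d b"
    and rest: "bounded (E - {(a, b), (b, a)}) V (d(a := d a - 1, b := d b - 1))"
    and IH: "\<And>V'. V' \<subset> V \<Longrightarrow> bounded E V' d"
  shows "bounded E V d"
proof -
  define F where "F = E - {(a, b), (b, a)}"
  define d' where "d' = d(a := d a - 1, b := d b - 1)"
  have fin: "finite V" and E: "sym E" "irrefl E" using ad by (auto simp: admissible_def)
  have ab: "(a, b) \<in> E" "a \<in> V" "b \<in> V" "b \<in> component F V a" using nb by (auto simp: nonbridge_def F_def)
  have ba: "(b, a) \<in> E" using ab E by (auto dest: symD)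
  have ne: "a \<noteq> b" using ab E by (auto simp: irrefl_def)
  have Na: "nbrs_in E V a = insert b (nbrs_in F V a)" "b \<notin> nbrs_in F V a"
    and Nb: "nbrs_in E V b = insert a (nbrs_in F V b)" "a \<notin> nbrs_in F V b"
    using ab ba by (auto simp: nbrs_in_def F_def)
  have No: "nbrs_in E V v = nbrs_in F V v" if "v \<noteq> a" "v \<noteq> b" for v
    using that by (auto simp: nbrs_in_def F_def)
  have finN: "finite (nbrs_in F V v)" for v using finite_nbrs_in[OF fin] .
  have eig: "x \<in> eigenfunctions F V d'" if x: "x \<in> eigenfunctions E V d" and eq: "x a = x b" for x
  proof -
    have "(real (d' v) - 1) * x v = (\<Sum>w\<in>nbrs_in F V v. x w)" if v: "v \<in> V" for v
    proof -
      consider "v = a" | "v = b" | "v \<noteq> a" "v \<noteq> b" by blast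
      then show ?thesis
      proof cases
        case 1
        have "(real (d a) - 1) * x a = x b + (\<Sum>w\<in>nbrs_in F V a. x w)"
          using eigenfunction_eq[OF x ab(2)] Na finN by simp
        moreover have "real (d a) = real (d' a) + 1" using d3 ne by (simp add: d'_def of_nat_diff)
        ultimately show ?thesis unfolding 1 using eq by (simp only:) (simp add: algebra_simps)
      next
        case 2
        have "(real (d b) - 1) * x b = x a + (\<Sum>w\<in>nbrs_in F V b. x w)"
          using eigenfunction_eq[OF x ab(3)] Nb finN by simp
        moreover have "real (d b) = real (d' b) + 1" using d3 by (simp add: d'_def of_nat_diff)
        ultimately show ?thesis unfolding 2 using eq by (simp only:) (simp add: algebra_simps)
      next
        case 3
        then show ?thesis using eigenfunction_eq[OF x v] No[OF 3] by (simp add: d'_def)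
      qed
    qed
    then show ?thesis using eigenfunction_outside[OF x] by (simp add: eigenfunctions_def)
  qed
  from rest obtain k where k: "dim_at_most (eigenfunctions F V d') k" "4 * int k \<le> nullity_bound F V d'"
    "4 * int k = nullity_bound F V d' \<longrightarrow> extremal F V d'" unfolding F_def d'_def by (elim boundedE)
  have "dim_at_most (eigenfunctions E V d) (Suc k)"
    by (rule dim_at_most_functional[OF linear_functional_diff[of a b]], rule dim_at_most_mono[OF k(1)])
      (use eig in auto)
  moreover have nbd: "nullity_bound E V d = nullity_bound F V d' + 4"
  proof -
    have "(\<Sum>v\<in>V. 2 * int (d v) - 3) - (\<Sum>v\<in>V. 2 * int (d' v) - 3) = (\<Sum>v\<in>V. 2 * int (d v) - 2 * int (d' v))"
      by (simp add: sum_subtractf)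
    also have "\<dots> = (\<Sum>v\<in>{a, b}. 2 * int (d v) - 2 * int (d' v))"
      by (rule sum.mono_neutral_right) (use fin ab in \<open>auto simp: d'_def\<close>)
    also have "\<dots> = 4" using ne d3 by (simp add: d'_def of_nat_diff)
    finally show ?thesis using nonbridge_num_components[OF E(1) nb] by (simp add: nullity_bound_def F_def)
  qed
  ultimately have strict: "bounded E V d" if "\<not> extremal F V d'"
    by (intro bounded_strictI) (use k that in auto)
  show ?thesis
  proof (cases "extremal F V d'")
    case True
    have "\<not> in_edge_component F V a"
    proof
      assume "in_edge_component F V a"
      then obtain w where w: "nbrs_in F V a = {w}" "nbrs_in F V w = {a}"
        unfolding in_edge_component_def by blast
      have "component F V a \<subseteq> {a, w}" by (rule component_least) (use w in auto)
      then show False using ab(4) ne Na(2) w by auto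
    qed
    then have "in_hexagon_component F V a" using True ab(2) by (auto simp: extremal_def)
    then obtain c1 c2 c3 c4 c5 where dist: "distinct [a, c1, c2, c3, c4, c5]" and
      N: "nbrs_in F V a = {c5, c1}" "nbrs_in F V c1 = {a, c2}" "nbrs_in F V c2 = {c1, c3}"
         "nbrs_in F V c3 = {c2, c4}" "nbrs_in F V c4 = {c3, c5}" "nbrs_in F V c5 = {c4, a}"
      unfolding in_hexagon_component_def by blast
    have dist': "c5 \<noteq> c1" "c4 \<noteq> a" using dist by auto
    define C where "C = {a, c1, c2, c3, c4, c5}"
    have "component F V a \<subseteq> C" by (rule component_least) (use N in \<open>auto simp: C_def\<close>)
    then have b: "b = c2 \<or> b = c3 \<or> b = c4" using ab(4) ne Na(2) N by (auto simp: C_def)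
    have CV: "C \<subseteq> V" using ab(2) N by (auto simp: C_def nbrs_in_def)
    have dv: "d v = (if v = a \<or> v = b then 3 else 2)" if "v \<in> C" for v
    proof -
      have "d' v = 2" using True CV that by (auto simp: extremal_def)
      then show ?thesis using d3 ne by (auto simp: d'_def split: if_splits)
    qed
    have dC: "d a = 3" "d b = 3" "\<And>v. v \<in> C \<Longrightarrow> v \<noteq> a \<Longrightarrow> v \<noteq> b \<Longrightarrow> d v = 2"
      using dv[of a] dv[of b] dv b by (auto simp: C_def)
    have closed: "\<forall>u\<in>C. nbrs_in E V u \<subseteq> C"
    proof
      fix u assume u: "u \<in> C"
      have "nbrs_in F V u \<subseteq> C" using u N by (auto simp: C_def)
      moreover have "a \<in> C" "b \<in> C" using b by (auto simp: C_def)
      ultimately show "nbrs_in E V u \<subseteq> C" using No[of u] Na Nb by (cases "u = a \<or> u = b") auto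
    qed
    have count: "(\<Sum>v\<in>C. 2 * int (d v) - 3) = 10"
    proof -
      have "(\<Sum>v\<in>C. 2 * int (d v) - 3) = (\<Sum>v\<in>C. if v = a \<or> v = b then 3 else 1)"
        by (rule sum.cong) (use dv in auto)
      then show ?thesis using dist b ne by (auto simp: C_def)
    qed
    have eqs: "2 * x a = x b + x c5 + x c1" "2 * x b = x a + (\<Sum>w\<in>nbrs_in F V b. x w)"
      "c1 \<noteq> b \<Longrightarrow> x c1 = x a + x c2" "c2 \<noteq> b \<Longrightarrow> x c2 = x c1 + x c3" "c3 \<noteq> b \<Longrightarrow> x c3 = x c2 + x c4"
      "c4 \<noteq> b \<Longrightarrow> x c4 = x c3 + x c5" "c5 \<noteq> b \<Longrightarrow> x c5 = x c4 + x a"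
      if x: "x \<in> eigenfunctions E V d" for x
    proof -
      show "2 * x a = x b + x c5 + x c1"
        using eigenfunction_eq[OF x ab(2)] Na N(1) dC dist' by simp
      show "2 * x b = x a + (\<Sum>w\<in>nbrs_in F V b. x w)"
        using eigenfunction_eq[OF x ab(3)] Nb finN[of b] dC by simp
      have V: "c1 \<in> V" "c2 \<in> V" "c3 \<in> V" "c4 \<in> V" "c5 \<in> V" using CV by (auto simp: C_def)
      have D: "d c = 2" "nbrs_in E V c = nbrs_in F V c" if "c \<in> {c1, c2, c3, c4, c5}" "c \<noteq> b" for c
        using dC(3)[of c] that No[of c] dist by (auto simp: C_def)
      show "c1 \<noteq> b \<Longrightarrow> x c1 = x a + x c2" using eigenfunction_eq[OF x V(1)] D[of c1] N dist dist' by simp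
      show "c2 \<noteq> b \<Longrightarrow> x c2 = x c1 + x c3" using eigenfunction_eq[OF x V(2)] D[of c2] N dist dist' by simp
      show "c3 \<noteq> b \<Longrightarrow> x c3 = x c2 + x c4" using eigenfunction_eq[OF x V(3)] D[of c3] N dist dist' by simp
      show "c4 \<noteq> b \<Longrightarrow> x c4 = x c3 + x c5" using eigenfunction_eq[OF x V(4)] D[of c4] N dist dist' by simp
      show "c5 \<noteq> b \<Longrightarrow> x c5 = x c4 + x a" using eigenfunction_eq[OF x V(5)] D[of c5] N dist dist' by simp
    qed
    have sub: "V - C \<subset> V" using ab(2) by (auto simp: C_def)
    have finish: "bounded E V d"
      if R: "finite R" "card R \<le> 2"
        "\<And>x v. x \<in> eigenfunctions E V d \<Longrightarrow> (\<And>r. r \<in> R \<Longrightarrow> x r = 0) \<Longrightarrow> v \<in> C \<Longrightarrow> x v = 0" for R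
    proof (rule bounded_remove_closed[OF ad CV _ closed R(1) _ IH[OF sub]])
      show "C \<noteq> {}" by (simp add: C_def)
      show "x v = 0" if "x \<in> eigenfunctions E V d" "\<And>r. r \<in> R \<Longrightarrow> x r = 0" "v \<in> C" for x v
        by (rule R(3)[OF that(1) _ that(3)]) (rule that(2))
    qed (use count R(2) in simp)
    \<comment> \<open>two adjacent zeros, chosen so that every further equation used has a single unknown\<close>
    consider "b = c2" | "b = c3" | "b = c4" using b by blast
    then show ?thesis
    proof cases
      case 1
      show ?thesis
      proof (rule finish[of "{c3, c4}"])
        fix x v assume x: "x \<in> eigenfunctions E V d" "\<And>r. r \<in> {c3, c4} \<Longrightarrow> x r = 0" and v: "v \<in> C"
        have "x c3 = 0" "x c4 = 0" using x(2) by simp_all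
        then have "x c3 = 0 \<and> x c4 = 0 \<and> x c5 = 0 \<and> x a = 0 \<and> x c2 = 0 \<and> x c1 = 0"
          using eqs[OF x(1)] 1 dist N(3) by auto
        then show "x v = 0" using v by (auto simp: C_def)
      qed (auto simp: card_insert_if)
    next
      case 2
      show ?thesis
      proof (rule finish[of "{a, c1}"])
        fix x v assume x: "x \<in> eigenfunctions E V d" "\<And>r. r \<in> {a, c1} \<Longrightarrow> x r = 0" and v: "v \<in> C"
        have "x a = 0" "x c1 = 0" using x(2) by simp_all
        then have "x a = 0 \<and> x c1 = 0 \<and> x c2 = 0 \<and> x c3 = 0 \<and> x c5 = 0 \<and> x c4 = 0"
          using eqs[OF x(1)] 2 dist by auto
        then show "x v = 0" using v by (auto simp: C_def)
      qed (auto simp: card_insert_if)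
    next
      case 3
      show ?thesis
      proof (rule finish[of "{c3, c2}"])
        fix x v assume x: "x \<in> eigenfunctions E V d" "\<And>r. r \<in> {c3, c2} \<Longrightarrow> x r = 0" and v: "v \<in> C"
        have "x c3 = 0" "x c2 = 0" using x(2) by simp_all
        then have "x c3 = 0 \<and> x c2 = 0 \<and> x c1 = 0 \<and> x a = 0 \<and> x c4 = 0 \<and> x c5 = 0"
          using eqs[OF x(1)] 3 dist N(5) by auto
        then show "x v = 0" using v by (auto simp: C_def)
      qed (auto simp: card_insert_if)
    qed
  qed (rule strict)
qed

lemma nonbridge_other_nbr:
  assumes fin: "finite V" and E: "sym E" "irrefl E" and nb: "nonbridge E V a b" and card: "card (nbrs_in E V a) \<le> 2"
  shows "\<exists>c. c \<noteq> b \<and> nbrs_in E V a = {b, c}"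
proof -
  let ?F = "E - {(a, b), (b, a)}"
  have ab: "(a, b) \<in> E" "b \<in> V" "b \<in> component ?F V a" using nb by (auto simp: nonbridge_def)
  have ne: "a \<noteq> b" using ab E by (auto simp: irrefl_def)
  have "\<exists>c. c \<in> nbrs_in ?F V a"
  proof (rule ccontr)
    assume "\<not> ?thesis"
    then have "component ?F V a \<subseteq> {a}" by (intro component_least) auto
    then show False using ab ne by auto
  qed
  then obtain c where c: "c \<in> nbrs_in ?F V a" by blast
  then have cb: "c \<noteq> b" "{b, c} \<subseteq> nbrs_in E V a" using ab by (auto simp: nbrs_in_def)
  have "{b, c} = nbrs_in E V a"
    by (rule card_seteq[OF finite_nbrs_in[OF fin] cb(2)]) (use card cb in simp)
  then show ?thesis using cb(1) by blast
qed

text \<open>Let \<open>w\<close> be the second neighbour of \<open>v\<close>. On the functions with \<open>x w = 0\<close> the equation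
at \<open>v\<close> reads \<open>x v = x b\<close>, so \<open>v\<close> and \<open>w\<close> can be deleted if the weight of
\<open>b\<close> drops by one. If the rest is extremal and \<open>b\<close> lies in an edge component, the equations already
force \<open>x w = 0\<close>, so the functional costs nothing; and \<open>b\<close> cannot lie on a hexagon, since the edge
to \<open>v\<close> would be the only way out of it.\<close>

lemma nonbridge_contract:
  assumes ad: "admissible E V d" and nb: "nonbridge E V b v" and d: "3 \<le> d b" "d v = 2"
    and rest: "\<And>V' d'. V' \<subset> V \<Longrightarrow> admissible E V' d' \<Longrightarrow> bounded E V' d'"
  shows "bounded E V d"
proof -
  have fin: "finite V" and E: "sym E" "irrefl E" using ad by (auto simp: admissible_def)
  define F where "F = E - {(b, v), (v, b)}"
  have bv: "(b, v) \<in> E" "b \<in> V" "v \<in> V" "v \<in> component F V b" using nb by (auto simp: nonbridge_def F_def)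
  have ne: "b \<noteq> v" using bv E by (auto simp: irrefl_def)
  have dg: "card (nbrs_in E V u) \<le> d u" "2 \<le> d u" if "u \<in> V" for u using ad that by (auto simp: admissible_def)
  obtain w where w: "w \<noteq> b" "nbrs_in E V v = {b, w}"
    using nonbridge_other_nbr[OF fin E nonbridge_sym[OF E(1) nb]] dg[OF bv(3)] d by auto
  have wV: "w \<in> V" using w by (auto simp: nbrs_in_def)
  have wv: "w \<noteq> v" using w E by (auto simp: nbrs_in_def irrefl_def)
  define V' where "V' = V - {v, w}"
  define d' where "d' = d(b := d b - 1)"
  have bV': "b \<in> V'" using bv ne w by (simp add: V'_def)
  have sub: "V' \<subset> V" using wV by (auto simp: V'_def)
  have finN: "finite (nbrs_in E U u)" if "U \<subseteq> V" for u U by (rule finite_nbrs_in[OF finite_subset[OF that fin]])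
  have vN: "v \<notin> nbrs_in E V u" if "u \<in> V" "u \<noteq> b" "u \<noteq> w" for u
  proof
    assume "v \<in> nbrs_in E V u"
    from nbrs_in_sym[OF E(1) that(1) this] show False using that(2,3) unfolding w(2) by blast
  qed
  have vNb: "v \<in> nbrs_in E V b" using bv by (simp add: nbrs_in_def)
  have N': "nbrs_in E V' u = nbrs_in E V u - {v, w}" for u by (auto simp: V'_def nbrs_in_def)
  have ad': "admissible E V' d'"
  proof -
    have "2 \<le> d' u \<and> card (nbrs_in E V' u) \<le> d' u" if u: "u \<in> V'" for u
    proof (cases "u = b")
      case True
      have "card (nbrs_in E V' b) \<le> card (nbrs_in E V b - {v})"
        by (rule card_mono) (use finN[of V b] in \<open>auto simp: N'\<close>)
      also have "\<dots> = card (nbrs_in E V b) - 1" using vNb by simp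
      finally have "card (nbrs_in E V' b) \<le> d b - 1" using dg(1)[OF bv(2)] by linarith
      then show ?thesis using d True by (simp add: d'_def)
    next
      case False
      have "card (nbrs_in E V' u) \<le> card (nbrs_in E V u)" by (rule card_nbrs_in_mono[OF fin]) (use sub in blast)
      moreover have "u \<in> V" using u sub by blast
      ultimately show ?thesis using dg[of u] False by (simp add: d'_def)
    qed
    then show ?thesis using fin E finite_subset[of V' V] sub by (auto simp: admissible_def)
  qed
  from rest[OF sub ad'] obtain k where k: "dim_at_most (eigenfunctions E V' d') k"
    "4 * int k \<le> nullity_bound E V' d'" "4 * int k = nullity_bound E V' d' \<longrightarrow> extremal E V' d'"
    by (elim boundedE)
  \<comment> \<open>removing the non-bridge creates no component; without it, deleting \<open>w\<close> isolates \<open>v\<close>, which pays for one component\<close>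
  have nbd: "nullity_bound E V' d' + 4 \<le> nullity_bound E V d"
  proof -
    have "num_components F (V - {w}) + 1 \<le> num_components F V + card (nbrs_in F V w)"
      by (rule num_components_remove) (use fin E wV in \<open>auto simp: F_def sym_def\<close>)
    moreover have "nbrs_in F V w = nbrs_in E V w" using wv w by (auto simp: nbrs_in_def F_def)
    moreover have "num_components F (V - {w} - {v}) + 1 \<le> num_components F (V - {w}) + card (nbrs_in F (V - {w}) v)"
      by (rule num_components_remove) (use fin E bv wv in \<open>auto simp: F_def sym_def\<close>)
    moreover have "nbrs_in F (V - {w}) v = {}" using w by (auto simp: nbrs_in_def F_def)
    moreover have "V - {w} - {v} = V'" by (auto simp: V'_def)
    moreover have "num_components F V' = num_components E V'"
    proof -
      have "F \<inter> V' \<times> V' = E \<inter> V' \<times> V'" by (auto simp: F_def V'_def)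
      then show ?thesis by (simp add: num_components_def component_def)
    qed
    moreover have "num_components F V = num_components E V"
      using nonbridge_num_components[OF E(1) nb] by (simp add: F_def)
    ultimately have nc: "num_components E V' + 2 \<le> num_components E V + d w" using dg(1)[OF wV] by simp
    have "(\<Sum>u\<in>V'. 2 * int (d u) - 3) = (\<Sum>u\<in>V'. 2 * int (d' u) - 3) + 2"
    proof -
      have "(\<Sum>u\<in>V'. 2 * int (d u) - 3) - (\<Sum>u\<in>V'. 2 * int (d' u) - 3) = (\<Sum>u\<in>V'. 2 * int (d u) - 2 * int (d' u))"
        by (simp add: sum_subtractf)
      also have "\<dots> = (\<Sum>u\<in>{b}. 2 * int (d u) - 2 * int (d' u))"
        by (rule sum.mono_neutral_right) (use finite_subset[of V' V] fin sub bV' in \<open>auto simp: d'_def\<close>)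
      also have "\<dots> = 2" using d by (simp add: d'_def of_nat_diff)
      finally show ?thesis by simp
    qed
    moreover have "(\<Sum>u\<in>V. 2 * int (d u) - 3) = (\<Sum>u\<in>V'. 2 * int (d u) - 3) + (\<Sum>u\<in>{v, w}. 2 * int (d u) - 3)"
      unfolding V'_def by (rule sum.subset_diff) (use bv wV fin in auto)
    ultimately show ?thesis using nc wv d unfolding nullity_bound_def by simp
  qed
  have eig: "(\<lambda>u. if u \<in> V' then x u else 0) \<in> eigenfunctions E V' d'" and xv: "x v = x b"
    if x: "x \<in> eigenfunctions E V d" and xw: "x w = 0" for x
  proof -
    show xv: "x v = x b"
      using eigenfunction_eq2[OF x bv(3) w(2)] w(1) d xw by simp
    have eqn: "(real (d' u) - 1) * x u = (\<Sum>y\<in>nbrs_in E V' u. x y)" if u: "u \<in> V'" for u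
    proof (cases "u = b")
      case True
      have "(real (d b) - 1) * x b = x v + (\<Sum>y\<in>nbrs_in E V b - {v}. x y)"
        using eigenfunction_eq[OF x bv(2)] sum.remove[OF finN[OF subset_refl] vNb, of x] by simp
      also have "(\<Sum>y\<in>nbrs_in E V b - {v}. x y) = (\<Sum>y\<in>nbrs_in E V' b. x y)"
        by (rule sum.mono_neutral_right) (use finN[of V b] xw in \<open>auto simp: N'\<close>)
      finally have "(real (d b) - 1) * x b = x b + (\<Sum>y\<in>nbrs_in E V' b. x y)" using xv by simp
      moreover have "real (d b) = real (d' b) + 1" using d by (simp add: d'_def of_nat_diff)
      ultimately show ?thesis unfolding True by (simp only:) (simp add: algebra_simps)
    next
      case False
      have uV: "u \<in> V" "u \<noteq> w" using u by (auto simp: V'_def)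
      have "(real (d u) - 1) * x u = (\<Sum>y\<in>nbrs_in E V u. x y)" using eigenfunction_eq[OF x uV(1)] .
      also have "\<dots> = (\<Sum>y\<in>nbrs_in E V' u. x y)"
        by (rule sum.mono_neutral_right) (use finN[of V u] xw vN[OF uV(1) False uV(2)] in \<open>auto simp: N'\<close>)
      finally show ?thesis using False by (simp add: d'_def)
    qed
    have "(\<Sum>y\<in>nbrs_in E V' u. if y \<in> V' then x y else 0) = (\<Sum>y\<in>nbrs_in E V' u. x y)" for u
      by (rule sum.cong) (auto simp: nbrs_in_def)
    then show "(\<lambda>u. if u \<in> V' then x u else 0) \<in> eigenfunctions E V' d'"
      using eqn by (simp add: eigenfunctions_def)
  qed
  have dim0: "dim_at_most {x \<in> eigenfunctions E V d. x w = 0} k"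
  proof (rule dim_at_most_restrict[OF k(1)])
    fix x assume "x \<in> {x \<in> eigenfunctions E V d. x w = 0}"
    then have x: "x \<in> eigenfunctions E V d" "x w = 0" by auto
    show "(\<lambda>u. if u \<in> V' then x u else 0) \<in> eigenfunctions E V' d'" by (rule eig[OF x])
    show "x u = 0" if z: "\<And>u. u \<in> V' \<Longrightarrow> x u = 0" for u
    proof -
      have "x v = 0" using xv[OF x] z[OF bV'] by simp
      then show ?thesis using z[of u] x(2) eigenfunction_outside[OF x(1), of u] by (auto simp: V'_def)
    qed
  qed
  show ?thesis
  proof (cases "extremal E V' d'")
    case False
    have "dim_at_most (eigenfunctions E V d) (Suc k)"
      by (rule dim_at_most_functional[OF linear_functional_eval dim0])
    then show ?thesis by (rule bounded_strictI) (use k False nbd in auto)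
  next
    case True
    have db: "d b = 3" using True bV' d by (auto simp: extremal_def d'_def)
    have "in_edge_component E V' b \<or> in_hexagon_component E V' b" using True bV' by (simp add: extremal_def)
    then show ?thesis
    proof
      assume "in_edge_component E V' b"
      then obtain b' where b': "nbrs_in E V' b = {b'}" "nbrs_in E V' b' = {b}"
        unfolding in_edge_component_def by blast
      have b'V: "b' \<in> V'" using b' by (auto simp: nbrs_in_def)
      then have b'V2: "b' \<in> V" "b' \<noteq> w" "b' \<noteq> v" by (auto simp: V'_def)
      have b'b: "b' \<noteq> b" using b'(1) E by (auto simp: nbrs_in_def irrefl_def)
      have db': "d b' = 2" using True b'V b'b by (auto simp: extremal_def d'_def)
      have Nb: "nbrs_in E V b = {b', v} \<union> (if w \<in> nbrs_in E V b then {w} else {})"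
        using b'(1) vNb unfolding N' by auto
      have Nb': "nbrs_in E V b' = {b} \<union> (if w \<in> nbrs_in E V b' then {w} else {})"
        using b'(2) vN[OF b'V2(1) b'b b'V2(2)] unfolding N' by auto
      \<comment> \<open>eliminating \<open>x b'\<close> and \<open>x v\<close> from the equations at \<open>b\<close>, \<open>b'\<close> and \<open>v\<close> leaves a positive multiple of \<open>x w\<close>\<close>
      have "x w = 0" if x: "x \<in> eigenfunctions E V d" for x
      proof -
        have "2 * x b = (\<Sum>y\<in>nbrs_in E V b. x y)" using eigenfunction_eq[OF x bv(2)] db by simp
        also have "\<dots> = x b' + x v + (if w \<in> nbrs_in E V b then x w else 0)"
          by (subst Nb) (use b'V2 wv in auto)
        finally have 1: "2 * x b = x b' + x v + (if w \<in> nbrs_in E V b then x w else 0)" .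
        have "x b' = (\<Sum>y\<in>nbrs_in E V b'. x y)" using eigenfunction_eq[OF x b'V2(1)] db' by simp
        also have "\<dots> = x b + (if w \<in> nbrs_in E V b' then x w else 0)"
          by (subst Nb') (use w in auto)
        finally have 2: "x b' = x b + (if w \<in> nbrs_in E V b' then x w else 0)" .
        have 3: "x v = x b + x w" using eigenfunction_eq2[OF x bv(3) w(2)] w(1) d by simp
        show ?thesis using 1 2 3 by (auto split: if_splits)
      qed
      then have "{x \<in> eigenfunctions E V d. x w = 0} = eigenfunctions E V d" by blast
      then have "dim_at_most (eigenfunctions E V d) k" using dim0 by simp
      then show ?thesis by (rule bounded_strictI) (use k nbd in auto)
    next
      assume "in_hexagon_component E V' b"
      then obtain c1 c2 c3 c4 c5 where dist: "distinct [b, c1, c2, c3, c4, c5]" and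
        N: "nbrs_in E V' b = {c5, c1}" "nbrs_in E V' c1 = {b, c2}" "nbrs_in E V' c2 = {c1, c3}"
           "nbrs_in E V' c3 = {c2, c4}" "nbrs_in E V' c4 = {c3, c5}" "nbrs_in E V' c5 = {c4, b}"
        unfolding in_hexagon_component_def by blast
      define C where "C = {b, c1, c2, c3, c4, c5}"
      have CV': "C \<subseteq> V'" using bV' N by (auto simp: C_def nbrs_in_def)
      \<comment> \<open>the weights \<open>2\<close> are used up within the hexagon, and the third unit of \<open>b\<close> by \<open>v\<close>\<close>
      have full: "nbrs_in E V c = nbrs_in E V' c" if c: "c \<in> C" "c \<noteq> b" for c
      proof (rule card_seteq[symmetric])
        show "finite (nbrs_in E V c)" by (rule finN) simp
        show "nbrs_in E V' c \<subseteq> nbrs_in E V c" by (auto simp: N')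
        have "card (nbrs_in E V' c) = 2" using c N dist by (auto simp: C_def)
        moreover have "c \<in> V'" using c CV' by blast
        then have "d c = 2" using True c unfolding extremal_def by (auto simp: d'_def dest: bspec)
        moreover have "c \<in> V" using c CV' sub by blast
        ultimately show "card (nbrs_in E V c) \<le> card (nbrs_in E V' c)" using dg[of c] by simp
      qed
      have "{c5, c1, v} = nbrs_in E V b"
      proof (rule card_seteq)
        show "finite (nbrs_in E V b)" by (rule finN) simp
        have "{c5, c1} \<subseteq> nbrs_in E V b" using N(1) by (auto simp: N')
        then show "{c5, c1, v} \<subseteq> nbrs_in E V b" using vNb by blast
        have "v \<notin> C" using CV' by (auto simp: V'_def)
        then have "card {c5, c1, v} = 3" using dist by (auto simp: C_def)
        then show "card (nbrs_in E V b) \<le> card {c5, c1, v}" using dg(1)[OF bv(2)] db by simp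
      qed
      then have Nb: "nbrs_in F V b = {c5, c1}" using CV' by (auto simp: nbrs_in_def F_def V'_def C_def)
      have "component F V b \<subseteq> C"
      proof (rule component_least)
        show "b \<in> C" by (simp add: C_def)
        fix u y assume u: "u \<in> C" and y: "y \<in> nbrs_in F V u"
        show "y \<in> C"
        proof (cases "u = b")
          case False
          have "y \<in> nbrs_in E V u" using y by (auto simp: nbrs_in_def F_def)
          then have "y \<in> nbrs_in E V' u" using full[OF u False] by simp
          then show ?thesis using u False N by (auto simp: C_def)
        qed (use y Nb in \<open>auto simp: C_def\<close>)
      qed
      then show ?thesis using bv(4) CV' by (auto simp: V'_def)
    qed
  qed
qed

text \<open>A cycle through an edge at a vertex of degree \<open>2\<close> continues through the other edge.\<close>

lemma nonbridge_next:
  assumes E: "sym E" and irr: "irrefl E" and nb: "nonbridge E V a b"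
    and N: "nbrs_in E V a = {b, c}" and ne: "c \<noteq> b"
  shows "nonbridge E V a c"
proof -
  let ?Fb = "E - {(a, b), (b, a)}" and ?Fc = "E - {(a, c), (c, a)}"
  have ab: "a \<in> V" "b \<in> V" "(b, a) \<in> E" "b \<in> component ?Fb V a"
    using nb symD[OF E] by (auto simp: nonbridge_def)
  have ac: "(a, c) \<in> E" "c \<in> V" using N by (auto simp: nbrs_in_def)
  have nab: "a \<noteq> b" using ab(3) irr by (auto simp: irrefl_def)
  have F: "sym ?Fc" using E by (auto simp: sym_def)
  have "component ?Fb V a \<subseteq> {a} \<union> component ?Fc V c"
  proof (rule component_least)
    fix u w assume u: "u \<in> {a} \<union> component ?Fc V c" "u \<in> V" and w: "w \<in> nbrs_in ?Fb V u"
    show "w \<in> {a} \<union> component ?Fc V c"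
    proof (cases "u = a \<or> w = a")
      case True
      have "w = c" if "u = a"
      proof -
        have "w \<in> nbrs_in E V a" "w \<noteq> b" using w that by (auto simp: nbrs_in_def)
        then show ?thesis using N by blast
      qed
      then show ?thesis using True component_refl[of c] by auto
    next
      case False
      then have "w \<in> nbrs_in ?Fc V u" using w by (auto simp: nbrs_in_def)
      then show ?thesis using component_step[of u ?Fc V c w] u False by blast
    qed
  qed simp
  then have "b \<in> component ?Fc V c" using ab(4) nab by blast
  moreover have "a \<in> nbrs_in ?Fc V b" using ab nab ne by (auto simp: nbrs_in_def)
  ultimately have "a \<in> component ?Fc V c" using component_step ab(2) by metis
  then have "c \<in> component ?Fc V a" using component_eq[OF F, of a V c] component_refl[of c] by blast
  then show ?thesis using ac ab by (simp add: nonbridge_def)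
qed

lemma in_hexagon_componentI:
  "distinct [v, c1, c2, c3, c4, c5] \<Longrightarrow> nbrs_in E V v = {c5, c1} \<Longrightarrow> nbrs_in E V c1 = {v, c2} \<Longrightarrow>
   nbrs_in E V c2 = {c1, c3} \<Longrightarrow> nbrs_in E V c3 = {c2, c4} \<Longrightarrow> nbrs_in E V c4 = {c3, c5} \<Longrightarrow>
   nbrs_in E V c5 = {c4, v} \<Longrightarrow> in_hexagon_component E V v"
  unfolding in_hexagon_component_def by (intro exI[of _ c1] exI[of _ c2] exI[of _ c3] exI[of _ c4] exI[of _ c5]) simp

text \<open>Two zeros at adjacent vertices propagate around a cycle of weight-\<open>2\<close> vertices, so four times the nullity is at
most \<open>8\<close>, while the bound is the length plus \<open>2\<close>. This is strict from length \<open>7\<close> on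
and tight for length \<open>6\<close>. For lengths \<open>3\<close>, \<open>4\<close> and \<open>5\<close> a single zero
suffices. Short cycles are recognized by following both directions from \<open>a\<close>.\<close>

lemma bounded_cycle:
  assumes ad: "admissible E V d" and nb: "nonbridge E V a b0"
    and d2: "\<And>u w. nonbridge E V u w \<Longrightarrow> d u = 2"
    and IH: "\<And>V'. V' \<subset> V \<Longrightarrow> bounded E V' d"
  shows "bounded E V d"
proof -
  have fin: "finite V" and E: "sym E" "irrefl E" using ad by (auto simp: admissible_def)
  have irr: "u \<notin> nbrs_in E V u" for u using E(2) by (auto simp: nbrs_in_def irrefl_def)
  have NV: "w \<in> V" if "w \<in> nbrs_in E V u" for u w using that by (simp add: nbrs_in_def)
  note sy = nbrs_in_sym[OF E(1)]
  define K where "K = component E V a"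
  have aV: "a \<in> V" using nb by (simp add: nonbridge_def)
  have KV: "K \<subseteq> V" unfolding K_def by (rule component_subset[OF aV])
  have aK: "a \<in> K" by (simp add: K_def component_refl)
  have step: "w \<in> K" if "u \<in> K" "w \<in> nbrs_in E V u" for u w
    using that KV component_step[of u E V a w] unfolding K_def by blast
  have two: "\<exists>c. c \<noteq> y \<and> nbrs_in E V u = {y, c}" if "nonbridge E V u y" for u y
  proof (rule nonbridge_other_nbr[OF fin E that])
    have "u \<in> V" using that by (simp add: nonbridge_def)
    then show "card (nbrs_in E V u) \<le> 2" using ad d2[OF that] by (auto simp: admissible_def)
  qed
  have all: "nonbridge E V u w" if uy: "nonbridge E V u y" and w: "w \<in> nbrs_in E V u" for u w y
  proof -
    obtain c where c: "c \<noteq> y" "nbrs_in E V u = {y, c}" using two[OF uy] by blast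
    show ?thesis using uy w nonbridge_next[OF E uy c(2,1)] c(2) by auto
  qed
  have KX: "K \<subseteq> {u. \<exists>y. nonbridge E V u y}" unfolding K_def
  proof (rule component_least)
    show "a \<in> {u. \<exists>y. nonbridge E V u y}" using nb by blast
    fix u w assume "u \<in> {u. \<exists>y. nonbridge E V u y}" "w \<in> nbrs_in E V u"
    then show "w \<in> {u. \<exists>y. nonbridge E V u y}" using all nonbridge_sym[OF E(1)] by blast
  qed
  have dK: "d u = 2" if "u \<in> K" for u using KX that d2 by blast
  have other: "\<exists>c. c \<in> K \<and> c \<noteq> y \<and> nbrs_in E V u = {y, c}" if u: "u \<in> K" "y \<in> nbrs_in E V u" for u y
  proof -
    obtain t where "nonbridge E V u t" using KX u by blast
    then obtain c where c: "c \<noteq> y" "nbrs_in E V u = {y, c}" using two[OF all[OF _ u(2)]] by blast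
    then show ?thesis using step[OF u(1), of c] by auto
  qed
  have rel: "x u = x y + x c"
    if "x \<in> eigenfunctions E V d" "u \<in> K" "nbrs_in E V u = {y, c}" "c \<noteq> y" for x u y c
    using eigenfunction_eq2[OF that(1) _ that(3)] that(2,4) KV dK[OF that(2)] by auto
  have smaller: "bounded E (V - C) d" if "C \<subseteq> K" "a \<in> C" for C
    by (rule IH) (use that aV in auto)
  \<comment> \<open>all weights in \<open>K\<close> are \<open>2\<close>, so the weight sum over a closed set is its size\<close>
  have cut: "bounded E V d"
    if C: "C \<subseteq> K" "a \<in> C" and cl: "\<forall>u\<in>C. nbrs_in E V u \<subseteq> C" and R: "finite R"
      and kill: "\<And>x v. x \<in> eigenfunctions E V d \<Longrightarrow> (\<And>r. r \<in> R \<Longrightarrow> x r = 0) \<Longrightarrow> v \<in> C \<Longrightarrow> x v = 0"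
      and count: "4 * card R < card C + 2 \<or> 4 * card R = card C + 2 \<and> (\<forall>c\<in>C. in_hexagon_component E V c)"
    for C R
  proof (rule bounded_remove_closed[OF ad _ _ cl R _ smaller[OF C]])
    have "(\<Sum>v\<in>C. 2 * int (d v) - 3) = (\<Sum>v\<in>C. 1)" by (rule sum.cong) (use dK C in auto)
    then have "(\<Sum>v\<in>C. 2 * int (d v) - 3) = int (card C)" by simp
    then show "4 * int (card R) < (\<Sum>v\<in>C. 2 * int (d v) - 3) + 2 \<or>
      4 * int (card R) = (\<Sum>v\<in>C. 2 * int (d v) - 3) + 2 \<and>
      (\<forall>c\<in>C. d c = 2 \<and> (in_edge_component E V c \<or> in_hexagon_component E V c))"
      using count dK C(1) by auto
    show "x v = 0" if "x \<in> eigenfunctions E V d" "\<And>r. r \<in> R \<Longrightarrow> x r = 0" "v \<in> C" for x v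
      by (rule kill[OF that(1) _ that(3)]) (rule that(2))
  qed (use C KV in auto)
  obtain p where p: "p \<in> nbrs_in E V a" using two[OF nb] by blast
  obtain q where q: "q \<in> K" "q \<noteq> p" "nbrs_in E V a = {p, q}" using other[OF aK p] by blast
  have pK: "p \<in> K" using step[OF aK p] .
  have ap: "a \<noteq> p" "a \<noteq> q" using irr[of a] q by auto
  have aNp: "a \<in> nbrs_in E V p" and aNq: "a \<in> nbrs_in E V q" using sy[OF aV] q by auto
  obtain p2 where p2: "p2 \<in> K" "p2 \<noteq> a" "nbrs_in E V p = {a, p2}" using other[OF pK aNp] by blast
  obtain q2 where q2: "q2 \<in> K" "q2 \<noteq> a" "nbrs_in E V q = {a, q2}" using other[OF q(1) aNq] by blast
  have pp2: "p2 \<noteq> p" and qq2: "q2 \<noteq> q" using irr[of p] irr[of q] p2 q2 by auto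
  have pV: "p \<in> V" "q \<in> V" "p2 \<in> V" "q2 \<in> V" using pK q p2 q2 KV by auto
  \<comment> \<open>the two walks from \<open>a\<close> through \<open>p\<close> and \<open>q\<close> meet after as many steps as half the length of the cycle\<close>
  show ?thesis
  proof (cases "p2 = q")
    case True
    have "p \<in> nbrs_in E V q" using sy[OF pV(1)] p2 True by auto
    then have q2p: "q2 = p" using q2 ap by auto
    show ?thesis
    proof (rule cut[of "{a, p, q}" "{a}"])
      fix x v assume x: "x \<in> eigenfunctions E V d" "\<And>r. r \<in> {a} \<Longrightarrow> x r = 0" and v: "v \<in> {a, p, q}"
      have 0: "x a = 0" using x(2) by simp
      note r = rel[OF x(1) aK q(3,2)] rel[OF x(1) pK p2(3,2)] rel[OF x(1) q(1) q2(3,2)]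
      have "x p = 0" "x q = 0" using 0 r unfolding True q2p by linarith+
      then show "x v = 0" using v 0 by blast
    qed (use aK pK q p2 q2 q2p True ap in auto)
  next
    case p2q: False
    have q2p: "q2 \<noteq> p"
    proof
      assume "q2 = p"
      then have "q \<in> nbrs_in E V p" using sy[OF pV(2)] q2 by auto
      then show False using p2 p2q ap by auto
    qed
    have pN: "p \<in> nbrs_in E V p2" and qN: "q \<in> nbrs_in E V q2" using sy[OF pV(1)] sy[OF pV(2)] p2 q2 by auto
    show ?thesis
    proof (cases "p2 = q2")
      case True
      obtain r where "r \<noteq> p" "nbrs_in E V p2 = {p, r}" using other[OF p2(1) pN] by blast
      then have Nr: "nbrs_in E V p2 = {p, q}" using qN True q by auto
      show ?thesis
      proof (rule cut[of "{a, p, q, p2}" "{a}"])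
        fix x v assume x: "x \<in> eigenfunctions E V d" "\<And>r. r \<in> {a} \<Longrightarrow> x r = 0" and v: "v \<in> {a, p, q, p2}"
        have 0: "x a = 0" using x(2) by simp
        note r = rel[OF x(1) aK q(3,2)] rel[OF x(1) pK p2(3,2)] rel[OF x(1) q(1) q2(3,2)]
        have "x p = 0" "x q = 0" "x p2 = 0" using 0 r unfolding True by linarith+
        then show "x v = 0" using v 0 by blast
      qed (use aK pK q p2 q2 Nr True ap pp2 qq2 in auto)
    next
      case pq2: False
      obtain p3 where p3: "p3 \<in> K" "p3 \<noteq> p" "nbrs_in E V p2 = {p, p3}" using other[OF p2(1) pN] by blast
      obtain q3 where q3: "q3 \<in> K" "q3 \<noteq> q" "nbrs_in E V q2 = {q, q3}" using other[OF q2(1) qN] by blast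
      have p3V: "p3 \<in> V" "q3 \<in> V" using p3 q3 KV by auto
      have p2N: "p2 \<in> nbrs_in E V p3" and q2N: "q2 \<in> nbrs_in E V q3" using sy[OF pV(3)] sy[OF pV(4)] p3 q3 by auto
      have pp3: "p3 \<noteq> p2" and qq3: "q3 \<noteq> q2" using irr[of p2] irr[of q2] p3 q3 by auto
      have p3a: "p3 \<noteq> a" using p2N q p2q pp2 by auto
      have q3a: "q3 \<noteq> a" using q2N q q2p qq2 by auto
      have p3q: "p3 \<noteq> q" using p2N q2 pq2 p2 by auto
      have q3p: "q3 \<noteq> p" using q2N p2 pq2 q2 by auto
      show ?thesis
      proof (cases "p3 = q2")
        case True
        then have "q3 = p2" using p2N q3 p2q by auto
        show ?thesis
        proof (rule cut[of "{a, p, q, p2, q2}" "{a}"])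
          fix x v assume x: "x \<in> eigenfunctions E V d" "\<And>r. r \<in> {a} \<Longrightarrow> x r = 0" and v: "v \<in> {a, p, q, p2, q2}"
          have 0: "x a = 0" using x(2) by simp
          note r = rel[OF x(1) aK q(3,2)] rel[OF x(1) pK p2(3,2)] rel[OF x(1) q(1) q2(3,2)]
            rel[OF x(1) p2(1) p3(3,2)] rel[OF x(1) q2(1) q3(3,2)]
          have "x p = 0" "x q = 0" "x p2 = 0" "x q2 = 0" using 0 r unfolding True \<open>q3 = p2\<close> by linarith+
          then show "x v = 0" using v 0 by blast
        qed (use aK pK q p2 q2 p3 q3 True \<open>q3 = p2\<close> ap pp2 qq2 p2q q2p pq2 in auto)
      next
        case p3q2: False
        have q3p2: "q3 \<noteq> p2"
        proof
          assume "q3 = p2"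
          then have "q2 = p3" using q2N p3 q2p by auto
          then show False using p3q2 by simp
        qed
        show ?thesis
        proof (cases "p3 = q3")
          case True
          obtain r where "r \<noteq> p2" "nbrs_in E V p3 = {p2, r}" using other[OF p3(1) p2N] by blast
          then have Ns: "nbrs_in E V p3 = {p2, q2}" using q2N True pq2 by auto
          have Nq2: "nbrs_in E V q2 = {q, p3}" using q3 True by simp
          have dist: "distinct [a, p, p2, p3, q2, q]"
            using ap pp2 qq2 p2q q2p pq2 p3a p3q p3 pp3 p3q2 p2 q2 q by auto
          have hex: "\<forall>c\<in>{a, p, p2, p3, q2, q}. in_hexagon_component E V c"
          proof -
            have "in_hexagon_component E V a"
              by (rule in_hexagon_componentI[of a p p2 p3 q2 q]) (use dist q p2 p3 Ns Nq2 q2 in \<open>auto\<close>)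
            moreover have "in_hexagon_component E V p"
              by (rule in_hexagon_componentI[of p p2 p3 q2 q a]) (use dist q p2 p3 Ns Nq2 q2 in \<open>auto\<close>)
            moreover have "in_hexagon_component E V p2"
              by (rule in_hexagon_componentI[of p2 p3 q2 q a p]) (use dist q p2 p3 Ns Nq2 q2 in \<open>auto\<close>)
            moreover have "in_hexagon_component E V p3"
              by (rule in_hexagon_componentI[of p3 q2 q a p p2]) (use dist q p2 p3 Ns Nq2 q2 in \<open>auto\<close>)
            moreover have "in_hexagon_component E V q2"
              by (rule in_hexagon_componentI[of q2 q a p p2 p3]) (use dist q p2 p3 Ns Nq2 q2 in \<open>auto\<close>)
            moreover have "in_hexagon_component E V q"
              by (rule in_hexagon_componentI[of q a p p2 p3 q2]) (use dist q p2 p3 Ns Nq2 q2 in \<open>auto\<close>)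
            ultimately show ?thesis by simp
          qed
          show ?thesis
          proof (rule cut[of "{a, p, p2, p3, q2, q}" "{a, p}"])
            show "4 * card {a, p} < card {a, p, p2, p3, q2, q} + 2 \<or>
              4 * card {a, p} = card {a, p, p2, p3, q2, q} + 2 \<and> (\<forall>c\<in>{a, p, p2, p3, q2, q}. in_hexagon_component E V c)"
              using dist hex by simp
            fix x v assume x: "x \<in> eigenfunctions E V d" "\<And>r. r \<in> {a, p} \<Longrightarrow> x r = 0"
              and v: "v \<in> {a, p, p2, p3, q2, q}"
            have 0: "x a = 0" "x p = 0" using x(2) by simp_all
            note r = rel[OF x(1) aK q(3,2)] rel[OF x(1) pK p2(3,2)] rel[OF x(1) q(1) q2(3,2)]
              rel[OF x(1) p2(1) p3(3,2)]
            have "x q = 0" "x p2 = 0" "x q2 = 0" "x p3 = 0" using 0 r by linarith+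
            then show "x v = 0" using v 0 by blast
          qed (use aK pK q p2 q2 p3 Ns Nq2 in auto)
        next
          case False
          \<comment> \<open>at least seven vertices: two adjacent zeros propagate through the whole component\<close>
          show ?thesis
          proof (rule cut[of K "{a, p}"])
            have "{a, p, q, p2, q2, p3, q3} \<subseteq> K" using aK pK q p2 q2 p3 q3 by blast
            then have "card {a, p, q, p2, q2, p3, q3} \<le> card K"
              by (rule card_mono[OF finite_subset[OF KV fin]])
            moreover have "card {a, p, q, p2, q2, p3, q3} = 7"
            proof -
              have "distinct [a, p, q, p2, q2, p3, q3]"
                using ap pp2 qq2 p2q q2p pq2 p3a p3q p3 pp3 p3q2 p2 q2 q q3a q3p q3 qq3 q3p2 False by auto
              from distinct_card[OF this] show ?thesis by simp
            qed
            moreover have "card {a, p} = 2" using ap by simp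
            ultimately show "4 * card {a, p} < card K + 2 \<or>
              4 * card {a, p} = card K + 2 \<and> (\<forall>c\<in>K. in_hexagon_component E V c)" by simp
            fix x v assume x: "x \<in> eigenfunctions E V d" "\<And>r. r \<in> {a, p} \<Longrightarrow> x r = 0" and v: "v \<in> K"
            have 0: "x a = 0" "x p = 0" "x q = 0" using x(2) rel[OF x(1) aK q(3,2)] by simp_all
            have "K \<subseteq> {u \<in> K. x u = 0 \<and> (\<forall>w\<in>nbrs_in E V u. x w = 0)}"
            proof -
              have "component E V a \<subseteq> {u \<in> K. x u = 0 \<and> (\<forall>w\<in>nbrs_in E V u. x w = 0)}"
              proof (rule component_least)
                show "a \<in> {u \<in> K. x u = 0 \<and> (\<forall>w\<in>nbrs_in E V u. x w = 0)}" using aK 0 q by auto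
                fix u w assume u: "u \<in> {u \<in> K. x u = 0 \<and> (\<forall>w\<in>nbrs_in E V u. x w = 0)}" "u \<in> V"
                  and w: "w \<in> nbrs_in E V u"
                have wK: "w \<in> K" using step u w by blast
                obtain c where c: "c \<noteq> u" "nbrs_in E V w = {u, c}" using other[OF wK sy[OF u(2) w]] by blast
                have "x w = 0" "x u = 0" using u w by auto
                then have "x c = 0" using rel[OF x(1) wK c(2,1)] by simp
                then show "w \<in> {u \<in> K. x u = 0 \<and> (\<forall>w\<in>nbrs_in E V u. x w = 0)}"
                  using wK \<open>x w = 0\<close> \<open>x u = 0\<close> c by auto
              qed
              then show ?thesis by (simp add: K_def)
            qed
            then show "x v = 0" using v by blast
          qed (use aK step in auto)
        qed
      qed
    qed
  qed
qed

text \<open>Edges on cycles with an endpoint of weight at least \<open>3\<close> are handled first; if only edges with both weights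
\<open>2\<close> lie on cycles, then a cycle is a whole component, and otherwise the graph is a forest.\<close>

theorem admissible_bounded:
  assumes "admissible E V d"
  shows "bounded E V d"
  using assms
proof (induction "card V + card (E \<inter> V \<times> V)" arbitrary: E V d rule: less_induct)
  case less
  note ad = less.prems
  have fin: "finite V" and E: "sym E" "irrefl E" using ad by (auto simp: admissible_def)
  have IH: "bounded E V' d'" if V': "V' \<subset> V" and a: "admissible E V' d'" for V' d'
  proof (rule less.hyps[OF _ a])
    have "card V' < card V" using psubset_card_mono[OF fin V'] .
    moreover have "card (E \<inter> V' \<times> V') \<le> card (E \<inter> V \<times> V)"
      by (rule card_mono) (use fin V' in auto)
    ultimately show "card V' + card (E \<inter> V' \<times> V') < card V + card (E \<inter> V \<times> V)" by linarith
  qed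
  have IHsub: "bounded E V' d" if "V' \<subset> V" for V'
    using IH[OF that admissible_subset[OF ad]] that by blast
  show ?case
  proof (cases "V = {}")
    case True
    then have "dim_at_most (eigenfunctions E V d) 0" by (intro dim_at_most_0) (simp add: eigenfunctions_def)
    then show ?thesis unfolding bounded_def using True
      by (intro exI[of _ 0]) (simp add: nullity_bound_def num_components_def extremal_def)
  next
    case ne: False
    show ?thesis
    proof (cases "\<exists>a b. nonbridge E V a b")
      case False
      then show ?thesis by (intro bounded_forest[OF ad ne _ IHsub]) blast+
    next
      case True
      have ge2: "2 \<le> d a" if "nonbridge E V a b" for a b
        using that ad by (auto simp: nonbridge_def admissible_def)
      show ?thesis
      proof (cases "\<exists>a b. nonbridge E V a b \<and> 3 \<le> d a")
        case False
        then have d2: "d a = 2" if "nonbridge E V a b" for a b using that ge2[OF that] by (metis Suc_leI eval_nat_numeral(3) le_neq_implies_less)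
        obtain a b where "nonbridge E V a b" using True by blast
        then show ?thesis by (rule bounded_cycle[OF ad _ d2 IHsub])
      next
        case True
        then obtain a b where nb: "nonbridge E V a b" and a3: "3 \<le> d a" by blast
        show ?thesis
        proof (cases "3 \<le> d b")
          case False
          then have "d b = 2" using ge2[OF nonbridge_sym[OF E(1) nb]] by linarith
          from nonbridge_contract[OF ad nb a3 this IH] show ?thesis .
        next
          case b3: True
          let ?F = "E - {(a, b), (b, a)}" and ?d = "d(a := d a - 1, b := d b - 1)"
          have ab: "(a, b) \<in> E" "(b, a) \<in> E" "a \<in> V" "b \<in> V" "a \<noteq> b"
            using nb symD[OF E(1)] E(2) by (auto simp: nonbridge_def irrefl_def)
          have "admissible ?F V ?d"
          proof -
            have "2 \<le> ?d v \<and> card (nbrs_in ?F V v) \<le> ?d v" if v: "v \<in> V" for v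
            proof -
              have dv: "2 \<le> d v" "card (nbrs_in E V v) \<le> d v" using ad v by (auto simp: admissible_def)
              consider "v = a" | "v = b" "v \<noteq> a" | "v \<noteq> a" "v \<noteq> b" by blast
              then show ?thesis
              proof cases
                case 1
                have "nbrs_in ?F V v = nbrs_in E V v - {b}" "b \<in> nbrs_in E V v" using 1 ab by (auto simp: nbrs_in_def)
                then have "card (nbrs_in ?F V v) = card (nbrs_in E V v) - 1" by simp
                moreover have "?d v = d v - 1" using 1 ab(5) by simp
                moreover have "3 \<le> d v" using 1 a3 by simp
                ultimately show ?thesis using dv by linarith
              next
                case 2
                have "nbrs_in ?F V v = nbrs_in E V v - {a}" "a \<in> nbrs_in E V v" using 2 ab by (auto simp: nbrs_in_def)
                then have "card (nbrs_in ?F V v) = card (nbrs_in E V v) - 1" by simp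
                moreover have "?d v = d v - 1" using 2 by simp
                moreover have "3 \<le> d v" using 2 b3 by simp
                ultimately show ?thesis using dv by linarith
              next
                case 3
                have "nbrs_in ?F V v = nbrs_in E V v" using 3 by (auto simp: nbrs_in_def)
                then show ?thesis using 3 dv by simp
              qed
            qed
            then show ?thesis using fin E by (auto simp: admissible_def sym_def irrefl_def)
          qed
          moreover have "card (?F \<inter> V \<times> V) < card (E \<inter> V \<times> V)"
            by (rule psubset_card_mono) (use fin ab in auto)
          ultimately have "bounded ?F V ?d" by (intro less.hyps) auto
          from bounded_delete_edge[OF ad nb a3 b3 this IHsub] show ?thesis .
        qed
      qed
    qed
  qed
qed

section \<open>Deleting pendant vertices\<close>

text \<open>The conditions make the pairs of a leaf of weight \<open>1\<close> and its neighbour disjoint, so that deleting one pair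
leaves the others intact.\<close>

definition reducible :: "('a \<times> 'a) set \<Rightarrow> 'a set \<Rightarrow> ('a \<Rightarrow> nat) \<Rightarrow> bool" where
  "reducible E V d \<longleftrightarrow> finite V \<and> sym E \<and> irrefl E \<and>
     (\<forall>v\<in>V. 1 \<le> d v \<and> card (nbrs_in E V v) \<le> d v) \<and>
     (\<forall>v\<in>V. d v = 1 \<longrightarrow> (\<exists>w. nbrs_in E V v = {w} \<and> 2 \<le> d w \<and>
        (\<forall>u\<in>V. d u = 1 \<and> w \<in> nbrs_in E V u \<longrightarrow> u = v)))"

text \<open>The shape of a graph that attains the bound. A vertex of \<open>Q\<close> must use up its weight by the edges present when it
is deleted together with its pendant neighbour, so it has no edge to a vertex of \<open>Q\<close> deleted earlier; hence
there is no edge within \<open>Q\<close>.\<close>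

definition tight :: "('a \<times> 'a) set \<Rightarrow> 'a set \<Rightarrow> ('a \<Rightarrow> nat) \<Rightarrow> 'a set \<Rightarrow> 'a set \<Rightarrow> 'a set \<Rightarrow> bool" where
  "tight E V d P Q W \<longleftrightarrow> P \<union> Q \<union> W = V \<and> P \<inter> Q = {} \<and> P \<inter> W = {} \<and> Q \<inter> W = {} \<and>
     (\<forall>p\<in>P. d p = 1 \<and> (\<exists>q\<in>Q. nbrs_in E V p = {q})) \<and>
     (\<forall>q\<in>Q. d q = card (nbrs_in E V q) \<and> (\<exists>p. nbrs_in E V q \<inter> P = {p}) \<and> nbrs_in E V q \<inter> Q = {}) \<and>
     extremal E W d"

text \<open>A vertex \<open>q\<close> of \<open>Q\<close> has no neighbour outside \<open>V'\<close>, as its weight is its degree in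
\<open>V'\<close>; so \<open>w\<close> is not adjacent to \<open>Q\<close>.\<close>

lemma tight_add_pendant:
  assumes t: "tight E V' d P Q W" and V': "V' = V - {v, w}" and fin: "finite V" and E: "sym E" "irrefl E"
    and dg: "\<And>u. u \<in> V \<Longrightarrow> card (nbrs_in E V u) \<le> d u"
    and v: "v \<in> V" "nbrs_in E V v = {w}" "d v = 1" and dw: "d w = card (nbrs_in E V w)"
  shows "tight E V d (insert v P) (insert w Q) W"
proof -
  have irr: "u \<notin> nbrs_in E V u" for u using E(2) by (auto simp: nbrs_in_def irrefl_def)
  have wV: "w \<in> V" using v by (auto simp: nbrs_in_def)
  have vw: "v \<noteq> w" using irr[of v] v by auto
  have N': "nbrs_in E V' u = nbrs_in E V u - {v, w}" for u by (auto simp: V' nbrs_in_def)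
  have finN: "finite (nbrs_in E V u)" for u by (rule finite_nbrs_in[OF fin])
  have sub: "P \<subseteq> V'" "Q \<subseteq> V'" "W \<subseteq> V'" and un: "P \<union> Q \<union> W = V'"
    and dis: "P \<inter> Q = {}" "P \<inter> W = {}" "Q \<inter> W = {}" and ex: "extremal E W d"
    using t by (auto simp: tight_def)
  have P: "d p = 1" "\<exists>q\<in>Q. nbrs_in E V p = {q}" if p: "p \<in> P" for p
  proof -
    show "d p = 1" using t p by (simp add: tight_def)
    obtain q where q: "q \<in> Q" "nbrs_in E V' p = {q}" using t p by (auto simp: tight_def)
    have "{q} = nbrs_in E V p"
    proof (rule card_seteq[OF finN])
      show "{q} \<subseteq> nbrs_in E V p" unfolding q(2)[symmetric] N' by blast
      have "p \<in> V" using p sub V' by blast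
      then show "card (nbrs_in E V p) \<le> card {q}" using dg[of p] \<open>d p = 1\<close> by simp
    qed
    then show "\<exists>q\<in>Q. nbrs_in E V p = {q}" using q(1) by auto
  qed
  have Q: "nbrs_in E V q = nbrs_in E V' q" "d q = card (nbrs_in E V q)" "\<exists>p. nbrs_in E V' q \<inter> P = {p}"
      "nbrs_in E V' q \<inter> Q = {}" if q: "q \<in> Q" for q
  proof -
    have dq: "d q = card (nbrs_in E V' q)" using t q by (simp add: tight_def)
    have "q \<in> V" using q sub V' by blast
    then have "card (nbrs_in E V q) \<le> card (nbrs_in E V' q)" using dg[of q] dq by simp
    moreover have "nbrs_in E V' q \<subseteq> nbrs_in E V q" by (auto simp: N')
    ultimately show eq: "nbrs_in E V q = nbrs_in E V' q" by (metis card_seteq finN)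
    show "d q = card (nbrs_in E V q)" using dq eq by simp
    show "\<exists>p. nbrs_in E V' q \<inter> P = {p}" "nbrs_in E V' q \<inter> Q = {}" using t q by (auto simp: tight_def)
  qed
  have Qvw: "v \<notin> nbrs_in E V q" "w \<notin> nbrs_in E V q" if "q \<in> Q" for q
    using Q(1)[OF that] unfolding N' by blast+
  have wP: "p \<notin> nbrs_in E V w" if p: "p \<in> P" for p
  proof
    assume "p \<in> nbrs_in E V w"
    then have "w \<in> nbrs_in E V p" by (rule nbrs_in_sym[OF E(1) wV])
    then obtain q where "q \<in> Q" "w = q" using P(2)[OF p] by auto
    then show False using sub V' by blast
  qed
  have wQ: "q \<notin> nbrs_in E V w" if "q \<in> Q" for q
    using nbrs_in_sym[OF E(1) wV] Qvw(2)[OF that] by blast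
  have wv: "v \<in> nbrs_in E V w" using nbrs_in_sym[OF E(1) v(1)] v(2) by blast
  show ?thesis
    unfolding tight_def
  proof (intro conjI ballI)
    show "insert v P \<union> insert w Q \<union> W = V" using un V' v wV by blast
    show "insert v P \<inter> insert w Q = {}" "insert v P \<inter> W = {}" "insert w Q \<inter> W = {}"
      using dis sub V' vw by blast+
    show "d p = 1" if "p \<in> insert v P" for p using that P v by blast
    show "\<exists>q\<in>insert w Q. nbrs_in E V p = {q}" if "p \<in> insert v P" for p using that P v by blast
    fix q assume q: "q \<in> insert w Q"
    show "d q = card (nbrs_in E V q)" using q Q(2) dw by blast
    show "nbrs_in E V q \<inter> insert w Q = {}"
      using q Q(1,4) Qvw wQ irr by blast
    show "\<exists>p. nbrs_in E V q \<inter> insert v P = {p}"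
    proof (cases "q = w")
      case True
      then have "nbrs_in E V q \<inter> insert v P = {v}" using wP wv by blast
      then show ?thesis by blast
    next
      case False
      then have "nbrs_in E V q \<inter> insert v P = nbrs_in E V' q \<inter> P" using q Q(1) Qvw by blast
      then show ?thesis using Q(3) q False by auto
    qed
  qed (rule ex)
qed

text \<open>The equation at a leaf of weight \<open>1\<close> is \<open>x w = 0\<close>, and the equation at \<open>w\<close> determines
the value at the leaf, so deleting both changes neither the dimension nor the surviving equations. The leaf has summand
\<open>-1\<close> in the bound and is itself a component once \<open>w\<close> is gone; with both effects the bound drops by
at least twice the slack \<open>d w - deg w\<close>.\<close>

theorem reducible_bounded:
  fixes E :: "('a \<times> 'a) set"
  assumes "reducible E V d"
  shows "\<exists>k. dim_at_most (eigenfunctions E V d) k \<and> 4 * int k \<le> nullity_bound E V d \<and>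
    (4 * int k = nullity_bound E V d \<longrightarrow> (\<exists>P Q W. tight E V d P Q W))"
  using assms
proof (induction "card V" arbitrary: V rule: less_induct)
  case less
  have fin: "finite V" and E: "sym E" "irrefl E" and dg: "\<And>v. v \<in> V \<Longrightarrow> 1 \<le> d v" "\<And>v. v \<in> V \<Longrightarrow> card (nbrs_in E V v) \<le> d v"
    and pend: "\<And>v. v \<in> V \<Longrightarrow> d v = 1 \<Longrightarrow> \<exists>w. nbrs_in E V v = {w} \<and> 2 \<le> d w \<and>
        (\<forall>u\<in>V. d u = 1 \<and> w \<in> nbrs_in E V u \<longrightarrow> u = v)"
    using less.prems by (auto simp: reducible_def)
  show ?case
  proof (cases "\<exists>v\<in>V. d v = 1")
    case False
    have "2 \<le> d v" if "v \<in> V" for v using dg(1)[OF that] False that by (metis One_nat_def Suc_1 le_antisym not_less_eq_eq)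
    then have "admissible E V d" using fin E dg(2) by (simp add: admissible_def)
    then obtain k where k: "dim_at_most (eigenfunctions E V d) k" "4 * int k \<le> nullity_bound E V d"
      "4 * int k = nullity_bound E V d \<longrightarrow> extremal E V d" by (elim boundedE[OF admissible_bounded])
    have "tight E V d {} {} V" if "extremal E V d" using that by (simp add: tight_def)
    then show ?thesis using k by blast
  next
    case True
    then obtain v where v: "v \<in> V" "d v = 1" by blast
    obtain w where w: "nbrs_in E V v = {w}" "2 \<le> d w" "\<And>u. u \<in> V \<Longrightarrow> d u = 1 \<Longrightarrow> w \<in> nbrs_in E V u \<Longrightarrow> u = v"
      using pend[OF v] by blast
    have irr: "u \<notin> nbrs_in E V u" for u using E(2) by (auto simp: nbrs_in_def irrefl_def)
    have wV: "w \<in> V" using w by (auto simp: nbrs_in_def)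
    have vw: "v \<noteq> w" using irr[of v] w by auto
    have wv: "v \<in> nbrs_in E V w" using nbrs_in_sym[OF E(1) v(1)] w(1) by blast
    define V' where "V' = V - {v, w}"
    have N': "nbrs_in E V' u = nbrs_in E V u - {v, w}" for u by (auto simp: V'_def nbrs_in_def)
    have vN: "v \<notin> nbrs_in E V u" if "u \<in> V'" for u
      using nbrs_in_sym[OF E(1), of u V v] that w(1) by (auto simp: V'_def)
    have cV: "card V' < card V" by (rule psubset_card_mono[OF fin]) (use v in \<open>auto simp: V'_def\<close>)
    have "reducible E V' d" unfolding reducible_def
    proof (intro conjI ballI impI)
      show "finite V'" "sym E" "irrefl E" using fin E by (auto simp: V'_def)
      fix u assume u: "u \<in> V'"
      then have uV: "u \<in> V" "u \<noteq> v" "u \<noteq> w" by (auto simp: V'_def)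
      show "1 \<le> d u" using dg(1) uV by blast
      have "card (nbrs_in E V' u) \<le> card (nbrs_in E V u)"
        by (rule card_nbrs_in_mono[OF fin]) (auto simp: V'_def)
      then show "card (nbrs_in E V' u) \<le> d u" using dg(2)[OF uV(1)] by linarith
      assume du: "d u = 1"
      obtain t where t: "nbrs_in E V u = {t}" "2 \<le> d t" "\<And>s. s \<in> V \<Longrightarrow> d s = 1 \<Longrightarrow> t \<in> nbrs_in E V s \<Longrightarrow> s = u"
        using pend[OF uV(1) du] by blast
      have "t \<noteq> w" using w(3)[OF uV(1) du] t(1) uV(2) by blast
      moreover have "t \<noteq> v" using vN[OF u] t(1) by blast
      ultimately have "nbrs_in E V' u = {t}" using t(1) by (auto simp: N')
      moreover have "\<forall>s\<in>V'. d s = 1 \<and> t \<in> nbrs_in E V' s \<longrightarrow> s = u"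
      proof (intro ballI impI, elim conjE)
        fix s assume s: "s \<in> V'" "d s = 1" "t \<in> nbrs_in E V' s"
        have "s \<in> V" "t \<in> nbrs_in E V s" using s(1) s(3)[unfolded N'] by (auto simp: V'_def)
        then show "s = u" using t(3) s(2) by blast
      qed
      ultimately show "\<exists>w. nbrs_in E V' u = {w} \<and> 2 \<le> d w \<and>
        (\<forall>s\<in>V'. d s = 1 \<and> w \<in> nbrs_in E V' s \<longrightarrow> s = u)" using t(2) by blast
    qed
    from less.hyps[OF cV this] obtain k where k: "dim_at_most (eigenfunctions E V' d) k"
      "4 * int k \<le> nullity_bound E V' d" "4 * int k = nullity_bound E V' d \<longrightarrow> (\<exists>P Q W. tight E V' d P Q W)"
      by blast
    have "dim_at_most (eigenfunctions E V d) (k + card ({} :: 'a set))"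
    proof (rule dim_at_most_probe[OF fin _ _ k(1)])
      show "V' \<subseteq> V" by (auto simp: V'_def)
      fix x assume x: "x \<in> eigenfunctions E V d"
      have xw: "x w = 0" using eigenfunction_eq1[OF x v(1) w(1)] v(2) by simp
      show "x t = 0" if "u \<in> V'" "t \<in> nbrs_in E V u" "t \<notin> V'" for u t
        using that xw vN[OF that(1)] by (auto simp: V'_def nbrs_in_def)
      show "x u = 0" if z: "\<And>t. t \<in> V' \<Longrightarrow> x t = 0" and u: "u \<in> V" "u \<notin> V'" for u
      proof -
        have "(\<Sum>t\<in>nbrs_in E V w. x t) = x v + (\<Sum>t\<in>nbrs_in E V w - {v}. x t)"
          by (rule sum.remove[OF finite_nbrs_in[OF fin] wv])
        also have "(\<Sum>t\<in>nbrs_in E V w - {v}. x t) = 0"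
        proof (rule sum.neutral, rule ballI)
          fix t assume "t \<in> nbrs_in E V w - {v}"
          then have "t \<in> V'" using irr[of w] by (auto simp: V'_def nbrs_in_def)
          then show "x t = 0" by (rule z)
        qed
        finally have "x v = 0" using eigenfunction_eq[OF x wV] xw by simp
        then show ?thesis using xw u by (auto simp: V'_def)
      qed
    qed simp
    then have dim: "dim_at_most (eigenfunctions E V d) k" by simp
    have nb: "nullity_bound E V' d + 2 * int (d w) \<le> nullity_bound E V d + 2 * int (card (nbrs_in E V w))"
    proof -
      have "num_components E (V - {w}) + 1 \<le> num_components E V + card (nbrs_in E V w)"
        by (rule num_components_remove[OF fin E(1) wV])
      moreover have "num_components E (V - {w} - {v}) + 1 \<le> num_components E (V - {w}) + card (nbrs_in E (V - {w}) v)"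
        by (rule num_components_remove) (use fin E v vw in auto)
      moreover have "nbrs_in E (V - {w}) v = {}" using w(1) by (auto simp: nbrs_in_def)
      moreover have "V - {w} - {v} = V'" by (auto simp: V'_def)
      ultimately have nc: "num_components E V' + 2 \<le> num_components E V + card (nbrs_in E V w)" by simp
      have "(\<Sum>u\<in>V. 2 * int (d u) - 3) = (\<Sum>u\<in>V'. 2 * int (d u) - 3) + (\<Sum>u\<in>{v, w}. 2 * int (d u) - 3)"
        unfolding V'_def by (rule sum.subset_diff) (use v wV fin in auto)
      then show ?thesis using nc vw v(2) unfolding nullity_bound_def by simp
    qed
    have dgw: "int (card (nbrs_in E V w)) \<le> int (d w)" using dg(2)[OF wV] by simp
    show ?thesis
    proof (intro exI[of _ k] conjI impI)
      show "4 * int k \<le> nullity_bound E V d" using nb k(2) dgw by linarith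
      assume eq: "4 * int k = nullity_bound E V d"
      have "d w = card (nbrs_in E V w)" "4 * int k = nullity_bound E V' d"
        using nb k(2) dgw eq by linarith+
      then obtain P Q W where "tight E V' d P Q W" using k(3) by blast
      from tight_add_pendant[OF this V'_def fin E dg(2) v(1) w(1) v(2) \<open>d w = _\<close>]
      show "\<exists>P Q W. tight E V d P Q W" by blast
    qed (rule dim)
  qed
qed

section \<open>Components, isomorphisms and the reduction operation\<close>

text \<open>The axioms of \<open>pair_graph\<close> as a plain predicate, which is easier to carry through the reduction steps.\<close>

definition simple_graph :: "'a pair_pre_digraph \<Rightarrow> bool" where
  "simple_graph G \<longleftrightarrow> finite (pverts G) \<and> parcs G \<subseteq> pverts G \<times> pverts G \<and> sym (parcs G) \<and> irrefl (parcs G)"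

lemma pair_graph_simple:
  assumes "pair_graph G"
  shows "simple_graph G"
proof -
  interpret pair_graph G by fact
  have "parcs G \<subseteq> pverts G \<times> pverts G" using wellformed' by auto
  moreover have "(x, x) \<notin> parcs G" for x using pair_no_loops[of "(x, x)"] by auto
  ultimately show ?thesis using pair_sym_arcs pair_finite_verts
    by (auto simp: simple_graph_def irrefl_def symmetric_def)
qed

lemma simple_pair_graph:
  assumes "simple_graph G"
  shows "pair_graph G"
proof -
  have "finite (parcs G)" using assms finite_subset by (auto simp: simple_graph_def)
  then show ?thesis using assms
    by unfold_locales (auto simp: simple_graph_def symmetric_def irrefl_def)
qed

lemma simple_graph_nbrs:
  assumes "simple_graph G"
  shows "nbrs G v \<subseteq> pverts G" "finite (nbrs G v)" "v \<notin> nbrs G v" "w \<in> nbrs G v \<longleftrightarrow> v \<in> nbrs G w"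
    "w \<in> nbrs G v \<Longrightarrow> v \<in> pverts G"
proof -
  show s: "nbrs G v \<subseteq> pverts G" using assms by (auto simp: simple_graph_def nbrs_def)
  then show "finite (nbrs G v)" using assms finite_subset by (auto simp: simple_graph_def)
  show "v \<notin> nbrs G v" using assms by (auto simp: simple_graph_def nbrs_def irrefl_def)
  show "w \<in> nbrs G v \<longleftrightarrow> v \<in> nbrs G w" using assms by (auto simp: simple_graph_def nbrs_def sym_def)
  show "w \<in> nbrs G v \<Longrightarrow> v \<in> pverts G" using assms by (auto simp: simple_graph_def nbrs_def)
qed

lemma digraph_iso_pairI:
  assumes "tail C = fst" "head C = snd" "arcs C \<subseteq> verts C \<times> verts C"
    and "inj_on f (verts C)" "f ` verts C = pverts K" "(\<lambda>(x, y). (f x, f y)) ` arcs C = parcs K"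
  shows "digraph_iso C (with_proj K)"
proof -
  let ?h = "\<lparr>iso_verts = f, iso_arcs = (\<lambda>(x, y). (f x, f y)), iso_head = snd, iso_tail = fst\<rparr>"
  have "wf_digraph C" using assms(1-3) by unfold_locales auto
  moreover have "inj_on (\<lambda>(x, y). (f x, f y)) (arcs C)"
    using inj_on_subset[OF map_prod_inj_on[OF assms(4,4)] assms(3)] by (simp add: map_prod_def)
  ultimately have "pre_digraph.digraph_isomorphism C ?h"
    using assms(1-4) by (auto simp: pre_digraph.digraph_isomorphism_def)
  moreover have "with_proj K = app_iso ?h C"
    using assms by (simp add: app_iso_def with_proj_def)
  ultimately show ?thesis unfolding digraph_iso_def by blast
qed

lemma digraph_iso_pairE:
  assumes iso: "digraph_iso C (with_proj K)" and C: "tail C = fst" "head C = snd" "arcs C \<subseteq> verts C \<times> verts C"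
  obtains f where "inj_on f (verts C)" "f ` verts C = pverts K"
    "\<And>x y. x \<in> verts C \<Longrightarrow> y \<in> verts C \<Longrightarrow> (x, y) \<in> arcs C \<longleftrightarrow> (f x, f y) \<in> parcs K"
proof -
  obtain h where h: "pre_digraph.digraph_isomorphism C h" "with_proj K = app_iso h C"
    using iso by (auto simp: digraph_iso_def)
  let ?f = "iso_verts h"
  have inj: "inj_on ?f (verts C)" using h(1) by (simp add: pre_digraph.digraph_isomorphism_def)
  have V: "?f ` verts C = pverts K" and A: "iso_arcs h ` arcs C = parcs K"
    and T: "iso_tail h = fst" and H: "iso_head h = snd"
    using h(2) by (simp_all add: app_iso_def with_proj_def)
  have arc: "iso_arcs h (x, y) = (?f x, ?f y)" if "(x, y) \<in> arcs C" for x y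
  proof -
    have "?f (tail C (x, y)) = iso_tail h (iso_arcs h (x, y))" "?f (head C (x, y)) = iso_head h (iso_arcs h (x, y))"
      using h(1) that by (auto simp: pre_digraph.digraph_isomorphism_def)
    then show ?thesis using C T H by (simp add: prod_eq_iff)
  qed
  have "(x, y) \<in> arcs C \<longleftrightarrow> (?f x, ?f y) \<in> parcs K" if xy: "x \<in> verts C" "y \<in> verts C" for x y
  proof
    assume "(x, y) \<in> arcs C"
    then have "iso_arcs h (x, y) \<in> parcs K" using A by blast
    then show "(?f x, ?f y) \<in> parcs K" using arc[OF \<open>(x, y) \<in> arcs C\<close>] by simp
  next
    assume "(?f x, ?f y) \<in> parcs K"
    then obtain a b where ab: "(a, b) \<in> arcs C" "iso_arcs h (a, b) = (?f x, ?f y)"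
      unfolding A[symmetric] by force
    then have "?f a = ?f x" "?f b = ?f y" using arc[OF ab(1)] by simp_all
    then have "a = x" "b = y" using inj xy C(3) ab(1) by (auto dest: inj_onD)
    then show "(x, y) \<in> arcs C" using ab by simp
  qed
  then show ?thesis by (rule that[OF inj V])
qed

text \<open>In a symmetric digraph a strongly connected component is closed under adjacency, and it is contained in every closed set that
it meets.\<close>

lemma scc_props:
  assumes H: "simple_graph H" and C: "C \<in> pre_digraph.sccs (with_proj H)"
  shows "verts C \<noteq> {}" "verts C \<subseteq> pverts H" "tail C = fst" "head C = snd"
    "arcs C = {(x, y). x \<in> verts C \<and> y \<in> verts C \<and> (x, y) \<in> parcs H}"
    and "x \<in> verts C \<Longrightarrow> (x, y) \<in> parcs H \<Longrightarrow> y \<in> verts C"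
    and "x \<in> verts C \<Longrightarrow> x \<in> T \<Longrightarrow> (\<And>u w. u \<in> T \<Longrightarrow> (u, w) \<in> parcs H \<Longrightarrow> w \<in> T) \<Longrightarrow> verts C \<subseteq> T"
proof -
  interpret pair_graph H using simple_pair_graph[OF H] .
  have ind: "induced_subgraph C (with_proj H)" using C in_sccsE by blast
  then have sg: "subgraph C (with_proj H)" and
    ar: "arcs C = {e \<in> parcs H. fst e \<in> verts C \<and> snd e \<in> verts C}"
    by (simp_all add: induced_subgraph_def)
  from sg show "verts C \<subseteq> pverts H" "tail C = fst" "head C = snd"
    by (simp_all add: subgraph_def compatible_def)
  show "arcs C = {(x, y). x \<in> verts C \<and> y \<in> verts C \<and> (x, y) \<in> parcs H}"
    unfolding ar by force
  have S: "verts C \<in> sccs_verts" using C by (intro in_sccs_vertsI_sccs) blast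
  then show "verts C \<noteq> {}" by (simp add: sccs_verts_def)
  show "y \<in> verts C" if "x \<in> verts C" "(x, y) \<in> parcs H"
  proof (rule ccontr)
    assume "y \<notin> verts C"
    moreover have "x \<rightarrow>\<^sup>*\<^bsub>with_proj H\<^esub> y" using that(2) by (intro reachable_adjI) simp
    moreover have "y \<rightarrow>\<^sup>*\<^bsub>with_proj H\<^esub> x" using that(2) H
      by (intro reachable_adjI) (auto simp: simple_graph_def dest: symD)
    ultimately show False using S that(1) by (auto simp: sccs_verts_def)
  qed
  show "verts C \<subseteq> T" if x: "x \<in> verts C" "x \<in> T" and T: "\<And>u w. u \<in> T \<Longrightarrow> (u, w) \<in> parcs H \<Longrightarrow> w \<in> T"
  proof
    fix y assume "y \<in> verts C"
    then have "x \<rightarrow>\<^sup>*\<^bsub>with_proj H\<^esub> y" using S x(1) by (auto simp: sccs_verts_def)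
    then have "(x, y) \<in> (parcs H)\<^sup>*" using reachable_rtranclI by fastforce
    then show "y \<in> T" by (induction rule: rtrancl_induct) (use x T in auto)
  qed
qed

lemma scc_exists:
  assumes H: "simple_graph H" and x: "x \<in> pverts H"
  shows "\<exists>C \<in> pre_digraph.sccs (with_proj H). x \<in> verts C"
proof -
  interpret pair_graph H using simple_pair_graph[OF H] .
  have "(with_proj H \<restriction> {v. x \<rightarrow>\<^sup>*\<^bsub>with_proj H\<^esub> v}) \<in> sccs"
    using x by (intro induce_reachable_is_in_sccs) simp
  moreover have "x \<in> verts (with_proj H \<restriction> {v. x \<rightarrow>\<^sup>*\<^bsub>with_proj H\<^esub> v})" using x by simp
  ultimately show ?thesis by blast
qed

text \<open>The vertices of a disjoint union of paths \<open>P\<^sub>6\<close> are the ends \<open>P\<close>, their neighbours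
\<open>Q\<close> and the middle vertices \<open>W\<close>. The conditions describe what remains of this pattern when
reductions are undone, which merges vertices of \<open>Q\<close> together with their pendant neighbours.\<close>

definition p6_structure :: "'a pair_pre_digraph \<Rightarrow> 'a set \<Rightarrow> 'a set \<Rightarrow> 'a set \<Rightarrow> bool" where
  "p6_structure G P Q W \<longleftrightarrow> P \<union> Q \<union> W = pverts G \<and> P \<inter> Q = {} \<and> P \<inter> W = {} \<and> Q \<inter> W = {} \<and>
     (\<forall>p\<in>P. \<exists>q\<in>Q. nbrs G p = {q}) \<and>
     (\<forall>q\<in>Q. \<exists>p\<in>P. \<exists>U\<subseteq>W. nbrs G q = insert p U) \<and>
     (\<forall>w\<in>W. \<exists>w'\<in>W. \<exists>q\<in>Q. nbrs G w = {w', q})"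

lemma p6_structureD:
  assumes "p6_structure G P Q W"
  shows "P \<union> Q \<union> W = pverts G" "P \<inter> Q = {}" "P \<inter> W = {}" "Q \<inter> W = {}"
    "p \<in> P \<Longrightarrow> \<exists>q\<in>Q. nbrs G p = {q}"
    "q \<in> Q \<Longrightarrow> \<exists>p\<in>P. \<exists>U\<subseteq>W. nbrs G q = insert p U"
    "w \<in> W \<Longrightarrow> \<exists>w'\<in>W. \<exists>q\<in>Q. nbrs G w = {w', q}"
  using assms unfolding p6_structure_def by simp_all

text \<open>Neighbourhoods in the reduction graph. Degrees of old vertices do not change: a neighbour \<open>w\<close> of
\<open>v\<close> trades \<open>v\<close> for \<open>a w\<close>.\<close>

lemma reduction_nbrs:
  assumes G: "simple_graph G" and R: "reduction_graph G u v H"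
  defines "N \<equiv> nbrs G v - {u}"
  obtains a b where "nbrs G u = {v}" "u \<in> nbrs G v" "u \<noteq> v" "simple_graph H"
    "pverts H = (pverts G - {u, v}) \<union> a ` N \<union> b ` N"
    "(a ` N \<union> b ` N) \<inter> pverts G = {}" "a ` N \<inter> b ` N = {}"
    "\<And>w. w \<in> N \<Longrightarrow> nbrs H (a w) = {w, b w}" "\<And>w. w \<in> N \<Longrightarrow> nbrs H (b w) = {a w}"
    "\<And>x. x \<in> pverts G \<Longrightarrow> x \<noteq> u \<Longrightarrow> x \<noteq> v \<Longrightarrow>
       nbrs H x = (if x \<in> N then insert (a x) (nbrs G x - {v}) else nbrs G x)"
proof -
  note n = simple_graph_nbrs[OF G]
  have fin: "finite (pverts G)" and sub: "parcs G \<subseteq> pverts G \<times> pverts G"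
    and sy: "\<And>x y. (x,y) \<in> parcs G \<Longrightarrow> (y,x) \<in> parcs G" and irr: "\<And>x. (x,x) \<notin> parcs G"
    using G by (auto simp: simple_graph_def sym_def irrefl_def)
  obtain a b where u: "u \<in> pendant_verts G" "(u, v) \<in> parcs G"
    and ab: "inj_on a N" "inj_on b N" "a ` N \<inter> b ` N = {}" "(a ` N \<union> b ` N) \<inter> pverts G = {}"
    and HV: "pverts H = (pverts G - {u, v}) \<union> a ` N \<union> b ` N"
    and HA: "parcs H = {(x, y) \<in> parcs G. x \<notin> {u, v} \<and> y \<notin> {u, v}}
          \<union> (\<Union>w\<in>N. {(w, a w), (a w, w), (a w, b w), (b w, a w)})"
  proof -
    from R have "u \<in> pendant_verts G \<and> (u, v) \<in> parcs G \<and>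
      (\<exists>a b. inj_on a N \<and> inj_on b N \<and> a ` N \<inter> b ` N = {} \<and> (a ` N \<union> b ` N) \<inter> pverts G = {} \<and>
        pverts H = (pverts G - {u, v}) \<union> a ` N \<union> b ` N \<and>
        parcs H = {(x, y) \<in> parcs G. x \<notin> {u, v} \<and> y \<notin> {u, v}}
          \<union> (\<Union>w\<in>N. {(w, a w), (a w, w), (a w, b w), (b w, a w)}))"
      unfolding reduction_graph_def Let_def N_def .
    then show ?thesis by (elim conjE exE) (rule that)
  qed
  have Nu: "nbrs G u = {v}"
  proof -
    have "card (nbrs G u) = 1" using u(1) by (simp add: pendant_verts_def deg_nbrs)
    moreover have "v \<in> nbrs G u" using u(2) by (simp add: nbrs_def)
    ultimately show ?thesis by (metis card_1_singletonE singletonD)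
  qed
  have uv: "u \<in> nbrs G v" "u \<noteq> v" using u(2) sy irr by (auto simp: nbrs_def)
  have NV: "w \<in> pverts G" "w \<noteq> u" "w \<noteq> v" "(w,v) \<in> parcs G" "(v,w) \<in> parcs G" if "w \<in> N" for w
    using that sub irr sy by (auto simp: N_def nbrs_def)
  have aN: "a w \<notin> pverts G" "b w \<notin> pverts G" if "w \<in> N" for w using ab(4) that by auto
  have neq: "a w \<noteq> b x" if "w \<in> N" "x \<in> N" for w x using ab(3) that by blast
  have ai: "a w = a x \<longleftrightarrow> w = x" if "w \<in> N" "x \<in> N" for w x using ab(1) that by (auto simp: inj_on_def)
  have bi: "b w = b x \<longleftrightarrow> w = x" if "w \<in> N" "x \<in> N" for w x using ab(2) that by (auto simp: inj_on_def)
  have uN: "(x,u) \<in> parcs G \<Longrightarrow> x = v" for x using Nu sy by (auto simp: nbrs_def)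
  have na: "nbrs H (a w) = {w, b w}" if "w \<in> N" for w
  proof -
    have "(a w, x) \<notin> parcs G" for x using aN(1)[OF that] sub by auto
    moreover have "a w \<noteq> x" "x \<noteq> a w" if "x \<in> N" for x using aN(1)[OF \<open>w \<in> N\<close>] NV(1)[OF that] by auto
    ultimately show ?thesis using that neq[OF that] neq ai[OF that] ai by (auto simp: HA nbrs_def)
  qed
  have nb: "nbrs H (b w) = {a w}" if "w \<in> N" for w
  proof -
    have "(b w, x) \<notin> parcs G" for x using aN(2)[OF that] sub by auto
    moreover have "b w \<noteq> x" "x \<noteq> b w" if "x \<in> N" for x using aN(2)[OF \<open>w \<in> N\<close>] NV(1)[OF that] by auto
    moreover have "b w \<noteq> a x" "a x \<noteq> b w" if "x \<in> N" for x using neq[OF that \<open>w \<in> N\<close>] by auto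
    ultimately show ?thesis using that bi[OF that] by (auto simp: HA nbrs_def)
  qed
  have nold: "nbrs H x = (if x \<in> N then insert (a x) (nbrs G x - {v}) else nbrs G x)"
    if "x \<in> pverts G" "x \<noteq> u" "x \<noteq> v" for x
  proof -
    have "(x,v) \<in> parcs G \<Longrightarrow> x \<in> N" using sy that by (auto simp: N_def nbrs_def)
    moreover have "a w \<noteq> x" "b w \<noteq> x" "x \<noteq> a w" "x \<noteq> b w" if "w \<in> N" for w
      using aN[OF that] \<open>x \<in> pverts G\<close> by auto
    moreover have "(x, u) \<notin> parcs G" using uN that by auto
    moreover have "(x, v) \<in> parcs G" if "x \<in> N" using NV that by auto
    ultimately show ?thesis using that by (auto simp: HA nbrs_def)
  qed
  have "simple_graph H"
  proof -
    have "finite N" using n(2)[of v] by (simp add: N_def)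
    then have "finite (pverts H)" using fin by (simp add: HV)
    moreover have "parcs H \<subseteq> pverts H \<times> pverts H"
      using sub NV(1-3) unfolding HA HV by auto
    moreover have "sym (parcs H)" using sy by (auto simp: HA intro!: symI)
    moreover have "irrefl (parcs H)"
    proof -
      have "a w \<noteq> w" "w \<noteq> a w" "a w \<noteq> b w" "b w \<noteq> a w" if "w \<in> N" for w
        using aN[OF that] NV(1)[OF that] neq[OF that that] by auto
      then show ?thesis using irr by (auto simp: HA irrefl_def)
    qed
    ultimately show ?thesis by (simp add: simple_graph_def)
  qed
  from that[OF Nu uv this HV ab(4,3) na nb nold] show ?thesis .
qed

text \<open>Each \<open>w\<close> that loses its neighbour \<open>v\<close> in \<open>Q\<close> receives the new quasi-pendant vertex
\<open>a w\<close> instead, with pendant vertex \<open>b w\<close>. The degree condition excludes that \<open>v\<close> is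
itself the pendant vertex of \<open>u\<close>.\<close>

lemma p6_structure_reduction:
  assumes G: "simple_graph G" and R: "reduction_graph G u v H" and dv: "2 < card (nbrs G v)"
    and S: "p6_structure G P Q W"
  shows "\<exists>P Q W. p6_structure H P Q W"
proof -
  define N where "N = nbrs G v - {u}"
  note n = simple_graph_nbrs[OF G]
  from reduction_nbrs[OF G R, folded N_def] obtain a b where
    Nu: "nbrs G u = {v}" and uv: "u \<in> nbrs G v" "u \<noteq> v" and "simple_graph H" and
    HV: "pverts H = (pverts G - {u, v}) \<union> a ` N \<union> b ` N" and
    new: "(a ` N \<union> b ` N) \<inter> pverts G = {}" and ab: "a ` N \<inter> b ` N = {}" and
    na: "\<And>w. w \<in> N \<Longrightarrow> nbrs H (a w) = {w, b w}" and nb: "\<And>w. w \<in> N \<Longrightarrow> nbrs H (b w) = {a w}" and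
    nold: "\<And>x. x \<in> pverts G \<Longrightarrow> x \<noteq> u \<Longrightarrow> x \<noteq> v \<Longrightarrow>
       nbrs H x = (if x \<in> N then insert (a x) (nbrs G x - {v}) else nbrs G x)" by metis
  note D = p6_structureD[OF S]
  have uV: "u \<in> pverts G" "v \<in> pverts G" using n(1)[of v] n(1)[of u] Nu uv by auto
  have uP: "u \<in> P"
  proof (rule ccontr)
    assume "u \<notin> P"
    then consider "u \<in> Q" | "u \<in> W" using D(1) uV by blast
    then show False
    proof cases
      case 1
      then obtain p U where "p \<in> P" "nbrs G u = insert p U" using D(6) by blast
      then have "v \<in> P" using Nu by auto
      then obtain q where "nbrs G v = {q}" using D(5) by blast
      then show False using dv by simp
    next
      case 2
      then obtain w' q where "w' \<in> W" "q \<in> Q" "nbrs G u = {w', q}" using D(7) by blast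
      then show False using Nu D(4) by auto
    qed
  qed
  have vQ: "v \<in> Q" using D(5)[OF uP] Nu by auto
  obtain p U where pU: "p \<in> P" "U \<subseteq> W" "nbrs G v = insert p U" using D(6)[OF vQ] by blast
  have "u \<notin> U" using pU(2) uP D(3) by blast
  then have up: "u = p" using uv(1) pU(3) by blast
  have NU: "N = U" using up pU \<open>u \<notin> U\<close> by (auto simp: N_def)
  have NW: "N \<subseteq> W" using NU pU by simp
  have old: "P \<subseteq> pverts G" "Q \<subseteq> pverts G" "W \<subseteq> pverts G" using D(1) by auto
  have vN: "v \<in> nbrs G x \<longleftrightarrow> x \<in> N" if "x \<noteq> u" for x using n(4)[of v x] that by (auto simp: N_def)
  have uNx: "u \<in> nbrs G x \<longleftrightarrow> x = v" for x using n(4)[of u x] Nu by auto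
  have "p6_structure H ((P - {u}) \<union> b ` N) ((Q - {v}) \<union> a ` N) W"
    unfolding p6_structure_def
  proof (intro conjI ballI)
    have "u \<notin> Q" "u \<notin> W" "v \<notin> P" "v \<notin> W" using D(2-4) uP vQ by auto
    then have "pverts G - {u, v} = (P - {u}) \<union> (Q - {v}) \<union> W"
      unfolding D(1)[symmetric] by auto
    then show "P - {u} \<union> b ` N \<union> (Q - {v} \<union> a ` N) \<union> W = pverts H"
      unfolding HV by auto
    have fresh: "b x \<notin> P" "b x \<notin> Q" "b x \<notin> W" "a x \<notin> P" "a x \<notin> Q" "a x \<notin> W" if "x \<in> N" for x
    proof -
      have "a x \<notin> pverts G" "b x \<notin> pverts G" using new that by auto
      then show "b x \<notin> P" "b x \<notin> Q" "b x \<notin> W" "a x \<notin> P" "a x \<notin> Q" "a x \<notin> W" using old by auto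
    qed
    show "(P - {u} \<union> b ` N) \<inter> (Q - {v} \<union> a ` N) = {}" using D(2) ab fresh by auto
    show "(P - {u} \<union> b ` N) \<inter> W = {}" using D(3) fresh by auto
    show "(Q - {v} \<union> a ` N) \<inter> W = {}" using D(4) fresh by auto
  next
    fix p assume "p \<in> P - {u} \<union> b ` N"
    then show "\<exists>q\<in>Q - {v} \<union> a ` N. nbrs H p = {q}"
    proof
      assume p: "p \<in> P - {u}"
      then obtain q where q: "q \<in> Q" "nbrs G p = {q}" using D(5) by blast
      have "p \<notin> N" using p NW D(3) by blast
      moreover have "p \<noteq> v" using p vQ D(2) by blast
      ultimately have "nbrs H p = {q}" using nold[of p] p old q by auto
      moreover have "q \<noteq> v" using \<open>p \<notin> N\<close> vN[of p] p q by auto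
      ultimately show ?thesis using q by blast
    next
      assume "p \<in> b ` N" then show ?thesis using nb by blast
    qed
  next
    fix q assume "q \<in> Q - {v} \<union> a ` N"
    then show "\<exists>p\<in>P - {u} \<union> b ` N. \<exists>U\<subseteq>W. nbrs H q = insert p U"
    proof
      assume q: "q \<in> Q - {v}"
      then obtain p U where p: "p \<in> P" "U \<subseteq> W" "nbrs G q = insert p U" using D(6) by blast
      have "q \<notin> N" using q NW D(4) by blast
      moreover have "q \<noteq> u" using q uP D(2) by blast
      ultimately have "nbrs H q = insert p U" using nold[of q] q old p by auto
      moreover have "p \<noteq> u" using uNx[of q] q p by auto
      ultimately show ?thesis using p by blast
    next
      assume "q \<in> a ` N"
      then obtain w where w: "w \<in> N" "q = a w" by blast
      then have "nbrs H q = insert (b w) {w}" using na by auto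
      then show ?thesis using w NW by blast
    qed
  next
    fix w assume w: "w \<in> W"
    obtain w' q where wq: "w' \<in> W" "q \<in> Q" "nbrs G w = {w', q}" using D(7)[OF w] by blast
    have wu: "w \<noteq> u" "w \<noteq> v" "w \<in> pverts G" using w uP vQ D(3,4) old by auto
    show "\<exists>w'\<in>W. \<exists>q\<in>Q - {v} \<union> a ` N. nbrs H w = {w', q}"
    proof (cases "w \<in> N")
      case True
      then have "v = q" using vN[of w] wu wq vQ D(4) by auto
      then have "nbrs H w = {w', a w}" using nold[of w] wu True wq vQ D(4) by auto
      then show ?thesis using wq True by blast
    next
      case False
      then have "q \<noteq> v" using vN[of w] wu wq by auto
      moreover have "nbrs H w = {w', q}" using nold[of w] wu False wq by auto
      ultimately show ?thesis using wq by blast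
    qed
  qed
  then show ?thesis by blast
qed

text \<open>The new vertices must belong to \<open>P\<close> and \<open>Q\<close>: as \<open>b w\<close> has a single neighbour, it is in
\<open>P\<close>, so \<open>a w\<close> is in \<open>Q\<close> and \<open>w\<close> in \<open>W\<close>. Hence all former
neighbours of \<open>v\<close> other than \<open>u\<close> are in \<open>W\<close>, and \<open>u\<close>, \<open>v\<close>
can be put back.\<close>

lemma p6_structure_unreduction:
  assumes G: "simple_graph G" and R: "reduction_graph G u v H" and S: "p6_structure H P Q W"
  shows "\<exists>P Q W. p6_structure G P Q W"
proof -
  define N where "N = nbrs G v - {u}"
  note n = simple_graph_nbrs[OF G]
  from reduction_nbrs[OF G R, folded N_def] obtain a b where
    Nu: "nbrs G u = {v}" and uv: "u \<in> nbrs G v" "u \<noteq> v" and H: "simple_graph H" and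
    HV: "pverts H = (pverts G - {u, v}) \<union> a ` N \<union> b ` N" and
    new: "(a ` N \<union> b ` N) \<inter> pverts G = {}" and ab: "a ` N \<inter> b ` N = {}" and
    na: "\<And>w. w \<in> N \<Longrightarrow> nbrs H (a w) = {w, b w}" and nb: "\<And>w. w \<in> N \<Longrightarrow> nbrs H (b w) = {a w}" and
    nold: "\<And>x. x \<in> pverts G \<Longrightarrow> x \<noteq> u \<Longrightarrow> x \<noteq> v \<Longrightarrow>
       nbrs H x = (if x \<in> N then insert (a x) (nbrs G x - {v}) else nbrs G x)" by metis
  note D = p6_structureD[OF S]
  note nH = simple_graph_nbrs[OF H]
  have uV: "u \<in> pverts G" "v \<in> pverts G" using n(1)[of v] n(1)[of u] Nu uv by auto
  have NV: "w \<in> pverts G" "w \<noteq> u" "w \<noteq> v" if "w \<in> N" for w using that n(1)[of v] n(3)[of v] by (auto simp: N_def)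
  have vN: "v \<in> nbrs G x \<longleftrightarrow> x \<in> N" if "x \<noteq> u" for x using n(4)[of v x] that by (auto simp: N_def)
  have uNx: "u \<in> nbrs G x \<longleftrightarrow> x = v" for x using n(4)[of u x] Nu by auto
  define old where "old = pverts G - {u, v}"
  have bP: "b w \<in> P" if w: "w \<in> N" for w
  proof (rule ccontr)
    assume "b w \<notin> P"
    moreover have "b w \<in> pverts H" using w HV by blast
    ultimately consider "b w \<in> Q" | "b w \<in> W" using D(1) by blast
    then show False
    proof cases
      case 1
      then obtain p U where "p \<in> P" "nbrs H (b w) = insert p U" using D(6) by blast
      then have "a w \<in> P" using nb[OF w] by auto
      then obtain q where "nbrs H (a w) = {q}" using D(5) by blast
      then have "w = b w" using na[OF w] by auto
      then show False using new NV(1)[OF w] w by auto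
    next
      case 2
      then obtain w' q where "w' \<in> W" "q \<in> Q" "nbrs H (b w) = {w', q}" using D(7) by blast
      then show False using nb[OF w] D(4) by auto
    qed
  qed
  have aQ: "a w \<in> Q" if w: "w \<in> N" for w using D(5)[OF bP[OF w]] nb[OF w] by auto
  have NW: "w \<in> W" if w: "w \<in> N" for w
  proof -
    obtain p U where p: "p \<in> P" "U \<subseteq> W" "nbrs H (a w) = insert p U" using D(6)[OF aQ[OF w]] by blast
    have wb: "w \<noteq> b w" using new NV(1)[OF w] w by auto
    have "b w \<notin> U" using bP[OF w] p(2) D(3) by blast
    moreover have "b w \<in> insert p U" unfolding p(3)[symmetric] na[OF w] by simp
    ultimately have "p = b w" by simp
    moreover have "w \<in> insert p U" unfolding p(3)[symmetric] na[OF w] by simp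
    ultimately show ?thesis using p(2) wb by auto
  qed
  have oldH: "old = pverts G \<inter> pverts H" using HV new by (auto simp: old_def)
  have newPQ: "x \<in> old" if "x \<in> W" for x
  proof -
    have "x \<in> pverts H" using that D(1) by blast
    moreover have "x \<notin> a ` N" "x \<notin> b ` N" using that aQ bP D(3,4) by blast+
    ultimately show ?thesis using HV by (auto simp: old_def)
  qed
  have "p6_structure G (insert u (P \<inter> old)) (insert v (Q \<inter> old)) W"
    unfolding p6_structure_def
  proof (intro conjI ballI)
    have "P \<inter> old \<union> (Q \<inter> old) \<union> W = old" using D(1) newPQ oldH by blast
    then show "insert u (P \<inter> old) \<union> insert v (Q \<inter> old) \<union> W = pverts G"
      using uV by (auto simp: old_def)
    show "insert u (P \<inter> old) \<inter> insert v (Q \<inter> old) = {}" using D(2) uv(2) by (auto simp: old_def)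
    show "insert u (P \<inter> old) \<inter> W = {}" using D(3) newPQ by (auto simp: old_def)
    show "insert v (Q \<inter> old) \<inter> W = {}" using D(4) newPQ by (auto simp: old_def)
  next
    fix p assume "p \<in> insert u (P \<inter> old)"
    then show "\<exists>q\<in>insert v (Q \<inter> old). nbrs G p = {q}"
    proof
      assume p: "p \<in> P \<inter> old"
      then obtain q where q: "q \<in> Q" "nbrs H p = {q}" using D(5) by blast
      have "p \<notin> N" using p NW D(3) by blast
      then have eq: "nbrs G p = {q}" using nold[of p] p q by (auto simp: old_def)
      then have "q \<in> old" using n(1)[of p] q D(1) oldH by auto
      then show ?thesis using eq q by blast
    qed (use Nu in auto)
  next
    fix q assume "q \<in> insert v (Q \<inter> old)"
    then show "\<exists>p\<in>insert u (P \<inter> old). \<exists>U\<subseteq>W. nbrs G q = insert p U"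
    proof
      assume "q = v"
      moreover have "nbrs G v = insert u N" using uv by (auto simp: N_def)
      moreover have "N \<subseteq> W" using NW by blast
      ultimately show ?thesis by blast
    next
      assume q: "q \<in> Q \<inter> old"
      then obtain p U where p: "p \<in> P" "U \<subseteq> W" "nbrs H q = insert p U" using D(6) by blast
      have "q \<notin> N" using q NW D(4) by blast
      then have eq: "nbrs G q = insert p U" using nold[of q] q p by (auto simp: old_def)
      then have "p \<in> old" using n(1)[of q] p D(1) oldH by auto
      then show ?thesis using eq p by blast
    qed
  next
    fix w assume w: "w \<in> W"
    obtain w' q where wq: "w' \<in> W" "q \<in> Q" "nbrs H w = {w', q}" using D(7)[OF w] by blast
    have wo: "w \<in> pverts G" "w \<noteq> u" "w \<noteq> v" using newPQ[OF w] by (auto simp: old_def)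
    show "\<exists>w'\<in>W. \<exists>q\<in>insert v (Q \<inter> old). nbrs G w = {w', q}"
    proof (cases "w \<in> N")
      case True
      have eq: "insert (a w) (nbrs G w - {v}) = {w', q}" using nold[OF wo] True wq(3) by simp
      have "a w \<notin> W" using aQ[OF True] D(4) by blast
      then have aq: "a w = q" using eq wq(1) by auto
      have "a w \<notin> nbrs G w" using n(1)[of w] new True by blast
      then have "nbrs G w - {v} = insert (a w) (nbrs G w - {v}) - {a w}" by auto
      also have "\<dots> = {w', q} - {a w}" unfolding eq ..
      also have "\<dots> = {w'}" using aq wq(1) \<open>a w \<notin> W\<close> by auto
      finally have "nbrs G w - {v} = {w'}" .
      then have "nbrs G w = {w', v}" using vN[of w] wo True by auto
      then show ?thesis using wq(1) by blast
    next
      case False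
      then have eq: "nbrs G w = {w', q}" using nold[OF wo] wq by simp
      then have "q \<in> old" using n(1)[of w] wq D(1) oldH by auto
      then show ?thesis using eq wq by blast
    qed
  qed
  then show ?thesis by blast
qed

lemma reductions_simple_p6:
  assumes "reduction_step\<^sup>*\<^sup>* G H" "simple_graph G"
  shows "simple_graph H \<and> ((\<exists>P Q W. p6_structure G P Q W) \<longleftrightarrow> (\<exists>P Q W. p6_structure H P Q W))"
  using assms
proof (induction rule: rtranclp_induct)
  case (step H K)
  then have H: "simple_graph H" and iff: "(\<exists>P Q W. p6_structure G P Q W) \<longleftrightarrow> (\<exists>P Q W. p6_structure H P Q W)"
    by auto
  obtain u v where uv: "2 < deg H v" "reduction_graph H u v K" using step(2) unfolding reduction_step_def by blast
  have dv: "2 < card (nbrs H v)" using uv(1) by (simp add: deg_nbrs)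
  have "simple_graph K" using reduction_nbrs[OF H uv(2)] by metis
  moreover have "(\<exists>P Q W. p6_structure H P Q W) \<longleftrightarrow> (\<exists>P Q W. p6_structure K P Q W)"
    using p6_structure_reduction[OF H uv(2) dv] p6_structure_unreduction[OF H uv(2)] by (metis (no_types))
  ultimately show ?case using iff by simp
qed simp

lemma nbrs_embed: "nbrs (embed G) (Inl v) = Inl ` nbrs G v"
  by (auto simp: nbrs_def embed_def)

lemma simple_graph_embed:
  assumes "simple_graph G"
  shows "simple_graph (embed G)"
proof -
  have "finite (pverts (embed G))" using assms by (simp add: simple_graph_def embed_def)
  moreover have "parcs (embed G) \<subseteq> pverts (embed G) \<times> pverts (embed G)"
    using assms by (auto simp: simple_graph_def embed_def)
  moreover have "sym (parcs (embed G))" using assms by (auto simp: simple_graph_def embed_def sym_def)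
  moreover have "irrefl (parcs (embed G))" using assms by (auto simp: simple_graph_def embed_def irrefl_def)
  ultimately show ?thesis by (simp add: simple_graph_def)
qed

lemma p6_structure_embed:
  fixes G :: "'a pair_pre_digraph"
  shows "(\<exists>P Q W. p6_structure (embed G) P Q W) \<longleftrightarrow> (\<exists>P Q W. p6_structure G P Q W)"
proof
  assume "\<exists>P Q W. p6_structure G P Q W"
  then obtain P Q W where S: "p6_structure G P Q W" by blast
  note D = p6_structureD[OF S]
  let ?e = "Inl :: 'a \<Rightarrow> 'a + nat"
  have "p6_structure (embed G) (?e ` P) (?e ` Q) (?e ` W)"
    unfolding p6_structure_def
  proof (intro conjI)
    show "?e ` P \<union> ?e ` Q \<union> ?e ` W = pverts (embed G)"
      unfolding embed_def using D(1) by auto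
    show "?e ` P \<inter> ?e ` Q = {}" "?e ` P \<inter> ?e ` W = {}" "?e ` Q \<inter> ?e ` W = {}" using D(2-4) by auto
    show "\<forall>p\<in>?e ` P. \<exists>q\<in>?e ` Q. nbrs (embed G) p = {q}"
    proof
      fix x :: "'a + nat" assume "x \<in> ?e ` P"
      then obtain p where p: "p \<in> P" "x = Inl p" by blast
      obtain q where "q \<in> Q" "nbrs G p = {q}" using D(5)[OF p(1)] by blast
      then show "\<exists>q\<in>?e ` Q. nbrs (embed G) x = {q}" unfolding p(2) nbrs_embed by auto
    qed
    show "\<forall>q\<in>?e ` Q. \<exists>p\<in>?e ` P. \<exists>U\<subseteq>?e ` W. nbrs (embed G) q = insert p U"
    proof
      fix x :: "'a + nat" assume "x \<in> ?e ` Q"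
      then obtain q where q: "q \<in> Q" "x = Inl q" by blast
      obtain p U where "p \<in> P" "U \<subseteq> W" "nbrs G q = insert p U" using D(6)[OF q(1)] by blast
      then show "\<exists>p\<in>?e ` P. \<exists>U\<subseteq>?e ` W. nbrs (embed G) x = insert p U"
        unfolding q(2) nbrs_embed by (intro bexI[of _ "Inl p"] exI[of _ "?e ` U"]) auto
    qed
    show "\<forall>w\<in>?e ` W. \<exists>w'\<in>?e ` W. \<exists>q\<in>?e ` Q. nbrs (embed G) w = {w', q}"
    proof
      fix x :: "'a + nat" assume "x \<in> ?e ` W"
      then obtain w where w: "w \<in> W" "x = Inl w" by blast
      obtain w' q where "w' \<in> W" "q \<in> Q" "nbrs G w = {w', q}" using D(7)[OF w(1)] by blast
      then show "\<exists>w'\<in>?e ` W. \<exists>q\<in>?e ` Q. nbrs (embed G) x = {w', q}"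
        unfolding w(2) nbrs_embed by auto
    qed
  qed
  then show "\<exists>P Q W. p6_structure (embed G) P Q W" by blast
next
  assume "\<exists>P Q W. p6_structure (embed G) P Q W"
  then obtain P Q W where S: "p6_structure (embed G) P Q W" by blast
  note D = p6_structureD[OF S]
  let ?e = "Inl :: 'a \<Rightarrow> 'a + nat"
  have V: "pverts (embed G) = ?e ` pverts G" by (simp add: embed_def)
  let ?i = "\<lambda>X. {v. Inl v \<in> X}"
  have un: "P \<subseteq> ?e ` pverts G" "Q \<subseteq> ?e ` pverts G" "W \<subseteq> ?e ` pverts G" using D(1) V by auto
  have "p6_structure G (?i P) (?i Q) (?i W)"
    unfolding p6_structure_def
  proof (intro conjI)
    have "?e ` (?i P \<union> ?i Q \<union> ?i W) = P \<union> Q \<union> W" using un by auto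
    then have "?e ` (?i P \<union> ?i Q \<union> ?i W) = ?e ` pverts G" using D(1) V by simp
    then show "?i P \<union> ?i Q \<union> ?i W = pverts G" by (simp add: inj_image_eq_iff[OF inj_Inl])
    show "?i P \<inter> ?i Q = {}" "?i P \<inter> ?i W = {}" "?i Q \<inter> ?i W = {}" using D(2-4) by auto
    show "\<forall>p\<in>?i P. \<exists>q\<in>?i Q. nbrs G p = {q}"
    proof
      fix p assume "p \<in> ?i P"
      then obtain y where y: "y \<in> Q" "Inl ` nbrs G p = {y}" using D(5)[of "Inl p"] nbrs_embed[of G p] by auto
      then obtain q where q: "y = Inl q" using un by blast
      then have "?e ` nbrs G p = ?e ` {q}" using y(2) by simp
      then have "nbrs G p = {q}" by (simp only: inj_image_eq_iff[OF inj_Inl])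
      then show "\<exists>q\<in>?i Q. nbrs G p = {q}" using y q by blast
    qed
    show "\<forall>q\<in>?i Q. \<exists>p\<in>?i P. \<exists>U\<subseteq>?i W. nbrs G q = insert p U"
    proof
      fix q assume "q \<in> ?i Q"
      then obtain y X where y: "y \<in> P" "X \<subseteq> W" "Inl ` nbrs G q = insert y X"
        using D(6)[of "Inl q"] nbrs_embed[of G q] by auto
      then obtain p where p: "y = Inl p" using un by blast
      have "X \<subseteq> range ?e" using y(3) by blast
      then have "?e ` ?i X = X" by auto
      then have "?e ` nbrs G q = ?e ` (insert p (?i X))" using y(3) p by simp
      then have "nbrs G q = insert p (?i X)" by (simp only: inj_image_eq_iff[OF inj_Inl])
      then show "\<exists>p\<in>?i P. \<exists>U\<subseteq>?i W. nbrs G q = insert p U"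
        using y p by (intro bexI[of _ p] exI[of _ "?i X"]) auto
    qed
    show "\<forall>w\<in>?i W. \<exists>w'\<in>?i W. \<exists>q\<in>?i Q. nbrs G w = {w', q}"
    proof
      fix w assume "w \<in> ?i W"
      then obtain x y where y: "x \<in> W" "y \<in> Q" "Inl ` nbrs G w = {x, y}"
        using D(7)[of "Inl w"] nbrs_embed[of G w] by auto
      obtain w' q where wq: "x = Inl w'" "y = Inl q" using y un by blast
      then have "?e ` nbrs G w = ?e ` {w', q}" using y(3) by simp
      then have "nbrs G w = {w', q}" by (simp only: inj_image_eq_iff[OF inj_Inl])
      then show "\<exists>w'\<in>?i W. \<exists>q\<in>?i Q. nbrs G w = {w', q}" using y wq by blast
    qed
  qed
  then show "\<exists>P Q W. p6_structure G P Q W" by blast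
qed

definition six_path :: "'a pair_pre_digraph \<Rightarrow> 'a \<Rightarrow> 'a \<Rightarrow> 'a \<Rightarrow> 'a \<Rightarrow> 'a \<Rightarrow> 'a \<Rightarrow> bool" where
  "six_path H p q w w' q' p' \<longleftrightarrow> distinct [p, q, w, w', q', p'] \<and> nbrs H p = {q} \<and> nbrs H q = {p, w} \<and>
     nbrs H w = {w', q} \<and> nbrs H w' = {w, q'} \<and> nbrs H q' = {p', w'} \<and> nbrs H p' = {q'}"

lemma six_path_rev: "six_path H p q w w' q' p' \<Longrightarrow> six_path H p' q' w' w q p"
  unfolding six_path_def by auto

text \<open>When a quasi-pendant vertex has degree \<open>2\<close>, its only neighbour besides the pendant one is a single vertex of
\<open>W\<close>, so the path cannot branch.\<close>

lemma p6_final_six_path: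
  assumes H: "simple_graph H" and S: "p6_structure H P Q W" and w: "w \<in> W"
    and fin: "\<forall>v \<in> quasi_pendant_verts H. deg H v = 2"
  shows "\<exists>p q w' q' p'. six_path H p q w w' q' p'"
proof -
  note n = simple_graph_nbrs[OF H]
  note D = p6_structureD[OF S]
  have quasi: "\<exists>p\<in>P. nbrs H q = {p, w} \<and> nbrs H p = {q}" if q: "q \<in> Q" "w \<in> W" "w \<in> nbrs H q" for q w
  proof -
    obtain p U where p: "p \<in> P" "U \<subseteq> W" "nbrs H q = insert p U" using D(6)[OF q(1)] by blast
    obtain q1 where "nbrs H p = {q1}" using D(5)[OF p(1)] by blast
    moreover have "q \<in> nbrs H p" using n(4)[of q p] p(3) by simp
    ultimately have Np: "nbrs H p = {q}" by simp
    have "p \<in> pverts H" "q \<in> pverts H" using p(1) q(1) D(1) by auto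
    then have "q \<in> quasi_pendant_verts H" using Np p(3)
      by (auto simp: quasi_pendant_verts_def pendant_verts_def deg_nbrs nbrs_def)
    then have c: "card (nbrs H q) = 2" using fin by (simp add: deg_nbrs)
    have "p \<noteq> w" using p(1) q(2) D(3) by blast
    then have "{p, w} = nbrs H q"
      by (intro card_seteq) (use n(2)[of q] p(3) q(3) c in auto)
    then show ?thesis using p(1) Np by blast
  qed
  obtain w' q where wq: "w' \<in> W" "q \<in> Q" "nbrs H w = {w', q}" using D(7)[OF w] by blast
  obtain w2 q' where wq': "w2 \<in> W" "q' \<in> Q" "nbrs H w' = {w2, q'}" using D(7)[OF wq(1)] by blast
  have "w \<in> nbrs H w'" using n(4)[of w w'] wq(3) by simp
  then have w2: "w2 = w" using wq' w D(4) by auto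
  have "w \<in> nbrs H q" "w' \<in> nbrs H q'" using n(4)[of w q] n(4)[of w' q'] wq(3) wq'(3) by simp_all
  then obtain p p' where p: "p \<in> P" "nbrs H q = {p, w}" "nbrs H p = {q}"
    and p': "p' \<in> P" "nbrs H q' = {p', w'}" "nbrs H p' = {q'}"
    using quasi[OF wq(2) w] quasi[OF wq'(2) wq(1)] by blast
  have ww: "w \<noteq> w'" using n(3)[of w] wq(3) by auto
  have qq: "q \<noteq> q'"
  proof
    assume "q = q'"
    then have "w' \<in> {p, w}" using p(2) p'(2) by auto
    then show False using ww wq(1) p(1) D(3) by auto
  qed
  have pp: "p \<noteq> p'" using p(3) p'(3) qq by auto
  have "distinct [p, q, w, w', q', p']"
    using ww qq pp w wq(1,2) wq'(2) p(1) p'(1) D(2-4) by auto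
  then show ?thesis unfolding six_path_def using p p' wq(3) wq'(3) w2 by blast
qed

lemma path_graph_6: "parcs (path_graph 6) = {(5,4),(4,5),(4,3),(3,2),(3,4),(2,3),(2,1),(1,0),(1,2),(0,1)}"
proof -
  have "parcs (path_graph 6) = Set.filter (\<lambda>(i,j). j = i + 1 \<or> i = j + 1) (set [0..<6] \<times> set [0..<6])"
    unfolding path_graph_def by (simp add: set_eq_iff)
  also have "\<dots> = {(5,4),(4,5),(4,3),(3,2),(3,4),(2,3),(2,1),(1,0),(1,2),(0,1)::nat \<times> nat}" by code_simp
  finally show ?thesis .
qed

lemma six_path_component_iso:
  assumes H: "simple_graph H" and C: "C \<in> pre_digraph.sccs (with_proj H)" and w: "w \<in> verts C"
    and six: "six_path H p q w w' q' p'"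
  shows "digraph_iso C (with_proj (path_graph 6))"
proof -
  note c = scc_props[OF H C]
  have dist: "distinct [p, q, w, w', q', p']" and N: "nbrs H p = {q}" "nbrs H q = {p, w}" "nbrs H w = {w', q}"
    "nbrs H w' = {w, q'}" "nbrs H q' = {p', w'}" "nbrs H p' = {q'}" using six by (auto simp: six_path_def)
  have arc: "(x, y) \<in> parcs H \<longleftrightarrow> y \<in> nbrs H x" for x y by (simp add: nbrs_def)
  define T where "T = {p, q, w, w', q', p'}"
  have "verts C \<subseteq> T"
    by (rule c(7)[OF w]) (use N in \<open>auto simp: T_def arc\<close>)
  moreover have "T \<subseteq> verts C"
  proof -
    note st = c(6)[unfolded arc]
    have "w' \<in> verts C" "q \<in> verts C" using st[OF w] N by simp_all
    moreover from this have "q' \<in> verts C" "p \<in> verts C" using st[of w' q'] st[of q p] N by simp_all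
    moreover from this have "p' \<in> verts C" using st[of q' p'] N by simp
    ultimately show ?thesis using w by (simp add: T_def)
  qed
  ultimately have VT: "verts C = T" by blast
  define f where "f = (\<lambda>x. if x = p then 0 else if x = q then 1 else if x = w then 2 else
    if x = w' then 3 else if x = q' then 4 else (5::nat))"
  have fv: "f p = 0" "f q = 1" "f w = 2" "f w' = 3" "f q' = 4" "f p' = 5" using dist by (auto simp: f_def)
  have arcs: "arcs C = {(p',q'),(q',p'),(q',w'),(w',w),(w',q'),(w,w'),(w,q),(q,p),(q,w),(p,q)}"
  proof -
    have "y \<in> T" if "x \<in> T" "y \<in> nbrs H x" for x y
      using c(6)[of x y] that unfolding VT arc .
    then have "arcs C = (\<Union>x\<in>T. Pair x ` nbrs H x)" unfolding c(5) VT arc by auto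
    then show ?thesis by (simp add: T_def N)
  qed
  show ?thesis
  proof (rule digraph_iso_pairI[OF c(3,4)])
    show "arcs C \<subseteq> verts C \<times> verts C" unfolding c(5) by blast
    show "inj_on f (verts C)" unfolding VT T_def using fv by (auto simp: inj_on_def)
    show "f ` verts C = pverts (path_graph 6)" unfolding VT T_def using fv by (auto simp: path_graph_def)
    show "(\<lambda>(x, y). (f x, f y)) ` arcs C = parcs (path_graph 6)"
      unfolding arcs path_graph_6 using fv by simp
  qed
qed

text \<open>An isomorphism with a graph on the vertices \<open>0, \<dots>, k - 1\<close>, read as an enumeration of the vertices.\<close>

lemma digraph_iso_nat:
  assumes iso: "digraph_iso C (with_proj K)" and K: "pverts K = {..<k}"
    and C: "tail C = fst" "head C = snd" "arcs C \<subseteq> verts C \<times> verts C"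
  obtains g where "bij_betw g {..<k} (verts C)"
    "\<And>i j. i < k \<Longrightarrow> j < k \<Longrightarrow> (g i, g j) \<in> arcs C \<longleftrightarrow> (i, j) \<in> parcs K"
proof -
  obtain f where f: "inj_on f (verts C)" "f ` verts C = pverts K"
    and e: "\<And>x y. x \<in> verts C \<Longrightarrow> y \<in> verts C \<Longrightarrow> (x, y) \<in> arcs C \<longleftrightarrow> (f x, f y) \<in> parcs K"
    by (rule digraph_iso_pairE[OF iso C]) blast
  have b: "bij_betw f (verts C) {..<k}" using f K by (simp add: bij_betw_def)
  define g where "g = the_inv_into (verts C) f"
  have g: "bij_betw g {..<k} (verts C)" unfolding g_def by (rule bij_betw_the_inv_into[OF b])
  have fg: "f (g i) = i" if "i < k" for i
    unfolding g_def by (rule f_the_inv_into_f[OF f(1)]) (use that f K in auto)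
  have gv: "g i \<in> verts C" if "i < k" for i using bij_betwE[OF g] that by blast
  show ?thesis
  proof (rule that[OF g])
    show "(g i, g j) \<in> arcs C \<longleftrightarrow> (i, j) \<in> parcs K" if "i < k" "j < k" for i j
      using e[OF gv gv, OF that] fg that by simp
  qed
qed

lemma iso_path_six_path:
  assumes H: "simple_graph H" and C: "C \<in> pre_digraph.sccs (with_proj H)"
    and iso: "digraph_iso C (with_proj (path_graph 6))"
  shows "\<exists>p q w w' q' p'. six_path H p q w w' q' p' \<and> verts C = {p, q, w, w', q', p'}"
proof -
  note c = scc_props[OF H C]
  have sub: "arcs C \<subseteq> verts C \<times> verts C" unfolding c(5) by blast
  have K: "pverts (path_graph 6) = {..<6}" by (simp add: path_graph_def)
  obtain g where g: "bij_betw g {..<6} (verts C)"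
    and e: "\<And>i j. i < 6 \<Longrightarrow> j < 6 \<Longrightarrow> (g i, g j) \<in> arcs C \<longleftrightarrow> (i, j) \<in> parcs (path_graph 6)"
    by (rule digraph_iso_nat[OF iso K c(3,4) sub]) blast
  have gv: "g i \<in> verts C" if "i < 6" for i using bij_betwE[OF g] that by blast
  have six: "{..<6::nat} = {0,1,2,3,4,5}" by auto
  have VC: "verts C = {g 0, g 1, g 2, g 3, g 4, g 5}"
    using g unfolding bij_betw_def six by auto
  have inj: "g i = g j \<longleftrightarrow> i = j" if "i < 6" "j < 6" for i j
    using g that unfolding bij_betw_def inj_on_def by auto
  have nb: "nbrs H (g i) = g ` {j. j < 6 \<and> (i, j) \<in> parcs (path_graph 6)}" if i: "i < 6" for i
  proof (rule Set.set_eqI)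
    fix y
    have "y \<in> nbrs H (g i) \<longleftrightarrow> (g i, y) \<in> arcs C"
      using c(6)[OF gv[OF i], of y] gv[OF i] unfolding c(5) nbrs_def by auto
    also have "\<dots> \<longleftrightarrow> (\<exists>j<6. y = g j \<and> (g i, g j) \<in> arcs C)"
    proof -
      have "y \<in> g ` {..<6}" if "(g i, y) \<in> arcs C" using that sub g by (auto simp: bij_betw_def)
      then show ?thesis by auto
    qed
    also have "\<dots> \<longleftrightarrow> y \<in> g ` {j. j < 6 \<and> (i, j) \<in> parcs (path_graph 6)}" using e[OF i] by auto
    finally show "y \<in> nbrs H (g i) \<longleftrightarrow> y \<in> g ` {j. j < 6 \<and> (i, j) \<in> parcs (path_graph 6)}" .
  qed
  have sets: "{j. j < 6 \<and> (0::nat, j) \<in> parcs (path_graph 6)} = {1}"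
    "{j. j < 6 \<and> (1::nat, j) \<in> parcs (path_graph 6)} = {0, 2}"
    "{j. j < 6 \<and> (2::nat, j) \<in> parcs (path_graph 6)} = {3, 1}"
    "{j. j < 6 \<and> (3::nat, j) \<in> parcs (path_graph 6)} = {2, 4}"
    "{j. j < 6 \<and> (4::nat, j) \<in> parcs (path_graph 6)} = {5, 3}"
    "{j. j < 6 \<and> (5::nat, j) \<in> parcs (path_graph 6)} = {4}"
    unfolding path_graph_6 by auto
  have "six_path H (g 0) (g 1) (g 2) (g 3) (g 4) (g 5)"
    unfolding six_path_def using nb[of 0] nb[of 1] nb[of 2] nb[of 3] nb[of 4] nb[of 5] unfolding sets
    by (simp add: inj)
  then show ?thesis using VC by blast
qed

text \<open>The classes are recovered from degrees: degree \<open>1\<close>, degree \<open>2\<close> next to a vertex of degree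
\<open>1\<close>, and the rest. By symmetry of the path it suffices to look at its first three vertices.\<close>

lemma six_paths_p6_structure:
  assumes H: "simple_graph H"
    and six: "\<And>x. x \<in> pverts H \<Longrightarrow> \<exists>p q w w' q' p'. six_path H p q w w' q' p' \<and> x \<in> {p, q, w}"
  shows "\<exists>P Q W. p6_structure H P Q W"
proof -
  note n = simple_graph_nbrs[OF H]
  define P where "P = {x \<in> pverts H. card (nbrs H x) = 1}"
  define Q where "Q = {x \<in> pverts H. card (nbrs H x) = 2 \<and> (\<exists>p\<in>nbrs H x. card (nbrs H p) = 1)}"
  define W where "W = {x \<in> pverts H. card (nbrs H x) = 2 \<and> \<not> (\<exists>p\<in>nbrs H x. card (nbrs H p) = 1)}"
  have cls: "p \<in> P" "q \<in> Q" "w \<in> W" if s: "six_path H p q w w' q' p'" for p q w w' q' p'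
  proof -
    have V: "p \<in> pverts H" "q \<in> pverts H" "w \<in> pverts H"
      using s n(5)[of q p] n(5)[of p q] n(5)[of q w] by (auto simp: six_path_def)
    show "p \<in> P" "q \<in> Q" "w \<in> W" using s V by (auto simp: six_path_def P_def Q_def W_def)
  qed
  have dis: "P \<inter> Q = {}" "P \<inter> W = {}" "Q \<inter> W = {}" by (auto simp: P_def Q_def W_def)
  have "p6_structure H P Q W" unfolding p6_structure_def
  proof (intro conjI ballI)
    show "P \<union> Q \<union> W = pverts H"
    proof
      show "pverts H \<subseteq> P \<union> Q \<union> W" using six cls by blast
    qed (auto simp: P_def Q_def W_def)
    fix x
    { assume x: "x \<in> P"
      then have "x \<in> pverts H" by (simp add: P_def)
      then obtain p q w w' q' p' where s: "six_path H p q w w' q' p'" "x \<in> {p, q, w}" using six[of x] by blast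
      then have "x = p" using cls[OF s(1)] x dis by blast
      then have "nbrs H x = {q}" using s by (simp add: six_path_def)
      then show "\<exists>q\<in>Q. nbrs H x = {q}" using cls[OF s(1)] by blast }
    { assume x: "x \<in> Q"
      then have "x \<in> pverts H" by (simp add: Q_def)
      then obtain p q w w' q' p' where s: "six_path H p q w w' q' p'" "x \<in> {p, q, w}" using six[of x] by blast
      then have "x = q" using cls[OF s(1)] x dis by blast
      then have "nbrs H x = insert p {w}" using s by (simp add: six_path_def)
      then show "\<exists>p\<in>P. \<exists>U\<subseteq>W. nbrs H x = insert p U" using cls[OF s(1)] by blast }
    { assume x: "x \<in> W"
      then have "x \<in> pverts H" by (simp add: W_def)
      then obtain p q w w' q' p' where s: "six_path H p q w w' q' p'" "x \<in> {p, q, w}" using six[of x] by blast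
      then have "x = w" using cls[OF s(1)] x dis by blast
      then have "nbrs H x = {w', q}" using s by (simp add: six_path_def)
      then show "\<exists>w'\<in>W. \<exists>q\<in>Q. nbrs H x = {w', q}" using cls[OF s(1)] cls(3)[OF six_path_rev[OF s(1)]] by blast }
  qed (rule dis)+
  then show ?thesis by blast
qed

theorem final_components_iff_p6_structure:
  assumes G: "pair_graph G" "connected_graph G" "card (pverts G) \<ge> 3"
  shows "(\<forall>C \<in> final_reduction_components G. digraph_iso C (with_proj (path_graph 6))) \<longleftrightarrow>
    (\<exists>P Q W. p6_structure G P Q W)"
proof
  assume all: "\<forall>C \<in> final_reduction_components G. digraph_iso C (with_proj (path_graph 6))"
  obtain H where H: "final_reduction_graph G H" using final_reduction_graph_exists[OF G] by blast
  then have steps: "reduction_step\<^sup>*\<^sup>* (embed G) H" by (simp add: final_reduction_graph_def)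
  note r = reductions_simple_p6[OF steps simple_graph_embed[OF pair_graph_simple[OF G(1)]]]
  have sH: "simple_graph H" using r by blast
  have "\<exists>P Q W. p6_structure H P Q W"
  proof (rule six_paths_p6_structure[OF sH])
    fix x assume x: "x \<in> pverts H"
    obtain C where C: "C \<in> pre_digraph.sccs (with_proj H)" "x \<in> verts C" using scc_exists[OF sH x] by blast
    have "C \<in> final_reduction_components G" unfolding final_reduction_components_def using H C(1) by blast
    then have "digraph_iso C (with_proj (path_graph 6))" using all by blast
    then obtain p q w w' q' p' where s: "six_path H p q w w' q' p'" "verts C = {p, q, w, w', q', p'}"
      using iso_path_six_path[OF sH C(1)] by blast
    then show "\<exists>p q w w' q' p'. six_path H p q w w' q' p' \<and> x \<in> {p, q, w}"
      using C(2) six_path_rev[OF s(1)] by blast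
  qed
  then show "\<exists>P Q W. p6_structure G P Q W" using r p6_structure_embed by blast
next
  assume S: "\<exists>P Q W. p6_structure G P Q W"
  show "\<forall>C \<in> final_reduction_components G. digraph_iso C (with_proj (path_graph 6))"
  proof
    fix C assume "C \<in> final_reduction_components G"
    then obtain H where H: "final_reduction_graph G H" "C \<in> pre_digraph.sccs (with_proj H)"
      by (auto simp: final_reduction_components_def)
    then have steps: "reduction_step\<^sup>*\<^sup>* (embed G) H" and fin: "\<forall>v \<in> quasi_pendant_verts H. deg H v = 2"
      by (auto simp: final_reduction_graph_def)
    note r = reductions_simple_p6[OF steps simple_graph_embed[OF pair_graph_simple[OF G(1)]]]
    have sH: "simple_graph H" using r by blast
    obtain P Q W where PQW: "p6_structure H P Q W" using r S p6_structure_embed[of G] by blast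
    note D = p6_structureD[OF PQW]
    note c = scc_props[OF sH H(2)]
    have arc: "(x, y) \<in> parcs H \<longleftrightarrow> y \<in> nbrs H x" for x y by (simp add: nbrs_def)
    have Qw: "\<exists>w\<in>W. w \<in> verts C" if q: "q \<in> Q" "q \<in> verts C" for q
    proof -
      obtain p U where p: "p \<in> P" "U \<subseteq> W" "nbrs H q = insert p U" using D(6)[OF q(1)] by blast
      obtain q1 where q1: "nbrs H p = {q1}" using D(5)[OF p(1)] by blast
      have "p \<in> pverts H" "q \<in> pverts H" using p(1) q(1) D(1) by auto
      then have "q \<in> quasi_pendant_verts H" using q1 p(3)
        by (auto simp: quasi_pendant_verts_def pendant_verts_def deg_nbrs nbrs_def)
      then have "card (nbrs H q) = 2" using fin by (simp add: deg_nbrs)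
      then have "U \<noteq> {}" using p(3) by auto
      then obtain w where "w \<in> U" by blast
      then show ?thesis using p c(6)[OF q(2), of w] by (auto simp: arc)
    qed
    obtain x where x: "x \<in> verts C" using c(1) by blast
    have "x \<in> P \<union> Q \<union> W" using x c(2) D(1) by blast
    then have "\<exists>w\<in>W. w \<in> verts C"
    proof (elim UnE)
      assume "x \<in> P"
      then obtain q where "q \<in> Q" "nbrs H x = {q}" using D(5) by blast
      then show ?thesis using Qw c(6)[OF x, of q] by (simp add: arc)
    qed (use Qw x in blast)+
    then obtain w where w: "w \<in> W" "w \<in> verts C" by blast
    obtain p q w' q' p' where "six_path H p q w w' q' p'" using p6_final_six_path[OF sH PQW w(1) fin] by blast
    from six_path_component_iso[OF sH H(2) w(2) this] show "digraph_iso C (with_proj (path_graph 6))" .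
  qed
qed

section \<open>Counting vertices, edges and eigenfunctions\<close>

lemma nbrs_in_graph:
  assumes "simple_graph G"
  shows "nbrs_in (parcs G) (pverts G) v = nbrs G v"
  using assms by (auto simp: simple_graph_def nbrs_in_def nbrs_def)

lemma connected_component:
  assumes G: "pair_graph G" "connected_graph G" and v: "v \<in> pverts G"
  shows "component (parcs G) (pverts G) v = pverts G"
proof
  have s: "simple_graph G" using pair_graph_simple[OF G(1)] .
  show "component (parcs G) (pverts G) v \<subseteq> pverts G" by (rule component_subset[OF v])
  have "parcs G \<inter> pverts G \<times> pverts G = parcs G" using s by (auto simp: simple_graph_def)
  then have c: "component (parcs G) (pverts G) v = {w. (v, w) \<in> (parcs G)\<^sup>*}" by (simp add: component_def)
  have sy: "(x, y) \<in> parcs G \<Longrightarrow> (y, x) \<in> parcs G" for x y using s by (auto simp: simple_graph_def sym_def)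
  have "mk_symmetric (with_proj G) = G"
    using sy by (auto simp: mk_symmetric_def intro!: pair_pre_digraph.equality)
  then have reach: "v \<rightarrow>\<^sup>*\<^bsub>with_proj G\<^esub> w" if "w \<in> pverts G" for w
    using G(2) v that by (auto simp: connected_def strongly_connected_def)
  interpret pair_graph G by fact
  have "(v, w) \<in> (parcs G)\<^sup>*" if "w \<in> pverts G" for w
    using reach[OF that] reachable_rtranclI by fastforce
  then show "pverts G \<subseteq> component (parcs G) (pverts G) v" unfolding c by blast
qed

lemma connected_num_components:
  assumes G: "pair_graph G" "connected_graph G" and ne: "pverts G \<noteq> {}"
  shows "num_components (parcs G) (pverts G) = 1"
proof -
  have "component (parcs G) (pverts G) ` pverts G = {pverts G}"
    using connected_component[OF G] ne by auto
  then show ?thesis by (simp add: num_components_def)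
qed

lemma connected_closed:
  assumes G: "pair_graph G" "connected_graph G" and v: "v \<in> pverts G" "v \<in> T"
    and T: "\<And>u. u \<in> T \<Longrightarrow> nbrs G u \<subseteq> T"
  shows "pverts G \<subseteq> T"
proof -
  have "component (parcs G) (pverts G) v \<subseteq> T"
    by (rule component_least[OF v(2)]) (use T nbrs_in_graph[OF pair_graph_simple[OF G(1)]] in blast)
  then show ?thesis using connected_component[OF G v(1)] by simp
qed

lemma card_parcs_edges:
  assumes G: "simple_graph G"
  shows "card (parcs G) = 2 * card (edges G)"
proof -
  let ?f = "\<lambda>(u, v). {u, v}"
  have fin: "finite (parcs G)" using G finite_subset by (auto simp: simple_graph_def)
  have sy: "(y, x) \<in> parcs G" if "(x, y) \<in> parcs G" for x y using G that by (auto simp: simple_graph_def sym_def)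
  have "(\<Sum>e\<in>edges G. sum (\<lambda>_. 1) {a \<in> parcs G. ?f a = e}) = sum (\<lambda>_. 1::nat) (parcs G)"
    by (rule sum.group) (use fin in \<open>auto simp: edges_def\<close>)
  moreover have "sum (\<lambda>_. 1::nat) {a \<in> parcs G. ?f a = e} = 2" if e: "e \<in> edges G" for e
  proof -
    obtain u v where uv: "(u, v) \<in> parcs G" "e = {u, v}" using e unfolding edges_def by auto
    have ne: "u \<noteq> v" using uv(1) G by (auto simp: simple_graph_def irrefl_def)
    have *: "(x, y) \<in> parcs G \<and> {x, y} = {u, v} \<longleftrightarrow> (x, y) = (u, v) \<or> (x, y) = (v, u)" for x y
      unfolding doubleton_eq_iff using uv(1) sy[OF uv(1)] by blast
    have "{a \<in> parcs G. ?f a = e} = {(u, v), (v, u)}"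
    proof (rule Set.set_eqI)
      show "a \<in> {a \<in> parcs G. ?f a = e} \<longleftrightarrow> a \<in> {(u, v), (v, u)}" for a
        by (cases a) (simp add: uv(2) *)
    qed
    then show ?thesis using ne by simp
  qed
  ultimately show ?thesis by simp
qed

lemma sum_degrees:
  assumes G: "simple_graph G"
  shows "(\<Sum>v\<in>pverts G. card (nbrs G v)) = 2 * card (edges G)"
proof -
  have "finite (pverts G)" using G by (simp add: simple_graph_def)
  then have "(\<Sum>v\<in>pverts G. card (nbrs G v)) = card (SIGMA v:pverts G. nbrs G v)"
    using simple_graph_nbrs(2)[OF G] by simp
  also have "(SIGMA v:pverts G. nbrs G v) = parcs G"
    using G by (auto simp: simple_graph_def nbrs_def)
  finally show ?thesis using card_parcs_edges[OF G] by simp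
qed

lemma graph_nullity_bound:
  assumes G: "pair_graph G" "connected_graph G" and ne: "pverts G \<noteq> {}"
  shows "nullity_bound (parcs G) (pverts G) (\<lambda>v. deg G v) =
    4 * int (card (edges G)) - 3 * int (card (pverts G)) + 2"
proof -
  have "(\<Sum>v\<in>pverts G. 2 * int (deg G v) - 3) =
      2 * int (\<Sum>v\<in>pverts G. card (nbrs G v)) - 3 * int (card (pverts G))"
    by (simp add: deg_nbrs sum_subtractf sum_distrib_left)
  then show ?thesis
    using sum_degrees[OF pair_graph_simple[OF G(1)]] connected_num_components[OF G ne]
    by (simp add: nullity_bound_def)
qed

text \<open>Sending a pendant vertex to its neighbour maps onto the quasi-pendant vertices; for a reduced graph the two sets have equal
size, so the map is injective.\<close>

lemma connected_reduced_reducible: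
  assumes G: "pair_graph G" "connected_graph G" "reduced G" and n: "card (pverts G) \<ge> 3"
  shows "reducible (parcs G) (pverts G) (\<lambda>v. deg G v)"
proof -
  have s: "simple_graph G" using pair_graph_simple[OF G(1)] .
  note N = simple_graph_nbrs[OF s]
  have fin: "finite (pverts G)" using s by (simp add: simple_graph_def)
  have ne: "nbrs G v \<noteq> {}" if v: "v \<in> pverts G" for v
  proof
    assume "nbrs G v = {}"
    then have "pverts G \<subseteq> {v}" by (intro connected_closed[OF G(1,2) v]) auto
    then have "card (pverts G) \<le> 1" using card_mono[of "{v}"] by force
    then show False using n by simp
  qed
  define P where "P = pendant_verts G"
  have P: "p \<in> P \<longleftrightarrow> p \<in> pverts G \<and> card (nbrs G p) = 1" for p by (auto simp: P_def pendant_verts_def deg_nbrs)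
  define f where "f = (\<lambda>p. THE q. nbrs G p = {q})"
  have f: "nbrs G p = {f p}" if "p \<in> P" for p
  proof -
    obtain q where "nbrs G p = {q}" using \<open>p \<in> P\<close> P by (auto simp: card_1_singleton_iff)
    then show ?thesis by (simp add: f_def)
  qed
  have img: "f ` P = quasi_pendant_verts G"
  proof
    show "f ` P \<subseteq> quasi_pendant_verts G"
    proof
      fix q assume "q \<in> f ` P"
      then obtain p where p: "p \<in> P" "q = f p" by blast
      then have "q \<in> nbrs G p" using f by simp
      then show "q \<in> quasi_pendant_verts G" using p(1) N(1)[of p] N(4)[of q p]
        by (auto simp: quasi_pendant_verts_def P_def nbrs_def)
    qed
    show "quasi_pendant_verts G \<subseteq> f ` P"
    proof
      fix q assume "q \<in> quasi_pendant_verts G"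
      then obtain p where p: "p \<in> P" "p \<in> nbrs G q" by (auto simp: quasi_pendant_verts_def P_def nbrs_def)
      then have "q \<in> nbrs G p" using N(4) by blast
      then have "q = f p" using f[OF p(1)] by simp
      then show "q \<in> f ` P" using p(1) by blast
    qed
  qed
  have finP: "finite P" using fin by (simp add: P_def pendant_verts_def)
  have inj: "inj_on f P"
    using G(3) img by (intro eq_card_imp_inj_on[OF finP]) (simp add: reduced_def P_def)
  show ?thesis unfolding reducible_def nbrs_in_graph[OF s] deg_nbrs
  proof (intro conjI ballI impI)
    show "finite (pverts G)" "sym (parcs G)" "irrefl (parcs G)" using s by (auto simp: simple_graph_def)
    fix v assume v: "v \<in> pverts G"
    show "1 \<le> card (nbrs G v)" using ne[OF v] N(2)[of v] by (simp add: Suc_le_eq card_gt_0_iff)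
    show "card (nbrs G v) \<le> card (nbrs G v)" ..
    assume c: "card (nbrs G v) = 1"
    then have vP: "v \<in> P" using v P by simp
    have "2 \<le> card (nbrs G (f v))"
      using conn_ge2[OF G(1,2) n, of "f v"] img vP by (auto simp: deg_nbrs)
    moreover have "\<forall>u\<in>pverts G. card (nbrs G u) = 1 \<and> f v \<in> nbrs G u \<longrightarrow> u = v"
    proof (intro ballI impI, elim conjE)
      fix u assume u: "u \<in> pverts G" "card (nbrs G u) = 1" "f v \<in> nbrs G u"
      have uP: "u \<in> P" using P u(1,2) by blast
      have "f v = f u" using u(3) unfolding f[OF uP] by simp
      then show "u = v" using inj_onD[OF inj _ uP vP] by simp
    qed
    ultimately show "\<exists>w. nbrs G v = {w} \<and> 2 \<le> card (nbrs G w) \<and>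
        (\<forall>u\<in>pverts G. card (nbrs G u) = 1 \<and> w \<in> nbrs G u \<longrightarrow> u = v)" using f[OF vP] by blast
  qed
qed

text \<open>An eigenfunction vanishes on \<open>Q\<close>, is constant on each of the \<open>r\<close> adjacent pairs in
\<open>W\<close>, with arbitrary constants, and is then determined on \<open>P\<close> by the equations at \<open>Q\<close>.
So its values at one vertex of each pair are free and determine it; the set \<open>R\<close> of these representatives is
chosen by an injective numbering \<open>h\<close>.\<close>

lemma p6_structure_counts:
  assumes G: "pair_graph G" and S: "p6_structure G P Q W"
  shows "\<exists>r q. laplacian_mult G 1 = r \<and> card (pverts G) = 2 * q + 2 * r \<and> card (edges G) = q + 3 * r"
proof -
  have s: "simple_graph G" using pair_graph_simple[OF G] .
  note N = simple_graph_nbrs[OF s]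
  note D = p6_structureD[OF S]
  note ng = nbrs_in_graph[OF s]
  have fin: "finite (pverts G)" using s by (simp add: simple_graph_def)
  have finPQW: "finite P" "finite Q" "finite W" using fin D(1) by (metis finite_Un)+
  have "\<forall>w\<in>W. \<exists>z. fst z \<in> W \<and> snd z \<in> Q \<and> nbrs G w = {fst z, snd z}" using D(7) by force
  from bchoice[OF this] obtain z where z: "\<And>w. w \<in> W \<Longrightarrow> fst (z w) \<in> W \<and> snd (z w) \<in> Q \<and> nbrs G w = {fst (z w), snd (z w)}"
    by blast
  define mt where "mt = (\<lambda>w. fst (z w))"
  define qu where "qu = (\<lambda>w. snd (z w))"
  have W: "mt w \<in> W" "qu w \<in> Q" "nbrs G w = {mt w, qu w}" if "w \<in> W" for w
    using z[OF that] by (simp_all add: mt_def qu_def)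
  have mtmt: "mt (mt w) = w" if w: "w \<in> W" for w
  proof -
    have "w \<in> nbrs G (mt w)" using N(4)[of w "mt w"] W(3)[OF w] by simp
    then show ?thesis using W[OF W(1)[OF w]] w D(4) by auto
  qed
  have mtne: "mt w \<noteq> w" if w: "w \<in> W" for w
  proof
    assume "mt w = w"
    moreover have "mt w \<in> nbrs G w" unfolding W(3)[OF w] by simp
    ultimately show False using N(3)[of w] by simp
  qed
  have qune: "mt w \<noteq> qu w" if w: "w \<in> W" for w
  proof
    assume "mt w = qu w"
    then have "qu w \<in> Q \<inter> W" using W(1,2)[OF w] by simp
    then show False unfolding D(4) by simp
  qed
  from bchoice[of P "\<lambda>p q. q \<in> Q \<and> nbrs G p = {q}"] D(5) obtain qn where
    P: "\<And>p. p \<in> P \<Longrightarrow> qn p \<in> Q \<and> nbrs G p = {qn p}" by blast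
  have "\<forall>q\<in>Q. \<exists>p. p \<in> P \<and> nbrs G q = insert p (nbrs G q \<inter> W)"
  proof
    fix q assume "q \<in> Q"
    then obtain p U where p: "p \<in> P" "U \<subseteq> W" "nbrs G q = insert p U" using D(6) by blast
    then have "nbrs G q \<inter> W = U" using D(3) by auto
    then show "\<exists>p. p \<in> P \<and> nbrs G q = insert p (nbrs G q \<inter> W)" using p by blast
  qed
  from bchoice[OF this] obtain pe where Q: "\<And>q. q \<in> Q \<Longrightarrow> pe q \<in> P \<and> nbrs G q = insert (pe q) (nbrs G q \<inter> W)"
    by blast
  have Q1: "pe q \<in> P" and Q2: "nbrs G q = insert (pe q) (nbrs G q \<inter> W)" if "q \<in> Q" for q
    using Q[OF that] by blast+
  have peW: "pe q \<notin> nbrs G q \<inter> W" if "q \<in> Q" for q using Q1[OF that] D(3) by blast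
  have sumQ: "sum g (nbrs G q) = g (pe q) + sum g (nbrs G q \<inter> W)" if "q \<in> Q" for q and g :: "'a \<Rightarrow> real"
  proof -
    have "sum g (nbrs G q) = sum g (insert (pe q) (nbrs G q \<inter> W))" using Q2[OF that] by (rule arg_cong)
    also have "\<dots> = g (pe q) + sum g (nbrs G q \<inter> W)"
      by (rule sum.insert) (use peW[OF that] finPQW in auto)
    finally show ?thesis .
  qed
  have qnpe: "qn (pe q) = q" if q: "q \<in> Q" for q
  proof -
    have "pe q \<in> nbrs G q" using Q2[OF q] by blast
    then have "q \<in> nbrs G (pe q)" using N(4) by blast
    then show ?thesis using P[OF Q1[OF q]] by simp
  qed
  have peqn: "pe (qn p) = p" if p: "p \<in> P" for p
  proof -
    have qQ: "qn p \<in> Q" using P[OF p] by simp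
    have "p \<in> nbrs G (qn p)" using N(4)[of p "qn p"] P[OF p] by simp
    then have "p \<in> insert (pe (qn p)) (nbrs G (qn p) \<inter> W)" using equalityD1[OF Q2[OF qQ]] by (rule rev_subsetD)
    moreover have "p \<notin> W" using p D(3) by blast
    ultimately show ?thesis by simp
  qed
  have cPQ: "card P = card Q"
    by (rule bij_betw_same_card[of qn], rule bij_betw_byWitness[of _ pe]) (use P Q1 qnpe peqn in auto)
  have NQW: "nbrs G q \<inter> W = {w \<in> W. qu w = q}" if q: "q \<in> Q" for q
  proof -
    have "w \<in> nbrs G q \<longleftrightarrow> qu w = q" if w: "w \<in> W" for w
    proof -
      have "w \<in> nbrs G q \<longleftrightarrow> q \<in> {mt w, qu w}" using N(4)[of w q] W(3)[OF w] by simp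
      moreover have "q \<noteq> mt w" using W(1)[OF w] q D(4) by auto
      ultimately show ?thesis by auto
    qed
    then show ?thesis by blast
  qed
  obtain h :: "'a \<Rightarrow> nat" where h: "inj_on h W" using finite_imp_inj_to_nat_seg[OF finPQW(3)] by blast
  define R where "R = {w \<in> W. h w < h (mt w)}"
  have RW: "R \<subseteq> W" by (auto simp: R_def)
  have hne: "h w \<noteq> h (mt w)" if "w \<in> W" for w 
    using inj_onD[OF h _ that W(1)[OF that]] mtne[OF that] by metis
  have mtR: "mt r \<notin> R" if "r \<in> R" for r using that mtmt[of r] by (simp add: R_def)
  have WR: "W = R \<union> mt ` R"
  proof
    show "W \<subseteq> R \<union> mt ` R"
    proof
      fix w assume w: "w \<in> W"
      show "w \<in> R \<union> mt ` R"
      proof (cases "h w < h (mt w)")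
        case False
        then have "mt w \<in> R" using w W(1)[OF w] hne[OF w] mtmt[OF w] by (auto simp: R_def)
        then have "mt (mt w) \<in> mt ` R" by blast
        then show ?thesis using mtmt[OF w] by simp
      qed (use w in \<open>simp add: R_def\<close>)
    qed
    show "R \<union> mt ` R \<subseteq> W" using RW W(1) by auto
  qed
  have finR: "finite R" using finPQW(3) RW finite_subset by blast
  have cW: "card W = 2 * card R"
  proof -
    have "inj_on mt R" by (rule inj_on_inverseI[of _ mt]) (use mtmt RW in auto)
    then have "card (mt ` R) = card R" by (rule card_image)
    moreover have "R \<inter> mt ` R = {}" using mtR by auto
    ultimately show ?thesis using card_Un_disjoint[of R "mt ` R"] finR WR by simp
  qed
  have PQW: "(P \<union> Q) \<inter> W = {}" using D(3,4) by blast
  have cV: "card (pverts G) = card P + card Q + card W"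
    using card_Un_disjoint[of "P \<union> Q" W] card_Un_disjoint[of P Q] finPQW D(1,2) PQW by simp
  have sum: "(\<Sum>v\<in>pverts G. card (nbrs G v)) = card P + (card Q + card W) + 2 * card W"
  proof -
    have "(\<Sum>v\<in>pverts G. card (nbrs G v)) =
        (\<Sum>v\<in>P. card (nbrs G v)) + (\<Sum>v\<in>Q. card (nbrs G v)) + (\<Sum>v\<in>W. card (nbrs G v))"
      unfolding D(1)[symmetric] using finPQW D(2) PQW by (simp add: sum.union_disjoint)
    moreover have "(\<Sum>v\<in>P. card (nbrs G v)) = card P" using P by simp
    moreover have "(\<Sum>v\<in>W. card (nbrs G v)) = 2 * card W"
      using W(3) qune by simp
    moreover have "(\<Sum>v\<in>Q. card (nbrs G v)) = card Q + card W"
    proof -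
      have "card (nbrs G q) = 1 + sum (\<lambda>_. 1) {w \<in> W. qu w = q}" if q: "q \<in> Q" for q
      proof -
        have "card (nbrs G q) = card (insert (pe q) (nbrs G q \<inter> W))" using Q2[OF q] by (rule arg_cong)
        also have "\<dots> = 1 + card (nbrs G q \<inter> W)" using peW[OF q] finPQW by simp
        finally show ?thesis using NQW[OF q] by simp
      qed
      then have "(\<Sum>v\<in>Q. card (nbrs G v)) = (\<Sum>q\<in>Q. 1 + sum (\<lambda>_. 1) {w \<in> W. qu w = q})" by simp
      also have "\<dots> = card Q + (\<Sum>q\<in>Q. sum (\<lambda>_. 1) {w \<in> W. qu w = q})" by (simp only: sum.distrib) simp
      also have "(\<Sum>q\<in>Q. sum (\<lambda>_. 1) {w \<in> W. qu w = q}) = sum (\<lambda>_. 1::nat) W"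
        by (rule sum.group) (use finPQW W(2) in auto)
      finally show ?thesis by simp
    qed
    ultimately show ?thesis by simp
  qed
  have mult: "laplacian_mult G 1 = card R"
  proof (rule laplacian_mult_eq_card[OF G])
    show "R \<subseteq> pverts G" using RW D(1) by blast
  next
    fix x v
    assume x: "x \<in> eigenfunctions (parcs G) (pverts G) (\<lambda>v. deg G v)" and x0: "\<forall>r\<in>R. x r = 0"
    have eq: "(real (card (nbrs G v)) - 1) * x v = (\<Sum>w\<in>nbrs G v. x w)" if "v \<in> P \<union> Q \<union> W" for v
      using eigenfunction_eq[OF x, of v] that D(1) by (simp add: ng deg_nbrs)
    have xQ: "x q = 0" if q: "q \<in> Q" for q
      using eq[of "pe q"] Q1[OF q] P[OF Q1[OF q]] qnpe[OF q] by simp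
    have xWm: "x w = x (mt w)" if w: "w \<in> W" for w
      using eq[of w] w W[OF w] qune[OF w] xQ[OF W(2)[OF w]] by simp
    have xW: "x w = 0" if w: "w \<in> W" for w
    proof -
      from w have "w \<in> R \<union> mt ` R" using WR by simp
      then show ?thesis
      proof
        assume "w \<in> mt ` R"
        then obtain r where "r \<in> R" "w = mt r" by blast
        then show ?thesis using xWm[of r] x0 RW by auto
      qed (use x0 in blast)
    qed
    have xP: "x p = 0" if p: "p \<in> P" for p
    proof -
      have q: "qn p \<in> Q" using P[OF p] by blast
      have "(\<Sum>w\<in>nbrs G (qn p). x w) = x p + (\<Sum>w\<in>nbrs G (qn p) \<inter> W. x w)"
        using sumQ[OF q, of x] peqn[OF p] by simp
      then show ?thesis using eq[of "qn p"] q xQ[OF q] xW by simp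
    qed
    show "x v = 0"
    proof (cases "v \<in> pverts G")
      case True
      then show ?thesis using D(1) xP xQ xW by blast
    qed (use eigenfunction_outside[OF x] in blast)
  next
    fix r assume r: "r \<in> R"
    then have rW: "r \<in> W" using RW by blast
    define y where "y = (\<lambda>w. if w = r \<or> w = mt r then 1 else (0::real))"
    have ym: "y (mt w) = y w" if w: "w \<in> W" for w
    proof -
      have "mt w = r \<longleftrightarrow> w = mt r" using mtmt[OF w] mtmt[OF rW] by metis
      moreover have "mt w = mt r \<longleftrightarrow> w = r" using mtmt[OF w] mtmt[OF rW] by metis
      ultimately show ?thesis by (auto simp: y_def)
    qed
    define x where "x = (\<lambda>v. if v \<in> W then y v else if v \<in> P then - (\<Sum>w\<in>nbrs G (qn v) \<inter> W. y w) else 0)"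
    have xQ: "x q = 0" if "q \<in> Q" for q using that D(2,4) by (auto simp: x_def)
    have "x \<in> eigenfunctions (parcs G) (pverts G) (\<lambda>v. deg G v)"
      unfolding eigenfunctions_def ng deg_nbrs
    proof (rule CollectI, intro conjI allI impI ballI)
      show "x v = 0" if "v \<notin> pverts G" for v using that D(1) by (auto simp: x_def)
      fix v assume "v \<in> pverts G"
      then consider "v \<in> P" | "v \<in> Q" | "v \<in> W" using D(1) by blast
      then show "(real (card (nbrs G v)) - 1) * x v = (\<Sum>w\<in>nbrs G v. x w)"
      proof cases
        case 1
        then show ?thesis using P[OF 1] xQ by simp
      next
        case 2
        have nW: "pe v \<notin> W" using Q1[OF 2] D(3) by blast
        have "(\<Sum>w\<in>nbrs G v. x w) = x (pe v) + (\<Sum>w\<in>nbrs G v \<inter> W. x w)" by (rule sumQ[OF 2])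
        also have "(\<Sum>w\<in>nbrs G v \<inter> W. x w) = (\<Sum>w\<in>nbrs G v \<inter> W. y w)"
          by (rule sum.cong) (auto simp: x_def)
        also have "x (pe v) = - (\<Sum>w\<in>nbrs G v \<inter> W. y w)"
          using Q1[OF 2] nW qnpe[OF 2] by (simp add: x_def)
        finally show ?thesis using xQ[OF 2] by simp
      next
        case 3
        have "(\<Sum>w\<in>nbrs G v. x w) = x (mt v) + x (qu v)" using W(3)[OF 3] qune[OF 3] by simp
        also have "\<dots> = y v" using xQ[OF W(2)[OF 3]] ym[OF 3] W(1)[OF 3] by (simp add: x_def)
        finally show ?thesis using W(3)[OF 3] qune[OF 3] 3 by (simp add: x_def)
      qed
    qed
    moreover have "x t = (if r = t then 1 else 0)" if t: "t \<in> R" for t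
      using t RW mtR[OF r] by (auto simp: x_def y_def)
    ultimately show "\<exists>x\<in>eigenfunctions (parcs G) (pverts G) (\<lambda>v. deg G v).
        \<forall>t\<in>R. x t = (if r = t then 1 else 0)" by blast
  qed
  show ?thesis
  proof (intro exI conjI)
    show "laplacian_mult G 1 = card R" by (rule mult)
    show "card (pverts G) = 2 * card Q + 2 * card R" using cV cPQ cW by simp
    show "card (edges G) = card Q + 3 * card R" using sum sum_degrees[OF s] cPQ cW by simp
  qed
qed

lemma sum_card_nbrs_in:
  assumes fin: "finite V" and E: "E \<subseteq> V \<times> V"
  shows "(\<Sum>v\<in>V. card (nbrs_in E V v)) = card E"
proof -
  have "(\<Sum>v\<in>V. card (nbrs_in E V v)) = card (SIGMA v:V. nbrs_in E V v)"
    using fin finite_nbrs_in[OF fin] by simp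
  also have "(SIGMA v:V. nbrs_in E V v) = E" using E by (auto simp: nbrs_in_def)
  finally show ?thesis .
qed

text \<open>An edge of a cycle could be removed without disconnecting the graph, which would leave a connected graph with fewer than
\<open>n - 1\<close> edges.\<close>

lemma tree_of_edge_count:
  assumes G: "pair_graph G" "connected_graph G" and count: "card (edges G) + 1 = card (pverts G)"
  shows "tree_graph G"
  unfolding tree_graph_def
proof (intro conjI notI G(2))
  assume "\<exists>k\<ge>3. \<exists>H. subgraph (with_proj H) (with_proj G) \<and> graph_iso H (cycle_graph k)"
  then obtain k H where k: "k \<ge> 3" and sub: "subgraph (with_proj H) (with_proj G)"
    and iso: "graph_iso H (cycle_graph k)" by blast
  have s: "simple_graph G" using pair_graph_simple[OF G(1)] .
  define E where "E = parcs G"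
  define V where "V = pverts G"
  have fin: "finite V" and EV: "E \<subseteq> V \<times> V" and E: "sym E" "irrefl E"
    using s by (simp_all add: simple_graph_def E_def V_def)
  have HV: "pverts H \<subseteq> V" and HE: "parcs H \<subseteq> E" and wf: "wf_digraph (with_proj H)"
    using sub by (auto simp: subgraph_def E_def V_def)
  have HH: "arcs (with_proj H) \<subseteq> verts (with_proj H) \<times> verts (with_proj H)"
  proof
    fix a assume "a \<in> arcs (with_proj H)"
    then have "tail (with_proj H) a \<in> verts (with_proj H)" "head (with_proj H) a \<in> verts (with_proj H)"
      by (simp_all only: wf_digraph.tail_in_verts[OF wf] wf_digraph.head_in_verts[OF wf])
    then show "a \<in> verts (with_proj H) \<times> verts (with_proj H)" by (cases a) simp
  qed
  have K: "pverts (cycle_graph k) = {..<k}" by (simp add: cycle_graph_def)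
  obtain g where g: "bij_betw g {..<k} (verts (with_proj H))"
    and e: "\<And>i j. i < k \<Longrightarrow> j < k \<Longrightarrow> (g i, g j) \<in> arcs (with_proj H) \<longleftrightarrow> (i, j) \<in> parcs (cycle_graph k)"
    by (rule digraph_iso_nat[OF iso K _ _ HH]) auto
  have gV: "g i \<in> V" if "i < k" for i using bij_betwE[OF g] that HV by auto
  have inj: "g i = g j \<longleftrightarrow> i = j" if "i < k" "j < k" for i j
    using g that unfolding bij_betw_def inj_on_def by auto
  have arc: "(g i, g j) \<in> E" if "i < k" "j < k" "(i, j) \<in> parcs (cycle_graph k)" for i j
    using e[OF that(1,2)] that(3) HE by auto
  define a where "a = g 0"
  define b where "b = g (k - 1)"
  have ab: "(a, b) \<in> E" unfolding a_def b_def
    by (rule arc) (use k in \<open>auto simp: cycle_graph_def\<close>)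
  let ?F = "E - {(a, b), (b, a)}"
  have reach: "g i \<in> component ?F V a" if "i < k" for i
    using that
  proof (induction i)
    case 0
    then show ?case by (simp add: a_def component_refl)
  next
    case (Suc i)
    have "(g i, g (Suc i)) \<in> E" by (rule arc) (use Suc.prems in \<open>auto simp: cycle_graph_def\<close>)
    moreover have "(g i, g (Suc i)) \<noteq> (a, b)"
      using inj[of i 0] inj[of "Suc i" "k - 1"] Suc.prems k by (auto simp: a_def b_def)
    moreover have "(g i, g (Suc i)) \<noteq> (b, a)"
      using inj[of i "k - 1"] Suc.prems k by (auto simp: a_def b_def)
    ultimately have "g (Suc i) \<in> nbrs_in ?F V (g i)" using gV[OF Suc.prems] by (simp add: nbrs_in_def)
    then show ?case using component_step[OF Suc.IH gV] Suc.prems by simp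
  qed
  have aV: "a \<in> V" "b \<in> V" using gV[of 0] gV[of "k - 1"] k by (simp_all add: a_def b_def)
  have nb: "nonbridge E V a b"
    using ab aV reach[of "k - 1"] k by (simp add: nonbridge_def b_def)
  have "num_components ?F V = 1"
    using nonbridge_num_components[OF E(1) nb] connected_num_components[OF G] aV by (auto simp: E_def V_def)
  moreover have "2 * card V \<le> 2 * num_components ?F V + (\<Sum>v\<in>V. card (nbrs_in ?F V v))"
    by (rule card_le_num_components_edges[OF fin]) (use E in \<open>auto simp: sym_def irrefl_def\<close>)
  moreover have "(\<Sum>v\<in>V. card (nbrs_in ?F V v)) = card ?F"
    by (rule sum_card_nbrs_in[OF fin]) (use EV in blast)
  moreover have "card ?F = card E - 2"
  proof -
    have "(b, a) \<in> E" by (rule symD[OF E(1) ab])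
    moreover have "a \<noteq> b" using ab E(2) by (auto simp: irrefl_def)
    ultimately show ?thesis using ab by (subst card_Diff_subset) auto
  qed
  moreover have "card E = 2 * card (edges G)" using card_parcs_edges[OF s] by (simp add: E_def)
  moreover have "card E \<noteq> 0" using ab finite_subset[OF EV] fin by auto
  ultimately show False using count by (simp add: V_def)
qed

definition hexagon_graph :: "'a pair_pre_digraph \<Rightarrow> 'a \<Rightarrow> 'a \<Rightarrow> 'a \<Rightarrow> 'a \<Rightarrow> 'a \<Rightarrow> 'a \<Rightarrow> bool" where
  "hexagon_graph G c0 c1 c2 c3 c4 c5 \<longleftrightarrow> distinct [c0, c1, c2, c3, c4, c5] \<and> pverts G = {c0, c1, c2, c3, c4, c5} \<and>
     nbrs G c0 = {c5, c1} \<and> nbrs G c1 = {c0, c2} \<and> nbrs G c2 = {c1, c3} \<and>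
     nbrs G c3 = {c2, c4} \<and> nbrs G c4 = {c3, c5} \<and> nbrs G c5 = {c4, c0}"

lemma cycle_graph_6:
  "parcs (cycle_graph 6) = {(5,4),(5,0),(4,3),(4,5),(3,2),(3,4),(2,1),(2,3),(1,0),(1,2),(0,5),(0,1)}"
proof -
  have "parcs (cycle_graph 6) = Set.filter (\<lambda>(i,j). j = (i + 1) mod 6 \<or> i = (j + 1) mod 6) (set [0..<6] \<times> set [0..<6])"
    unfolding cycle_graph_def by (simp add: set_eq_iff)
  also have "\<dots> = {(5,4),(5,0),(4,3),(4,5),(3,2),(3,4),(2,1),(2,3),(1,0),(1,2),(0,5),(0,1)::nat \<times> nat}" by code_simp
  finally show ?thesis .
qed

lemma hexagon_graph_iso:
  assumes G: "simple_graph G" and h: "hexagon_graph G c0 c1 c2 c3 c4 c5"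
  shows "graph_iso G (cycle_graph 6)"
proof -
  have dist: "distinct [c0, c1, c2, c3, c4, c5]" and V: "pverts G = {c0, c1, c2, c3, c4, c5}" and
    N: "nbrs G c0 = {c5, c1}" "nbrs G c1 = {c0, c2}" "nbrs G c2 = {c1, c3}"
     "nbrs G c3 = {c2, c4}" "nbrs G c4 = {c3, c5}" "nbrs G c5 = {c4, c0}"
    using h by (auto simp: hexagon_graph_def)
  define f where "f = (\<lambda>x. if x = c0 then 0 else if x = c1 then 1 else if x = c2 then 2 else
    if x = c3 then 3 else if x = c4 then 4 else (5::nat))"
  have fv: "f c0 = 0" "f c1 = 1" "f c2 = 2" "f c3 = 3" "f c4 = 4" "f c5 = 5" using dist by (auto simp: f_def)
  have arcs: "parcs G = {(c5,c4),(c5,c0),(c4,c3),(c4,c5),(c3,c2),(c3,c4),(c2,c1),(c2,c3),(c1,c0),(c1,c2),(c0,c5),(c0,c1)}"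
  proof -
    have "parcs G = (\<Union>x\<in>pverts G. Pair x ` nbrs G x)" using G by (auto simp: simple_graph_def nbrs_def)
    then show ?thesis by (simp add: V N)
  qed
  show ?thesis
  proof (rule digraph_iso_pairI[where f = f])
    show "arcs (with_proj G) \<subseteq> verts (with_proj G) \<times> verts (with_proj G)" using G by (simp add: simple_graph_def)
    show "inj_on f (verts (with_proj G))" using fv by (auto simp: V inj_on_def)
    show "f ` verts (with_proj G) = pverts (cycle_graph 6)" using fv by (auto simp: V cycle_graph_def)
    show "(\<lambda>(x, y). (f x, f y)) ` arcs (with_proj G) = parcs (cycle_graph 6)"
      using fv by (simp add: arcs cycle_graph_6)
  qed simp_all
qed

lemma iso_hexagon_graph:
  assumes G: "simple_graph G" and iso: "graph_iso G (cycle_graph 6)"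
  shows "\<exists>c0 c1 c2 c3 c4 c5. hexagon_graph G c0 c1 c2 c3 c4 c5"
proof -
  have sub: "arcs (with_proj G) \<subseteq> verts (with_proj G) \<times> verts (with_proj G)" using G by (simp add: simple_graph_def)
  have K: "pverts (cycle_graph 6) = {..<6}" by (simp add: cycle_graph_def)
  obtain g where g: "bij_betw g {..<6} (verts (with_proj G))"
    and e: "\<And>i j. i < 6 \<Longrightarrow> j < 6 \<Longrightarrow> (g i, g j) \<in> arcs (with_proj G) \<longleftrightarrow> (i, j) \<in> parcs (cycle_graph 6)"
    by (rule digraph_iso_nat[OF iso K _ _ sub]) auto
  have six: "{..<6::nat} = {0,1,2,3,4,5}" by auto
  have VG: "pverts G = {g 0, g 1, g 2, g 3, g 4, g 5}"
    using g unfolding bij_betw_def six by auto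
  have inj: "g i = g j \<longleftrightarrow> i = j" if "i < 6" "j < 6" for i j
    using g that unfolding bij_betw_def inj_on_def by auto
  have nb: "nbrs G (g i) = g ` {j. j < 6 \<and> (i, j) \<in> parcs (cycle_graph 6)}" if i: "i < 6" for i
  proof (rule Set.set_eqI)
    fix y
    have "y \<in> nbrs G (g i) \<longleftrightarrow> (g i, y) \<in> parcs G" by (simp add: nbrs_def)
    also have "\<dots> \<longleftrightarrow> (\<exists>j<6. y = g j \<and> (g i, g j) \<in> parcs G)"
    proof -
      have "y \<in> g ` {..<6}" if "(g i, y) \<in> parcs G" using that sub g by (auto simp: bij_betw_def)
      then show ?thesis by auto
    qed
    also have "\<dots> \<longleftrightarrow> y \<in> g ` {j. j < 6 \<and> (i, j) \<in> parcs (cycle_graph 6)}" using e[OF i] by auto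
    finally show "y \<in> nbrs G (g i) \<longleftrightarrow> y \<in> g ` {j. j < 6 \<and> (i, j) \<in> parcs (cycle_graph 6)}" .
  qed
  have sets: "{j. j < 6 \<and> (0::nat, j) \<in> parcs (cycle_graph 6)} = {5, 1}"
    "{j. j < 6 \<and> (1::nat, j) \<in> parcs (cycle_graph 6)} = {0, 2}"
    "{j. j < 6 \<and> (2::nat, j) \<in> parcs (cycle_graph 6)} = {1, 3}"
    "{j. j < 6 \<and> (3::nat, j) \<in> parcs (cycle_graph 6)} = {2, 4}"
    "{j. j < 6 \<and> (4::nat, j) \<in> parcs (cycle_graph 6)} = {3, 5}"
    "{j. j < 6 \<and> (5::nat, j) \<in> parcs (cycle_graph 6)} = {4, 0}"
    unfolding cycle_graph_6 by auto
  have "hexagon_graph G (g 0) (g 1) (g 2) (g 3) (g 4) (g 5)"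
    unfolding hexagon_graph_def using nb[of 0] nb[of 1] nb[of 2] nb[of 3] nb[of 4] nb[of 5] VG unfolding sets
    by (simp add: inj)
  then show ?thesis by blast
qed

text \<open>Along the cycle the equations are \<open>x (i + 1) = x i - x (i - 1)\<close>, a recursion of period \<open>6\<close>; the two
dual functions are the periodic sequences with initial values \<open>1, 0\<close> and \<open>0, 1\<close>.\<close>

lemma hexagon_graph_mult:
  assumes G: "pair_graph G" and h: "hexagon_graph G c0 c1 c2 c3 c4 c5"
  shows "laplacian_mult G 1 = 2" "card (pverts G) = 6"
proof -
  have s: "simple_graph G" using pair_graph_simple[OF G] .
  have dist: "distinct [c0, c1, c2, c3, c4, c5]" and V: "pverts G = {c0, c1, c2, c3, c4, c5}" and
    N: "nbrs G c0 = {c5, c1}" "nbrs G c1 = {c0, c2}" "nbrs G c2 = {c1, c3}"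
     "nbrs G c3 = {c2, c4}" "nbrs G c4 = {c3, c5}" "nbrs G c5 = {c4, c0}"
    using h by (auto simp: hexagon_graph_def)
  have ne: "c5 \<noteq> c1" "c0 \<noteq> c2" "c1 \<noteq> c3" "c2 \<noteq> c4" "c3 \<noteq> c5" "c4 \<noteq> c0" "c0 \<noteq> c1" using dist by auto
  show "card (pverts G) = 6" using distinct_card[OF dist] V by simp
  have mem: "x \<in> eigenfunctions (parcs G) (pverts G) (\<lambda>v. deg G v) \<longleftrightarrow>
      (\<forall>v. v \<notin> pverts G \<longrightarrow> x v = 0) \<and> x c0 = x c5 + x c1 \<and> x c1 = x c0 + x c2 \<and> x c2 = x c1 + x c3 \<and>
      x c3 = x c2 + x c4 \<and> x c4 = x c3 + x c5 \<and> x c5 = x c4 + x c0" for x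
    unfolding eigenfunctions_def nbrs_in_graph[OF s] deg_nbrs mem_Collect_eq using N ne by (simp add: V)
  have "laplacian_mult G 1 = card {c0, c1}"
  proof (rule laplacian_mult_eq_card[OF G])
    show "{c0, c1} \<subseteq> pverts G" by (simp add: V)
  next
    fix x v assume x: "x \<in> eigenfunctions (parcs G) (pverts G) (\<lambda>v. deg G v)" and z: "\<forall>r\<in>{c0, c1}. x r = 0"
    have 0: "x c0 = 0" "x c1 = 0" using z by simp_all
    have eqs: "x c0 = x c5 + x c1" "x c1 = x c0 + x c2" "x c2 = x c1 + x c3" "x c5 = x c4 + x c0"
      using x unfolding mem by blast+
    have "x c5 = 0" "x c2 = 0" "x c3 = 0" "x c4 = 0" using 0 eqs by linarith+
    moreover have "v \<notin> pverts G \<Longrightarrow> x v = 0" using x unfolding mem by blast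
    ultimately show "x v = 0" using 0 unfolding V by blast
  next
    fix r assume r: "r \<in> {c0, c1}"
    define x where "x = (\<lambda>v. if v = c0 then 1 else if v = c2 \<or> v = c3 then -1 else if v = c5 then 1 else (0::real))"
    define y where "y = (\<lambda>v. if v = c1 \<or> v = c2 then 1 else if v = c4 \<or> v = c5 then -1 else (0::real))"
    have "x \<in> eigenfunctions (parcs G) (pverts G) (\<lambda>v. deg G v)"
      unfolding mem using dist by (auto simp: x_def V)
    moreover have "y \<in> eigenfunctions (parcs G) (pverts G) (\<lambda>v. deg G v)"
      unfolding mem using dist by (auto simp: y_def V)
    moreover have "x c0 = 1" "x c1 = 0" "y c0 = 0" "y c1 = 1" using dist by (auto simp: x_def y_def)
    ultimately show "\<exists>x\<in>eigenfunctions (parcs G) (pverts G) (\<lambda>v. deg G v). \<forall>s\<in>{c0, c1}. x s = (if r = s then 1 else 0)"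
      using r ne(7) by auto
  qed
  then show "laplacian_mult G 1 = 2" using ne(7) by simp
qed

text \<open>In a hexagon of \<open>W\<close> both units of weight are used inside the hexagon, so it is a component of \<open>G\<close>.
A vertex of an edge component of \<open>W\<close> has one neighbour left, which cannot be pendant and hence is in
\<open>Q\<close>.\<close>

lemma tight_connected_cases:
  assumes G: "pair_graph G" "connected_graph G"
    and t: "tight (parcs G) (pverts G) (\<lambda>v. deg G v) P Q W"
  shows "(\<exists>c0 c1 c2 c3 c4 c5. hexagon_graph G c0 c1 c2 c3 c4 c5) \<or> p6_structure G P Q W"
proof -
  have s: "simple_graph G" using pair_graph_simple[OF G(1)] .
  note N = simple_graph_nbrs[OF s]
  have V: "P \<union> Q \<union> W = pverts G" and dis: "P \<inter> Q = {}" "P \<inter> W = {}" "Q \<inter> W = {}"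
    and P: "\<And>p. p \<in> P \<Longrightarrow> \<exists>q\<in>Q. nbrs G p = {q}"
    and Q: "\<And>q. q \<in> Q \<Longrightarrow> (\<exists>p. nbrs G q \<inter> P = {p}) \<and> nbrs G q \<inter> Q = {}"
    and ex: "extremal (parcs G) W (\<lambda>v. deg G v)"
    using t by (auto simp: tight_def nbrs_in_graph[OF s])
  have W2: "card (nbrs G w) = 2" if "w \<in> W" for w using ex that by (simp add: extremal_def deg_nbrs)
  have NW: "nbrs_in (parcs G) W w = nbrs G w \<inter> W" for w by (auto simp: nbrs_in_def nbrs_def)
  show ?thesis
  proof (cases "\<exists>w\<in>W. in_hexagon_component (parcs G) W w")
    case True
    then obtain c0 c1 c2 c3 c4 c5 where c0: "c0 \<in> W" and dist: "distinct [c0, c1, c2, c3, c4, c5]" and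
      H: "nbrs_in (parcs G) W c0 = {c5, c1}" "nbrs_in (parcs G) W c1 = {c0, c2}" "nbrs_in (parcs G) W c2 = {c1, c3}"
        "nbrs_in (parcs G) W c3 = {c2, c4}" "nbrs_in (parcs G) W c4 = {c3, c5}" "nbrs_in (parcs G) W c5 = {c4, c0}"
      unfolding in_hexagon_component_def by blast
    have full: "nbrs G c = {x, y}" if "c \<in> W" "nbrs_in (parcs G) W c = {x, y}" "x \<noteq> y" for c x y
    proof -
      have "{x, y} \<subseteq> nbrs G c" using that(2) unfolding NW by blast
      then show ?thesis using card_seteq[OF N(2)[of c], of "{x, y}"] W2[OF that(1)] that(3) by simp
    qed
    have memW: "c1 \<in> W" "c2 \<in> W" "c3 \<in> W" "c4 \<in> W" "c5 \<in> W" using H unfolding NW by blast+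
    have ne: "c5 \<noteq> c1" "c0 \<noteq> c2" "c1 \<noteq> c3" "c2 \<noteq> c4" "c3 \<noteq> c5" "c4 \<noteq> c0" using dist by auto
    have F: "nbrs G c0 = {c5, c1}" "nbrs G c1 = {c0, c2}" "nbrs G c2 = {c1, c3}"
        "nbrs G c3 = {c2, c4}" "nbrs G c4 = {c3, c5}" "nbrs G c5 = {c4, c0}"
      using full[OF c0 H(1) ne(1)] full[OF memW(1) H(2) ne(2)] full[OF memW(2) H(3) ne(3)]
        full[OF memW(3) H(4) ne(4)] full[OF memW(4) H(5) ne(5)] full[OF memW(5) H(6) ne(6)] by simp_all
    have c0V: "c0 \<in> pverts G" using c0 V by blast
    have "pverts G \<subseteq> {c0, c1, c2, c3, c4, c5}"
      by (rule connected_closed[OF G c0V]) (use F in auto)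
    moreover have "{c0, c1, c2, c3, c4, c5} \<subseteq> pverts G" using c0V memW V by blast
    ultimately have "hexagon_graph G c0 c1 c2 c3 c4 c5" unfolding hexagon_graph_def using dist F by blast
    then show ?thesis by blast
  next
    case False
    have "p6_structure G P Q W" unfolding p6_structure_def
    proof (intro conjI ballI)
      show "\<exists>q\<in>Q. nbrs G p = {q}" if "p \<in> P" for p using P[OF that] .
    next
      fix q assume q: "q \<in> Q"
      obtain p where p: "nbrs G q \<inter> P = {p}" using Q[OF q] by blast
      have "nbrs G q \<subseteq> P \<union> Q \<union> W" using N(1)[of q] V by simp
      then have "nbrs G q = insert p (nbrs G q \<inter> W)" using p Q[OF q] by blast
      moreover have "p \<in> P" using p by blast
      ultimately show "\<exists>p\<in>P. \<exists>U\<subseteq>W. nbrs G q = insert p U" by blast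
    next
      fix w assume w: "w \<in> W"
      then have "in_edge_component (parcs G) W w" using ex False by (auto simp: extremal_def)
      then obtain w' where w': "nbrs G w \<inter> W = {w'}" unfolding in_edge_component_def NW by blast
      have w'W: "w' \<in> W" "w' \<in> nbrs G w" using w' by blast+
      obtain a b where ab: "nbrs G w = {a, b}" "a \<noteq> b" using W2[OF w] by (auto simp: card_2_iff)
      have "w' = a \<or> w' = b" using w'W(2) unfolding ab(1) by simp
      then obtain y where y: "y \<noteq> w'" "nbrs G w = {w', y}"
      proof
        assume "w' = a"
        then show thesis using that[of b] ab by simp
      next
        assume "w' = b"
        then show thesis using that[of a] ab by (simp add: insert_commute)
      qed
      have yN: "y \<in> nbrs G w" using y(2) by simp
      have "y \<notin> W" using w' yN y(1) by blast
      moreover have "y \<notin> P"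
      proof
        assume "y \<in> P"
        then obtain q where q: "q \<in> Q" "nbrs G y = {q}" using P by blast
        have "w \<in> nbrs G y" using N(4) yN by blast
        then have "w = q" unfolding q(2) by simp
        then show False using q(1) w dis(3) by blast
      qed
      ultimately have "y \<in> Q" using N(1)[of w] yN V by blast
      then show "\<exists>w'\<in>W. \<exists>q\<in>Q. nbrs G w = {w', q}" using w'W(1) y(2) by blast
    qed (use V dis in auto)
    then show ?thesis by blast
  qed
qed

lemma p6_structure_big_degree:
  assumes G: "simple_graph G" and S: "p6_structure G P Q W" and v: "v \<in> pverts G" "deg G v > 2"
  shows "v \<in> quasi_pendant_verts G"
proof -
  note D = p6_structureD[OF S]
  have c: "2 < card (nbrs G v)" using v(2) by (simp add: deg_nbrs)
  have "v \<notin> P"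
  proof
    assume "v \<in> P"
    then obtain q where "nbrs G v = {q}" using D(5) by blast
    then show False using c by simp
  qed
  moreover have "v \<notin> W"
  proof
    assume "v \<in> W"
    then obtain w q where "nbrs G v = {w, q}" using D(7) by blast
    then show False using c card_insert_le_m1[of 2 "{q}" w] by simp
  qed
  ultimately have "v \<in> Q" using v(1) D(1) by blast
  then obtain p U where p: "p \<in> P" "nbrs G v = insert p U" using D(6) by blast
  obtain q where "nbrs G p = {q}" using D(5)[OF p(1)] by blast
  then have "deg G p = 1" by (simp add: deg_nbrs)
  moreover have "p \<in> pverts G" using p(1) D(1) by blast
  moreover have "(v, p) \<in> parcs G" using p(2) by (auto simp: nbrs_def)
  ultimately show ?thesis using v(1) by (auto simp: quasi_pendant_verts_def pendant_verts_def)
qed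

theorem theorem1p2:
  fixes G :: "'a pair_pre_digraph" and n m :: nat and c :: int
  assumes "pair_graph G"
    and "connected_graph G"
    and "reduced G"
    and "n = card (pverts G)"
    and "n \<ge> 6"
    and "m = card (edges G)"
    and "c = int m - int n + 1"
  shows "real (laplacian_mult G 1) \<le> real_of_int c + (real n - 2) / 4 \<and>
    (real (laplacian_mult G 1) = real_of_int c + (real n - 2) / 4 \<longleftrightarrow>
      (graph_iso G (cycle_graph 6) \<and> c = 1) \<or>
      (tree_graph G \<and> c = 0 \<and>
       (\<forall>v \<in> pverts G. deg G v > 2 \<longrightarrow> v \<in> quasi_pendant_verts G) \<and>
       (\<forall>C \<in> final_reduction_components G. digraph_iso C (with_proj (path_graph 6)))))"
proof -
  note G = assms(1,2)
  have s: "simple_graph G" using pair_graph_simple[OF G(1)] .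
  have n3: "card (pverts G) \<ge> 3" using assms(4,5) by simp
  define \<mu> where "\<mu> = laplacian_mult G 1"
  have nb: "nullity_bound (parcs G) (pverts G) (\<lambda>v. deg G v) = 4 * c + int n - 2"
  proof -
    have "pverts G \<noteq> {}" using n3 by auto
    from graph_nullity_bound[OF G this] show ?thesis unfolding assms(4,6,7) by simp
  qed
  obtain k where k: "dim_at_most (eigenfunctions (parcs G) (pverts G) (\<lambda>v. deg G v)) k"
    "4 * int k \<le> 4 * c + int n - 2"
    "4 * int k = 4 * c + int n - 2 \<longrightarrow> (\<exists>P Q W. tight (parcs G) (pverts G) (\<lambda>v. deg G v) P Q W)"
    using reducible_bounded[OF connected_reduced_reducible[OF G assms(3) n3]] unfolding nb by blast
  have \<mu>k: "\<mu> \<le> k" unfolding \<mu>_def by (rule laplacian_mult_le[OF G(1) k(1)])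
  have final: "(\<forall>C \<in> final_reduction_components G. digraph_iso C (with_proj (path_graph 6))) \<longleftrightarrow>
      (\<exists>P Q W. p6_structure G P Q W)" by (rule final_components_iff_p6_structure[OF G n3])
  have le: "4 * int \<mu> \<le> 4 * c + int n - 2" using \<mu>k k(2) by linarith
  have "4 * int \<mu> = 4 * c + int n - 2 \<longleftrightarrow>
      (graph_iso G (cycle_graph 6) \<and> c = 1) \<or>
      (tree_graph G \<and> c = 0 \<and>
       (\<forall>v \<in> pverts G. deg G v > 2 \<longrightarrow> v \<in> quasi_pendant_verts G) \<and>
       (\<forall>C \<in> final_reduction_components G. digraph_iso C (with_proj (path_graph 6))))"
    (is "?eq \<longleftrightarrow> ?hex \<or> ?tree")
  proof
    assume eq: ?eq
    then have "4 * int k = 4 * c + int n - 2" using \<mu>k k(2) by linarith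
    then obtain P Q W where "tight (parcs G) (pverts G) (\<lambda>v. deg G v) P Q W" using k(3) by blast
    from tight_connected_cases[OF G this] show "?hex \<or> ?tree"
    proof
      assume "\<exists>c0 c1 c2 c3 c4 c5. hexagon_graph G c0 c1 c2 c3 c4 c5"
      then obtain c0 c1 c2 c3 c4 c5 where h: "hexagon_graph G c0 c1 c2 c3 c4 c5" by blast
      have "c = 1" using eq hexagon_graph_mult[OF G(1) h] assms(4) by (simp add: \<mu>_def)
      then show ?thesis using hexagon_graph_iso[OF s h] by blast
    next
      assume S: "p6_structure G P Q W"
      obtain r q where rq: "\<mu> = r" "n = 2 * q + 2 * r" "m = q + 3 * r"
        using p6_structure_counts[OF G(1) S] unfolding \<mu>_def assms(4,6) by blast
      have c0: "c = 0" using eq assms(7) unfolding rq by simp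
      have "card (edges G) + 1 = card (pverts G)" using c0 assms(4,6,7) by simp
      then have "tree_graph G" by (rule tree_of_edge_count[OF G])
      moreover have "\<forall>v \<in> pverts G. deg G v > 2 \<longrightarrow> v \<in> quasi_pendant_verts G"
        using p6_structure_big_degree[OF s S] by blast
      ultimately show ?thesis using c0 final S by blast
    qed
  next
    assume "?hex \<or> ?tree"
    then show ?eq
    proof
      assume hex: ?hex
      then obtain c0 c1 c2 c3 c4 c5 where h: "hexagon_graph G c0 c1 c2 c3 c4 c5"
        using iso_hexagon_graph[OF s] by blast
      show ?eq using hexagon_graph_mult[OF G(1) h] hex assms(4) by (simp add: \<mu>_def)
    next
      assume tree: ?tree
      then obtain P Q W where S: "p6_structure G P Q W" using final by blast
      obtain r q where rq: "\<mu> = r" "n = 2 * q + 2 * r" "m = q + 3 * r"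
        using p6_structure_counts[OF G(1) S] unfolding \<mu>_def assms(4,6) by blast
      have "c = 0" using tree by blast
      then show ?eq using assms(7) unfolding rq by simp
    qed
  qed
  moreover have "real \<mu> = real_of_int c + (real n - 2) / 4 \<longleftrightarrow>
      real_of_int (4 * int \<mu>) = real_of_int (4 * c + int n - 2)" by (simp add: field_simps)
  moreover have "real \<mu> \<le> real_of_int c + (real n - 2) / 4 \<longleftrightarrow>
      real_of_int (4 * int \<mu>) \<le> real_of_int (4 * c + int n - 2)" by (simp add: field_simps)
  ultimately show ?thesis using le unfolding \<mu>_def[symmetric] by (simp only: of_int_eq_iff of_int_le_iff)
qed

end
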